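(* Let $M$ be a simple matroid of rank $r$ on a finite ground set $E$ with $|E|=n$, and let $G$ be a group of automorphisms of $M$. Then for every integer $i\ge 0$ the following three representations of $G$ over $\mathbb{C}$ are isomorphic, and they are nonzero only for $i=r-2$: 1. $\widetilde{H}_{n-3-i}(IN(M^{*}),\mathbb{C})\otimes \mathrm{sgn}$; 2. $\widetilde{H}_{i}(NS(M),\mathbb{C})$; 3. $\widetilde{H}_{i}(\mathcal{L}(M),\mathbb{C})$.
   Context: $M^{*}$ is the dual matroid of $M$. $IN(M^{*})$ is the abstract simplicial complex on $E$ whose faces are the independent sets of $M^*$. $NS(M)$ is the abstract simplicial complex of non-spanning subsets of $M$: $NS(M)=\{A\subseteq E : \mathrm{rk}(A)<\mathrm{rk}(E)\}$. $\mathcal{L}(M)$ is the lattice of flats of $M$ ordered by inclusion; with $\widehat 0,\widehat 1$ its minimum and maximum, $\widetilde{H}_i(\mathcal{L}(M),\mathbb{C})$ denotes the reduced simplicial homology of the order complex of $\mathcal{L}(M)\smallsetminus\{\widehat 0,\widehat 1\}$ (simplices are the finite chains). Reduced homology is computed with the augmented chain complex, in which the empty face sits in degree $-1$. An automorphism of $M$ is a permutation of $E$ preserving the family of independent sets; $G$ acts on each of the complexes by simplicial automorphisms, and on oriented simplices by $g[j_1,\dots,j_{k}]=[g(j_1),\dots,g(j_k)]$, hence on reduced homology. $\mathrm{sgn}$ is the one-dimensional representation of $G$ given by restricting the sign representation of the symmetric group $\mathfrak{S}_n$ of permutations of $E$ to its subgroup $G$. *)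

theory Defs
  imports Complex_Main "HOL-Combinatorics.Permutations" "HOL-Algebra.Group"
begin

section \<open>Finite matroids\<close>

locale matroid =
  fixes E :: "'a set" and \<I> :: "'a set set"
  assumes finite_ground: "finite E"
    and indep_subset: "X \<in> \<I> \<Longrightarrow> X \<subseteq> E"
    and indep_empty: "{} \<in> \<I>"
    and indep_mono: "X \<in> \<I> \<Longrightarrow> Y \<subseteq> X \<Longrightarrow> Y \<in> \<I>"
    and indep_augment:
      "X \<in> \<I> \<Longrightarrow> Y \<in> \<I> \<Longrightarrow> card X < card Y \<Longrightarrow> \<exists>y \<in> Y - X. insert y X \<in> \<I>"

definition bases :: "'a set set \<Rightarrow> 'a set set" where
  "bases \<I> = {B \<in> \<I>. \<forall>X \<in> \<I>. B \<subseteq> X \<longrightarrow> X = B}"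

definition rk :: "'a set set \<Rightarrow> 'a set \<Rightarrow> nat" where
  "rk \<I> A = Max (card ` {X \<in> \<I>. X \<subseteq> A})"

text \<open>Neither loops nor parallel elements, i.e. no circuit with at most two elements.\<close>

definition simple_matroid :: "'a set \<Rightarrow> 'a set set \<Rightarrow> bool" where
  "simple_matroid E \<I> \<longleftrightarrow> matroid E \<I> \<and> (\<forall>X \<subseteq> E. card X \<le> 2 \<longrightarrow> X \<in> \<I>)"

text \<open>The independent sets of the dual: the bases of the dual are the complements of bases.\<close>

definition dual_indep :: "'a set \<Rightarrow> 'a set set \<Rightarrow> 'a set set" where
  "dual_indep E \<I> = {A. \<exists>B \<in> bases \<I>. A \<subseteq> E - B}"

definition nonspanning :: "'a set \<Rightarrow> 'a set set \<Rightarrow> 'a set set" where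
  "nonspanning E \<I> = {A. A \<subseteq> E \<and> rk \<I> A < rk \<I> E}"

definition flats :: "'a set \<Rightarrow> 'a set set \<Rightarrow> 'a set set" where
  "flats E \<I> = {F. F \<subseteq> E \<and> (\<forall>x \<in> E - F. rk \<I> F < rk \<I> (insert x F))}"

definition matroid_aut :: "'a set \<Rightarrow> 'a set set \<Rightarrow> ('a \<Rightarrow> 'a) monoid" where
  "matroid_aut E \<I> =
     \<lparr>carrier = {g. g permutes E \<and> (\<forall>A \<subseteq> E. g ` A \<in> \<I> \<longleftrightarrow> A \<in> \<I>)}, mult = (\<circ>), one = id\<rparr>"


section \<open>Order complexes\<close>

definition proper_part :: "'a set set \<Rightarrow> 'a set set" where
  "proper_part L = {F \<in> L. \<not> (\<forall>F' \<in> L. F \<subseteq> F') \<and> \<not> (\<forall>F' \<in> L. F' \<subseteq> F)}"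

definition order_complex :: "'a set set \<Rightarrow> 'a set set set" where
  "order_complex P = {C. finite C \<and> subset.chain P C}"


section \<open>Reduced simplicial homology\<close>

text \<open>
  A complex is the set of its faces, the empty face included.  A list of distinct vertices whose
  set is a face stands for an oriented simplex, and a \<open>k\<close>-chain assigns to each oriented
  \<open>k\<close>-simplex its coefficient; thus it takes opposite values on opposite orientations and is the
  formal sum of the oriented simplices, one orientation being chosen for each face.
  The degree \<open>k\<close> is an integer; the empty list has degree \<open>-1\<close>, and for \<open>k < -1\<close> the only
  chain is \<open>0\<close>.
\<close>

definition chains :: "'v set set \<Rightarrow> int \<Rightarrow> ('v list \<Rightarrow> complex) set" where
  "chains \<Delta> k =
     {c. finite {l. c l \<noteq> 0}
       \<and> (\<forall>l. c l \<noteq> 0 \<longrightarrow> distinct l \<and> set l \<in> \<Delta> \<and> int (length l) = k + 1)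
       \<and> (\<forall>l \<pi>. \<pi> permutes set l \<longrightarrow> c (map \<pi> l) = of_int (sign \<pi>) * c l)}"

text \<open>
  The oriented simplices with \<open>[l]\<close> in their boundary are, up to orientation, the \<open>[v # l]\<close>, and
  there the coefficient is \<open>+1\<close>.  The lemma \<open>boundary_oriented_simplex\<close> below recovers the usual
  alternating sum.
\<close>

definition boundary :: "('v list \<Rightarrow> complex) \<Rightarrow> 'v list \<Rightarrow> complex" where
  "boundary c l = (\<Sum>v | c (v # l) \<noteq> 0. c (v # l))"

definition cycles :: "'v set set \<Rightarrow> int \<Rightarrow> ('v list \<Rightarrow> complex) set" where
  "cycles \<Delta> k = {c \<in> chains \<Delta> k. boundary c = (\<lambda>_. 0)}"

definition boundaries :: "'v set set \<Rightarrow> int \<Rightarrow> ('v list \<Rightarrow> complex) set" where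
  "boundaries \<Delta> k = boundary ` chains \<Delta> (k + 1)"

definition homologous :: "'v set set \<Rightarrow> int \<Rightarrow> (('v list \<Rightarrow> complex) \<times> ('v list \<Rightarrow> complex)) set" where
  "homologous \<Delta> k =
     {(x, y). x \<in> cycles \<Delta> k \<and> y \<in> cycles \<Delta> k \<and> (\<lambda>l. x l - y l) \<in> boundaries \<Delta> k}"

text \<open>
  The linear map on chains with \<open>[j\<^sub>1, \<dots>, j\<^sub>k] \<mapsto> [h j\<^sub>1, \<dots>, h j\<^sub>k]\<close>, for a bijection \<open>h\<close> of the
  vertex type.
\<close>

definition chain_map :: "('v \<Rightarrow> 'v) \<Rightarrow> ('v list \<Rightarrow> complex) \<Rightarrow> 'v list \<Rightarrow> complex" where
  "chain_map h c = (\<lambda>l. c (map (inv_into UNIV h) l))"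

definition oriented_simplex :: "'v list \<Rightarrow> 'v list \<Rightarrow> complex" where
  "oriented_simplex l m = (\<Sum>\<pi> | \<pi> permutes set l \<and> map \<pi> l = m. of_int (sign \<pi>))"


lemma oriented_simplex_support:
  assumes "distinct l" "oriented_simplex l m \<noteq> 0"
  shows "distinct m \<and> set m = set l \<and> length m = length l"
proof -
  obtain \<pi> where p: "\<pi> permutes set l" "map \<pi> l = m"
    using assms(2) unfolding oriented_simplex_def by (metis (mono_tags, lifting) mem_Collect_eq sum.neutral)
  then show ?thesis
    using assms(1) permutes_image[OF p(1)] by (auto simp: distinct_map permutes_inj_on[OF p(1)])
qed

lemma oriented_simplex_map:
  assumes "distinct l" "\<pi> permutes set l"
  shows "oriented_simplex l (map \<pi> l) = of_int (sign \<pi>)"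
proof -
  have "{\<rho>. \<rho> permutes set l \<and> map \<rho> l = map \<pi> l} = {\<pi>}"
    using assms(2) by (auto simp: permutes_def fun_eq_iff) metis
  then show ?thesis by (simp add: oriented_simplex_def)
qed

lemma oriented_simplex_permutation:
  assumes "distinct l" "distinct m" "set m = set l"
  shows "\<exists>\<pi>. \<pi> permutes set l \<and> m = map \<pi> l"
proof -
  have len: "length m = length l"
    using assms by (metis distinct_card)
  define \<pi> where "\<pi> x = (case map_of (zip l m) x of Some y \<Rightarrow> y | None \<Rightarrow> x)" for x
  have nth: "\<pi> (l ! i) = m ! i" if "i < length l" for i
    using map_of_zip_nth[OF len[symmetric] assms(1), of i] that by (simp add: \<pi>_def len)
  have m: "map \<pi> l = m"
    by (rule nth_equalityI) (auto simp: nth len)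
  have "bij_betw \<pi> (set l) (set l)"
    unfolding bij_betw_def using m assms by (metis distinct_map list.set_map)
  moreover have "\<pi> x = x" if "x \<notin> set l" for x
  proof -
    have "map_of (zip l m) x = None" using that len by (simp add: map_of_zip_is_None)
    then show ?thesis by (simp add: \<pi>_def)
  qed
  ultimately have "\<pi> permutes set l" by (rule bij_imp_permutes)
  with m show ?thesis by metis
qed

lemma oriented_simplex_alternating:
  assumes "distinct l" "\<pi> permutes set m"
  shows "oriented_simplex l (map \<pi> m) = of_int (sign \<pi>) * oriented_simplex l m"
proof (cases "distinct m \<and> set m = set l")
  case True
  then obtain \<rho> where r: "\<rho> permutes set l" "m = map \<rho> l"
    using oriented_simplex_permutation[OF assms(1)] by metis
  have p: "\<pi> permutes set l" using assms True by simp
  have "sign (\<pi> \<circ> \<rho>) = sign \<pi> * sign \<rho>"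
    by (rule sign_compose) (use r p in \<open>auto intro: permutation_permutes[THEN iffD2]\<close>)
  then show ?thesis
    using oriented_simplex_map[OF assms(1) permutes_compose[OF r(1) p]]
      oriented_simplex_map[OF assms(1) r(1)] r(2) by simp
next
  case False
  have "set (map \<pi> m) = set m" using permutes_image[OF assms(2)] by simp
  moreover have "distinct (map \<pi> m) = distinct m"
    using permutes_inj_on[OF assms(2)] by (simp add: distinct_map)
  ultimately show ?thesis
    using False oriented_simplex_support[OF assms(1)] by (metis mult_zero_right)
qed

lemma oriented_simplex_in_chains:
  assumes "distinct l" "set l \<in> \<Delta>"
  shows "oriented_simplex l \<in> chains \<Delta> (int (length l) - 1)"
proof -
  have "{m. oriented_simplex l m \<noteq> 0} \<subseteq> {m. set m \<subseteq> set l \<and> length m = length l}"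
    using oriented_simplex_support[OF assms(1)] by auto
  then have "finite {m. oriented_simplex l m \<noteq> 0}"
    using finite_lists_length_eq[OF finite_set] by (rule finite_subset)
  then show ?thesis
    using oriented_simplex_support[OF assms(1)] oriented_simplex_alternating[OF assms(1)] assms
    by (auto simp: chains_def)
qed

lemma oriented_simplex_move:
  assumes "distinct l"
  shows "oriented_simplex l (v # xs @ ys) = (- 1) ^ length xs * oriented_simplex l (xs @ v # ys)"
proof (induction xs arbitrary: ys rule: rev_induct)
  case Nil
  show ?case by simp
next
  case (snoc a xs)
  have swap: "oriented_simplex l (xs @ v # a # ys) = - oriented_simplex l (xs @ a # v # ys)"
  proof (cases "distinct (xs @ a # v # ys)")
    case True
    have t: "transpose a v permutes set (xs @ a # v # ys)"
      by (rule permutes_swap_id) auto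
    have "map (transpose a v) (xs @ a # v # ys) = xs @ v # a # ys"
      using True by (auto intro!: map_idI simp: transpose_def)
    moreover have "sign (transpose a v) = - 1" using True by (auto simp: sign_swap_id)
    ultimately show ?thesis using oriented_simplex_alternating[OF assms t] by simp
  next
    case False
    then have "\<not> distinct (xs @ v # a # ys)" by auto
    with False show ?thesis using oriented_simplex_support[OF assms] by (metis neg_0_equal_iff_equal)
  qed
  show ?case using snoc.IH[of "a # ys"] swap by simp
qed

lemma boundary_oriented_simplex:
  assumes "distinct l"
  shows "boundary (oriented_simplex l) =
    (\<lambda>m. \<Sum>i<length l. (- 1) ^ i * oriented_simplex (take i l @ drop (Suc i) l) m)"
proof
  fix m
  have split: "l = take i l @ l ! i # drop (Suc i) l" if "i < length l" for i
    using that by (rule id_take_nth_drop)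
  have dist: "distinct (take i l @ drop (Suc i) l)"
    and face: "set (take i l @ drop (Suc i) l) = set l - {l ! i}" if "i < length l" for i
  proof -
    have d: "distinct (take i l @ l ! i # drop (Suc i) l)"
      and s: "set l = set (take i l @ l ! i # drop (Suc i) l)"
      using assms split[OF that] by auto
    show "distinct (take i l @ drop (Suc i) l)" using d by auto
    show "set (take i l @ drop (Suc i) l) = set l - {l ! i}" unfolding s using d by auto
  qed
  show "boundary (oriented_simplex l) m =
    (\<Sum>i<length l. (- 1) ^ i * oriented_simplex (take i l @ drop (Suc i) l) m)"
  proof (cases "\<exists>i<length l. distinct m \<and> set m = set l - {l ! i}")
    case True
    then obtain i where i: "i < length l" "distinct m" "set m = set l - {l ! i}" by blast
    let ?xs = "take i l" and ?ys = "drop (Suc i) l"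
    have other: "oriented_simplex l (v # m) = 0" if "v \<noteq> l ! i" for v
    proof (rule ccontr)
      assume "oriented_simplex l (v # m) \<noteq> 0"
      then have "distinct (v # m)" "set (v # m) = set l"
        using oriented_simplex_support[OF assms] by blast+
      then show False using i that by (metis DiffI insertI1 list.simps(15) nth_mem singletonD
            distinct.simps(2) insert_iff)
    qed
    have "boundary (oriented_simplex l) m = (\<Sum>v\<in>{l ! i}. oriented_simplex l (v # m))"
      unfolding boundary_def by (rule sum.mono_neutral_left) (use other in auto)
    also have "\<dots> = oriented_simplex l (l ! i # m)" by simp
    also have "\<dots> = (- 1) ^ i * oriented_simplex (?xs @ ?ys) m"
    proof -
      obtain \<pi> where p: "\<pi> permutes set (?xs @ ?ys)" "m = map \<pi> (?xs @ ?ys)"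
        using oriented_simplex_permutation[OF dist[OF i(1)], of m] face[OF i(1)] i by metis
      have fixed: "\<pi> (l ! i) = l ! i"
        using p(1) face[OF i(1)] by (auto intro: permutes_not_in)
      have p': "\<pi> permutes set (l ! i # ?xs @ ?ys)"
        by (rule permutes_subset[OF p(1)]) auto
      have eq: "l ! i # m = map \<pi> (l ! i # ?xs @ ?ys)" using p(2) fixed by simp
      have "oriented_simplex l (l ! i # m) =
          of_int (sign \<pi>) * oriented_simplex l (l ! i # ?xs @ ?ys)"
        unfolding eq by (rule oriented_simplex_alternating[OF assms p'])
      also have "oriented_simplex l (l ! i # ?xs @ ?ys) = (- 1) ^ i * oriented_simplex l l"
        using oriented_simplex_move[OF assms, of "l ! i" ?xs ?ys] split[OF i(1)] i(1) by simp
      also have "oriented_simplex l l = 1"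
        using oriented_simplex_map[OF assms permutes_id] by simp
      finally show ?thesis
        using oriented_simplex_map[OF dist[OF i(1)] p(1)] p(2) by simp
    qed
    also have "\<dots> = (\<Sum>j\<in>{i}. (- 1) ^ j * oriented_simplex (take j l @ drop (Suc j) l) m)"
      by simp
    also have "\<dots> = (\<Sum>j<length l. (- 1) ^ j * oriented_simplex (take j l @ drop (Suc j) l) m)"
    proof (rule sum.mono_neutral_left)
      show "\<forall>j\<in>{..<length l} - {i}. (- 1) ^ j * oriented_simplex (take j l @ drop (Suc j) l) m = 0"
      proof
        fix j assume j: "j \<in> {..<length l} - {i}"
        then have "l ! j \<noteq> l ! i" "l ! j \<in> set l"
          using assms i(1) by (auto simp: nth_eq_iff_index_eq)
        then have "set m \<noteq> set l - {l ! j}" using i(3) by blast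
        then have "oriented_simplex (take j l @ drop (Suc j) l) m = 0"
          using oriented_simplex_support[OF dist] face j by blast
        then show "(- 1) ^ j * oriented_simplex (take j l @ drop (Suc j) l) m = 0" by simp
      qed
    qed (use i in auto)
    finally show ?thesis .
  next
    case False
    have "oriented_simplex l (v # m) = 0" for v
    proof (rule ccontr)
      assume "oriented_simplex l (v # m) \<noteq> 0"
      then have v: "distinct (v # m)" "set (v # m) = set l"
        using oriented_simplex_support[OF assms] by blast+
      then obtain i where "i < length l" "l ! i = v" by (metis in_set_conv_nth list.set_intros(1))
      moreover have "set m = set l - {v}" using v by auto
      ultimately show False using False v(1) by auto
    qed
    moreover have "oriented_simplex (take i l @ drop (Suc i) l) m = 0" if "i < length l" for i
      using oriented_simplex_support[OF dist[OF that], of m] face[OF that] False that by blast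
    ultimately show ?thesis by (simp add: boundary_def)
  qed
qed

lemma chain_map_oriented_simplex:
  assumes "bij h" "distinct l"
  shows "chain_map h (oriented_simplex l) = oriented_simplex (map h l)"
proof
  fix m
  let ?h = "inv_into UNIV h"
  have hh: "h (?h x) = x" "?h (h x) = x" for x
    using assms(1) by (simp_all add: bij_is_surj surj_f_inv_f bij_is_inj)
  have d: "distinct (map h l)"
    using assms by (simp add: distinct_map bij_is_inj inj_on_subset[OF bij_is_inj])
  show "chain_map h (oriented_simplex l) m = oriented_simplex (map h l) m"
  proof (cases "distinct m \<and> set m = h ` set l")
    case True
    have "distinct (map ?h m)" "set (map ?h m) = set l"
      using True bij_imp_bij_inv[OF assms(1)]
      by (auto simp: distinct_map image_image hh intro: inj_on_subset[OF bij_is_inj])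
    then obtain \<pi> where p: "\<pi> permutes set l" "map ?h m = map \<pi> l"
      using oriented_simplex_permutation[OF assms(2)] by blast
    let ?q = "map_permutation (set l) h \<pi>"
    have inj: "inj_on h (set l)"
      using bij_is_inj[OF assms(1)] by (rule inj_on_subset) simp
    have q: "?q permutes set (map h l)"
      using map_permutation_permutes[OF inj_on_imp_bij_betw[OF inj] p(1)] by simp
    have "?q (h x) = h (\<pi> x)" if "x \<in> set l" for x
      using map_permutation_apply[OF inj that] .
    then have "map ?q (map h l) = map h (map \<pi> l)" by simp
    also have "\<dots> = map h (map ?h m)" using p(2) by simp
    also have "\<dots> = m" by (simp add: comp_def hh)
    finally have m: "map ?q (map h l) = m" .
    have "sign ?q = sign \<pi>"
      by (rule sign_map_permutation[OF inj p(1)]) simp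
    then show ?thesis
      using oriented_simplex_map[OF d q] m oriented_simplex_map[OF assms(2) p(1)] p(2)
      by (simp add: chain_map_def)
  next
    case False
    then have "\<not> (distinct (map ?h m) \<and> set (map ?h m) = set l)"
      using hh by (metis (no_types, lifting) distinct_map image_image image_ident list.set_map image_cong)
    then show ?thesis
      using False oriented_simplex_support[OF assms(2)] oriented_simplex_support[OF d]
      unfolding chain_map_def by (metis list.set_map)
  qed
qed


section \<open>Complex representations\<close>

record ('g, 'w) complex_rep =
  rep_space :: "'w set"
  rep_zero :: 'w
  rep_add :: "'w \<Rightarrow> 'w \<Rightarrow> 'w"
  rep_scale :: "complex \<Rightarrow> 'w \<Rightarrow> 'w"
  rep_act :: "'g \<Rightarrow> 'w \<Rightarrow> 'w"

definition rep_iso :: "'g set \<Rightarrow> ('g, 'w) complex_rep \<Rightarrow> ('g, 'u) complex_rep \<Rightarrow> bool" where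
  "rep_iso G V W \<longleftrightarrow>
     (\<exists>f. bij_betw f (rep_space V) (rep_space W)
        \<and> (\<forall>x \<in> rep_space V. \<forall>y \<in> rep_space V. f (rep_add V x y) = rep_add W (f x) (f y))
        \<and> (\<forall>a. \<forall>x \<in> rep_space V. f (rep_scale V a x) = rep_scale W a (f x))
        \<and> (\<forall>g \<in> G. \<forall>x \<in> rep_space V. f (rep_act V g x) = rep_act W g (f x)))"

definition zero_rep :: "('g, 'w) complex_rep \<Rightarrow> bool" where
  "zero_rep V \<longleftrightarrow> rep_space V = {rep_zero V}"

text \<open>
  The tensor product of \<open>V\<close> with the one-dimensional representation given by the character
  \<open>\<chi>\<close>, on the space of \<open>V\<close> itself via \<open>v \<otimes> 1 \<mapsto> v\<close>.
\<close>

definition tensor_character ::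
  "('g, 'w) complex_rep \<Rightarrow> ('g \<Rightarrow> complex) \<Rightarrow> ('g, 'w) complex_rep" where
  "tensor_character V \<chi> = V\<lparr>rep_act := (\<lambda>g x. rep_scale V (\<chi> g) (rep_act V g x))\<rparr>"

definition sgn_character :: "('a \<Rightarrow> 'a) \<Rightarrow> complex" where
  "sgn_character g = of_int (sign g)"

text \<open>
  The reduced homology of \<open>\<Delta>\<close> in degree \<open>k\<close>, for the action of \<open>g\<close> on the vertices by \<open>\<phi> g\<close>.
\<close>

definition homology_rep ::
  "('g \<Rightarrow> 'v \<Rightarrow> 'v) \<Rightarrow> 'v set set \<Rightarrow> int \<Rightarrow> ('g, ('v list \<Rightarrow> complex) set) complex_rep" where
  "homology_rep \<phi> \<Delta> k =
     \<lparr>rep_space = cycles \<Delta> k // homologous \<Delta> k,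
      rep_zero = homologous \<Delta> k `` {\<lambda>_. 0},
      rep_add = (\<lambda>X Y. \<Union>x \<in> X. \<Union>y \<in> Y. homologous \<Delta> k `` {\<lambda>l. x l + y l}),
      rep_scale = (\<lambda>a X. \<Union>x \<in> X. homologous \<Delta> k `` {\<lambda>l. a * x l}),
      rep_act = (\<lambda>g X. \<Union>x \<in> X. homologous \<Delta> k `` {chain_map (\<phi> g) x})\<rparr>"

definition dual_indep_homology ::
  "'a set \<Rightarrow> 'a set set \<Rightarrow> int \<Rightarrow> ('a \<Rightarrow> 'a, ('a list \<Rightarrow> complex) set) complex_rep" where
  "dual_indep_homology E \<I> k = homology_rep (\<lambda>g. g) (dual_indep E \<I>) k"

definition nonspanning_homology ::
  "'a set \<Rightarrow> 'a set set \<Rightarrow> int \<Rightarrow> ('a \<Rightarrow> 'a, ('a list \<Rightarrow> complex) set) complex_rep" where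
  "nonspanning_homology E \<I> k = homology_rep (\<lambda>g. g) (nonspanning E \<I>) k"

definition flats_homology ::
  "'a set \<Rightarrow> 'a set set \<Rightarrow> int \<Rightarrow> ('a \<Rightarrow> 'a, ('a set list \<Rightarrow> complex) set) complex_rep" where
  "flats_homology E \<I> k =
     homology_rep (\<lambda>g F. g ` F) (order_complex (proper_part (flats E \<I>))) k"

end

theory Submission
  imports Defs
begin

text \<open>
  Write \<open>N\<close> for the complex of nonspanning sets and \<open>r\<close> for the rank.

  Passing to complements turns the independent sets of the dual matroid into the sets that are
  not faces of \<open>N\<close>, so the first isomorphism is Alexander duality. On chains, let \<open>star\<close> send an
  oriented simplex to its complement, oriented by a fixed volume form on the ground set; a permutation
  of the ground set multiplies the volume form by its sign, which accounts for the factor \<open>sgn\<close>.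
  Under \<open>star\<close> the boundary becomes the coboundary, so Alexander duality naturally relates homology to
  cohomology. Since the chain groups carry an inner product invariant under permutations, each homology
  class of the Alexander dual has exactly one harmonic representative \<open>z\<close>, and harmonicity of \<open>z\<close> says
  precisely that the boundary of \<open>star z\<close> lies in \<open>N\<close>. The isomorphism sends the class of \<open>z\<close> to the class of
  \<open>boundary (star z)\<close>; see \<open>alexander_duality\<close>. It is complex linear and equivariant, and so relates
  homology to homology and not to its dual.

  For the second isomorphism, consider the complex whose faces consist of a nonspanning set \<open>A\<close> together
  with a chain of proper flats all containing \<open>A\<close>. It contains \<open>N\<close> and the order complex of the proper
  flats. It arises from either of them by steps that do not change the homology, because the faces
  added in one step are paired off by adding and removing one fixed vertex: an element of the new
  flat in one case, the closure of the new set in the other (\<open>rel_acyclic_toggle\<close>,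
  \<open>rel_acyclic_add_closed\<close>, \<open>rel_acyclic_add_sets\<close>). Both inclusions are equivariant.

  For the vanishing, sets with fewer than \<open>r\<close> elements are nonspanning, so \<open>N\<close> contains
  the full simplex up to dimension \<open>r - 2\<close> and has no homology below that degree; chains of proper flats have fewer
  than \<open>r\<close> members, so the order complex has no homology above degree \<open>r - 2\<close>. The isomorphisms
  combine the two bounds.

  Both isomorphisms are obtained from linear relations between cycles rather than from maps, by
  \<open>rep_iso_of_correspondence\<close>: harmonic representatives and inverses of inclusions on
  homology then enter without any choices.
\<close>

section \<open>Alternating functions on lists\<close>

definition enum :: "'v set \<Rightarrow> 'v list" where
  "enum A = (SOME l. distinct l \<and> set l = A)"

lemma enum:
  assumes "finite A"
  shows "distinct (enum A)" "set (enum A) = A"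
proof -
  have "distinct (enum A) \<and> set (enum A) = A"
    unfolding enum_def by (rule someI_ex) (use finite_distinct_list[OF assms] in blast)
  then show "distinct (enum A)" "set (enum A) = A" by auto
qed

definition alternating :: "('v list \<Rightarrow> complex) \<Rightarrow> bool" where
  "alternating c \<longleftrightarrow> (\<forall>l. c l \<noteq> 0 \<longrightarrow> distinct l)
     \<and> (\<forall>l \<pi>. \<pi> permutes set l \<longrightarrow> c (map \<pi> l) = of_int (sign \<pi>) * c l)"

lemma alternating_perm:
  assumes "alternating c" "\<pi> permutes set l"
  shows "c (map \<pi> l) = of_int (sign \<pi>) * c l"
  using assms unfolding alternating_def by blast

lemma alternating_nondistinct: "alternating c \<Longrightarrow> \<not> distinct l \<Longrightarrow> c l = 0"
  unfolding alternating_def by blast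

lemma alternating_zero [simp]: "alternating (\<lambda>_. 0)"
  by (simp add: alternating_def)

lemma alternating_add: "alternating c \<Longrightarrow> alternating d \<Longrightarrow> alternating (\<lambda>l. c l + d l)"
  unfolding alternating_def by (auto simp: distrib_left) (metis add.right_neutral)

lemma alternating_scale: "alternating c \<Longrightarrow> alternating (\<lambda>l. a * c l)"
  unfolding alternating_def by auto

lemma alternating_sum: "(\<And>v. v \<in> A \<Longrightarrow> alternating (f v)) \<Longrightarrow> alternating (\<lambda>l. \<Sum>v\<in>A. f v l)"
  by (induction A rule: infinite_finite_induct) (auto intro: alternating_add)

lemma alternating_oriented_simplex: "distinct l \<Longrightarrow> alternating (oriented_simplex l)"
  unfolding alternating_def
  using oriented_simplex_support oriented_simplex_alternating by blast

lemma alternating_same_set: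
  assumes "alternating c" "distinct l" "distinct m" "set m = set l"
  shows "c m = oriented_simplex l m * c l"
proof -
  obtain \<pi> where p: "\<pi> permutes set l" "m = map \<pi> l"
    using oriented_simplex_permutation[OF assms(2-4)] by blast
  then show ?thesis
    using alternating_perm[OF assms(1) p(1)] oriented_simplex_map[OF assms(2) p(1)] by simp
qed

lemma oriented_simplex_cases:
  assumes "distinct l" "distinct m" "set m = set l"
  shows "oriented_simplex l m = 1 \<or> oriented_simplex l m = - 1"
proof -
  obtain \<pi> where p: "\<pi> permutes set l" "m = map \<pi> l"
    using oriented_simplex_permutation[OF assms] by blast
  then show ?thesis
    using oriented_simplex_map[OF assms(1) p(1)] by (cases \<pi> rule: sign_cases) auto
qed

lemma alternating_zero_iff:
  assumes "alternating c" "distinct l" "distinct m" "set m = set l"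
  shows "c m = 0 \<longleftrightarrow> c l = 0"
  using alternating_same_set[OF assms] oriented_simplex_cases[OF assms(2-4)] by auto

lemma alternating_zero_enum:
  assumes "alternating c" "c (enum (set l)) = 0"
  shows "c l = 0"
proof (cases "distinct l")
  case True
  then show ?thesis
    using alternating_zero_iff[OF assms(1) enum(1), of "set l" l] assms(2) by (simp add: enum)
qed (use alternating_nondistinct[OF assms(1)] in blast)

text \<open>
  The two signs cancel, so the product depends on the face alone. This makes the sum over faces
  that defines the inner product independent of the chosen orderings.
\<close>

lemma alternating_mult_cnj:
  assumes "alternating c" "alternating d" "distinct l" "distinct m" "set m = set l"
  shows "c m * cnj (d m) = c l * cnj (d l)"
  using alternating_same_set[OF assms(1,3-5)] alternating_same_set[OF assms(2,3-5)]
    oriented_simplex_cases[OF assms(3-5)] by auto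

lemma alternating_swap:
  assumes "alternating c"
  shows "c (v # w # l) = - c (w # v # l)"
proof (cases "distinct (v # w # l)")
  case True
  have t: "transpose v w permutes set (w # v # l)"
    by (rule permutes_swap_id) auto
  have "map (transpose v w) (w # v # l) = v # w # l"
    using True by (auto intro!: map_idI simp: transpose_def)
  moreover have "sign (transpose v w) = - 1" using True by (auto simp: sign_swap_id)
  ultimately show ?thesis using alternating_perm[OF assms t] by simp
next
  case False
  moreover from False have "\<not> distinct (w # v # l)" by auto
  ultimately show ?thesis using alternating_nondistinct[OF assms] by (metis neg_0_equal_iff_equal)
qed

lemma alternating_map:
  assumes "alternating c" "inj_on h (set l)" "\<pi> permutes set l"
  shows "c (map h (map \<pi> l)) = of_int (sign \<pi>) * c (map h l)"
proof -
  let ?q = "map_permutation (set l) h \<pi>"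
  have q: "?q permutes set (map h l)"
    using map_permutation_permutes[OF inj_on_imp_bij_betw[OF assms(2)] assms(3)] by simp
  have "?q (h x) = h (\<pi> x)" if "x \<in> set l" for x
    using map_permutation_apply[OF assms(2) that] .
  then have "map ?q (map h l) = map h (map \<pi> l)" by simp
  moreover have "sign ?q = sign \<pi>"
    by (rule sign_map_permutation[OF assms(2,3)]) simp
  ultimately show ?thesis using alternating_perm[OF assms(1) q] by metis
qed

lemma permutes_append_fix:
  assumes "\<pi> permutes set m" "set l \<inter> set m = {}"
  shows "map \<pi> l = l"
  using assms by (auto intro!: map_idI simp: permutes_def)

section \<open>Chains on a finite vertex set\<close>

definition restrict_chain :: "'v set set \<Rightarrow> ('v list \<Rightarrow> complex) \<Rightarrow> 'v list \<Rightarrow> complex" where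
  "restrict_chain S c l = (if set l \<in> S then c l else 0)"

text \<open>
  The cone over a chain with apex \<open>w\<close>, as exterior multiplication by \<open>w\<close>. Evaluating the chain on an
  ordering that depends only on the face makes the result alternating by construction;
  \<open>wedge_Cons\<close> recovers the expected value on every list that starts with \<open>w\<close>.
\<close>

definition wedge :: "'v \<Rightarrow> ('v list \<Rightarrow> complex) \<Rightarrow> 'v list \<Rightarrow> complex" where
  "wedge w c l = (if w \<in> set l
     then oriented_simplex (w # enum (set l - {w})) l * c (enum (set l - {w})) else 0)"

lemma chains_alternating: "c \<in> chains \<Delta> k \<Longrightarrow> alternating c"
  by (auto simp: chains_def alternating_def)

lemma chainsD: "c \<in> chains \<Delta> k \<Longrightarrow> c l \<noteq> 0 \<Longrightarrow> set l \<in> \<Delta> \<and> int (length l) = k + 1"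
  by (auto simp: chains_def)

lemma chains_mono: "c \<in> chains \<Delta> k \<Longrightarrow> \<Delta> \<subseteq> \<Delta>' \<Longrightarrow> c \<in> chains \<Delta>' k"
  by (auto simp: chains_def)

lemma zero_chain [simp]: "(\<lambda>_. 0) \<in> chains \<Delta> k"
  by (auto simp: chains_def)

lemma chains_add: "c \<in> chains \<Delta> k \<Longrightarrow> d \<in> chains \<Delta> k \<Longrightarrow> (\<lambda>l. c l + d l) \<in> chains \<Delta> k"
  unfolding chains_def
  by (auto simp: distrib_left intro: finite_subset[of _ "{l. c l \<noteq> 0} \<union> {l. d l \<noteq> 0}"])
    (metis add.right_neutral)+

lemma chains_scale: "c \<in> chains \<Delta> k \<Longrightarrow> (\<lambda>l. a * c l) \<in> chains \<Delta> k"
  unfolding chains_def by (auto intro: finite_subset[of _ "{l. c l \<noteq> 0}"])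

lemma chains_diff: "c \<in> chains \<Delta> k \<Longrightarrow> d \<in> chains \<Delta> k \<Longrightarrow> (\<lambda>l. c l - d l) \<in> chains \<Delta> k"
  using chains_add[of c \<Delta> k "\<lambda>l. (-1) * d l"] chains_scale[of d \<Delta> k "-1"] by simp

lemma restrict_chain_in: "c \<in> chains \<Delta> k \<Longrightarrow> restrict_chain S c \<in> chains (\<Delta> \<inter> S) k"
  unfolding chains_def restrict_chain_def
  by (auto simp: permutes_image split: if_splits intro: finite_subset[of _ "{l. c l \<noteq> 0}"])

lemma alternating_wedge: "alternating (wedge w c)"
proof -
  have d: "distinct (w # enum (set l - {w}))" for l
    by (simp add: enum)
  have "distinct l" if "wedge w c l \<noteq> 0" for l
  proof -
    have "oriented_simplex (w # enum (set l - {w})) l \<noteq> 0"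
      using that unfolding wedge_def by (metis mult_zero_left)
    then show ?thesis using oriented_simplex_support[OF d] by blast
  qed
  moreover have "wedge w c (map \<pi> l) = of_int (sign \<pi>) * wedge w c l" if "\<pi> permutes set l" for \<pi> l
    using oriented_simplex_alternating[OF d that, of l] that
    by (auto simp: wedge_def permutes_image)
  ultimately show ?thesis unfolding alternating_def by blast
qed

lemma wedge_Cons:
  assumes "alternating c" "w \<notin> set l"
  shows "wedge w c (w # l) = c l"
proof (cases "distinct l")
  case True
  let ?m = "enum (set l)"
  have m: "distinct ?m" "set ?m = set l" by (simp_all add: enum)
  obtain \<pi> where p: "\<pi> permutes set ?m" "l = map \<pi> ?m"
    using oriented_simplex_permutation[OF m(1) True] m(2) by metis
  have fixed: "\<pi> w = w" using p(1) m(2) assms(2) by (metis permutes_not_in)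
  have p': "\<pi> permutes set (w # ?m)"
    by (rule permutes_subset[OF p(1)]) auto
  have "oriented_simplex (w # ?m) (map \<pi> (w # ?m)) = of_int (sign \<pi>)"
    by (rule oriented_simplex_map[OF _ p']) (use m assms in auto)
  then have "oriented_simplex (w # ?m) (w # l) = of_int (sign \<pi>)"
    using p(2) fixed by simp
  moreover have "c l = of_int (sign \<pi>) * c ?m"
    using alternating_perm[OF assms(1) p(1)] p(2) by simp
  ultimately show ?thesis using assms by (simp add: wedge_def)
next
  case False
  then show ?thesis using alternating_nondistinct[OF assms(1)]
      alternating_nondistinct[OF alternating_wedge, of "w # l"] by auto
qed

locale vertex_set =
  fixes V :: "'v set"
  assumes finite_V: "finite V"
begin

lemma chainsI:
  assumes "alternating c" "\<Delta> \<subseteq> Pow V" "\<And>l. c l \<noteq> 0 \<Longrightarrow> set l \<in> \<Delta> \<and> int (length l) = k + 1"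
  shows "c \<in> chains \<Delta> k"
proof -
  have "{l. c l \<noteq> 0} \<subseteq> {l. set l \<subseteq> V \<and> length l = nat (k + 1)}"
    using assms by fastforce
  then have "finite {l. c l \<noteq> 0}"
    using finite_lists_length_eq[OF finite_V] finite_subset by blast
  then show ?thesis using assms by (auto simp: chains_def alternating_def)
qed

lemma boundary_eq:
  assumes "c \<in> chains \<Delta> k" "\<Delta> \<subseteq> Pow V"
  shows "boundary c l = (\<Sum>v\<in>V. c (v # l))"
  unfolding boundary_def
  by (rule sum.mono_neutral_left[OF finite_V]) (use chainsD[OF assms(1)] assms(2) in fastforce)+

lemma boundary_add:
  assumes "c \<in> chains \<Delta> k" "d \<in> chains \<Delta> k" "\<Delta> \<subseteq> Pow V"
  shows "boundary (\<lambda>l. c l + d l) = (\<lambda>l. boundary c l + boundary d l)"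
  using boundary_eq[OF _ assms(3)] assms chains_add[OF assms(1,2)] by (auto simp: sum.distrib)

lemma boundary_scale:
  assumes "c \<in> chains \<Delta> k" "\<Delta> \<subseteq> Pow V"
  shows "boundary (\<lambda>l. a * c l) = (\<lambda>l. a * boundary c l)"
  by (rule ext)
    (simp add: boundary_eq[OF assms] boundary_eq[OF chains_scale[OF assms(1)] assms(2)] sum_distrib_left)

lemma boundary_diff:
  assumes "c \<in> chains \<Delta> k" "d \<in> chains \<Delta> k" "\<Delta> \<subseteq> Pow V"
  shows "boundary (\<lambda>l. c l - d l) = (\<lambda>l. boundary c l - boundary d l)"
  using boundary_eq[OF _ assms(3)] assms chains_diff[OF assms(1,2)] by (auto simp: sum_subtractf)

lemma alternating_boundary:
  assumes "c \<in> chains \<Delta> k" "\<Delta> \<subseteq> Pow V"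
  shows "alternating (boundary c)"
proof -
  note alt = chains_alternating[OF assms(1)]
  have "distinct l" if "boundary c l \<noteq> 0" for l
  proof (rule ccontr)
    assume "\<not> distinct l"
    then have "c (v # l) = 0" for v using alternating_nondistinct[OF alt, of "v # l"] by simp
    then show False using that boundary_eq[OF assms] by simp
  qed
  moreover have "boundary c (map \<pi> l) = of_int (sign \<pi>) * boundary c l" if "\<pi> permutes set l" for \<pi> l
  proof -
    have "c (v # map \<pi> l) = of_int (sign \<pi>) * c (v # l)" for v
    proof (cases "v \<in> set l")
      case True
      then have "\<not> distinct (v # l)" "\<not> distinct (v # map \<pi> l)"
        using permutes_image[OF that] by auto
      then show ?thesis using alternating_nondistinct[OF alt] by (metis mult_zero_right)
    next
      case False
      have "\<pi> permutes set (v # l)" by (rule permutes_subset[OF that]) auto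
      from alternating_perm[OF alt this] show ?thesis
        using permutes_not_in[OF that False] by simp
    qed
    then show ?thesis by (simp add: boundary_eq[OF assms] sum_distrib_left)
  qed
  ultimately show ?thesis by (auto simp: alternating_def)
qed

lemma boundary_in_chains:
  assumes "c \<in> chains \<Delta> (k + 1)" "\<Delta> \<subseteq> Pow V" "\<And>\<sigma> \<tau>. \<sigma> \<in> \<Delta> \<Longrightarrow> \<tau> \<subseteq> \<sigma> \<Longrightarrow> \<tau> \<in> \<Delta>"
  shows "boundary c \<in> chains \<Delta> k"
proof (rule chainsI[OF alternating_boundary[OF assms(1,2)] assms(2)])
  fix l assume "boundary c l \<noteq> 0"
  then obtain v where "c (v # l) \<noteq> 0"
    unfolding boundary_eq[OF assms(1,2)] by (meson sum.neutral)
  then show "set l \<in> \<Delta> \<and> int (length l) = k + 1"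
    using chainsD[OF assms(1), of "v # l"] assms(3)[of "set (v # l)" "set l"] by auto
qed

lemma boundary_boundary:
  assumes "c \<in> chains \<Delta> k" "\<Delta> \<subseteq> Pow V"
  shows "boundary (boundary c) = (\<lambda>_. 0)"
proof
  fix l
  let ?s = "\<Sum>v\<in>V. \<Sum>u\<in>V. c (u # v # l)"
  have "boundary c \<in> chains (Pow V) (k - 1)"
    by (rule boundary_in_chains) (use chains_mono[OF assms] in auto)
  then have "boundary (boundary c) l = ?s"
    by (simp add: boundary_eq[OF assms] boundary_eq[of _ "Pow V"])
  moreover have "?s = - ?s"
  proof -
    have "?s = (\<Sum>u\<in>V. \<Sum>v\<in>V. c (u # v # l))" by (rule sum.swap)
    also have "\<dots> = (\<Sum>u\<in>V. \<Sum>v\<in>V. - c (v # u # l))"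
      by (intro sum.cong refl alternating_swap[OF chains_alternating[OF assms(1)]])
    finally show ?thesis by (simp add: sum_negf)
  qed
  ultimately show "boundary (boundary c) l = 0" by (simp add: equation_minus_iff)
qed

lemma wedge_in_chains:
  assumes "c \<in> chains \<Delta> k" "w \<in> V" "\<Delta>' \<subseteq> Pow V"
    and "\<And>\<sigma>. \<sigma> \<in> \<Delta> \<Longrightarrow> w \<notin> \<sigma> \<Longrightarrow> insert w \<sigma> \<in> \<Delta>'"
  shows "wedge w c \<in> chains \<Delta>' (k + 1)"
proof (rule chainsI[OF alternating_wedge assms(3)])
  fix l assume nz: "wedge w c l \<noteq> 0"
  then have w: "w \<in> set l" and c: "c (enum (set l - {w})) \<noteq> 0"
    by (auto simp: wedge_def split: if_splits)
  have d: "distinct l" using alternating_nondistinct[OF alternating_wedge] nz by metis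
  have "length (enum (set l - {w})) = card (set l - {w})"
    using distinct_card[OF enum(1), of "set l - {w}"] by (simp add: enum)
  then have "length l = Suc (length (enum (set l - {w})))"
    using w d by (metis List.finite_set card_Suc_Diff1 distinct_card)
  moreover have "insert w (set l - {w}) \<in> \<Delta>'"
    using assms(4)[of "set l - {w}"] chainsD[OF assms(1) c] by (simp add: enum)
  ultimately show "set l \<in> \<Delta>' \<and> int (length l) = k + 1 + 1"
    using chainsD[OF assms(1) c] w by (simp add: insert_absorb)
qed

text \<open>
  The boundary is contraction with the sum of all dual basis vectors and so anticommutes with
  exterior multiplication up to the value \<open>1\<close> of that sum at \<open>w\<close>. As both sides alternate, it is enough
  to compare them on lists that avoid \<open>w\<close> or start with it.
\<close>

lemma boundary_wedge:
  assumes "c \<in> chains \<Delta> k" "\<Delta> \<subseteq> Pow V" "w \<in> V"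
  shows "boundary (wedge w c) l = c l - wedge w (boundary c) l"
proof -
  note alt = chains_alternating[OF assms(1)]
  have "wedge w c \<in> chains (Pow V) (k + 1)"
    by (rule wedge_in_chains[OF assms(1,3)]) (use assms in auto)
  then have bw: "boundary (wedge w c) m = (\<Sum>v\<in>V. wedge w c (v # m))" for m
    by (rule boundary_eq) simp
  have no: "boundary (wedge w c) m = c m - wedge w (boundary c) m" if "w \<notin> set m" for m
  proof -
    have "wedge w c (v # m) = 0" if "v \<noteq> w" for v
      using that \<open>w \<notin> set m\<close> by (simp add: wedge_def)
    then have "(\<Sum>v\<in>V. wedge w c (v # m)) = (\<Sum>v\<in>{w}. wedge w c (v # m))"
      by (intro sum.mono_neutral_right) (use assms(3) finite_V in auto)
    then show ?thesis using bw wedge_Cons[OF alt that] that by (simp add: wedge_def)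
  qed
  have front: "boundary (wedge w c) (w # m) = c (w # m) - wedge w (boundary c) (w # m)"
    if "distinct (w # m)" for m
  proof -
    have "wedge w c (v # w # m) = (if v = w then 0 else - c (v # m))" for v
    proof (cases "v = w")
      case True
      then show ?thesis using alternating_nondistinct[OF alternating_wedge, of "v # w # m"] by simp
    next
      case False
      then show ?thesis using alternating_swap[OF alternating_wedge, of w c v w m]
          wedge_Cons[OF alt, of w "v # m"] that by simp
    qed
    then have "boundary (wedge w c) (w # m) = (\<Sum>v\<in>V. if v = w then 0 else - c (v # m))"
      using bw by simp
    also have "\<dots> = (\<Sum>v\<in>V - {w}. - c (v # m))"
      using finite_V assms(3) by (simp add: sum.If_cases Diff_eq Int_def sum.delta_remove Collect_neg_eq)
    also have "\<dots> = c (w # m) - boundary c m"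
      using boundary_eq[OF assms(1,2)] sum.remove[OF finite_V assms(3), of "\<lambda>v. c (v # m)"]
      by (simp add: sum_negf)
    finally show ?thesis
      using wedge_Cons[OF alternating_boundary[OF assms(1,2)]] that by simp
  qed
  have alt2: "alternating (\<lambda>m. boundary (wedge w c) m + (-1) * (c m + (-1) * wedge w (boundary c) m))"
    by (intro alternating_add alternating_scale alternating_wedge alt
       alternating_boundary[OF \<open>wedge w c \<in> chains (Pow V) (k + 1)\<close>]) simp
  have arith: "x + (y - z) = 0 \<Longrightarrow> x = z - y" for x y z :: complex
    by (simp add: algebra_simps)
  show ?thesis
  proof (cases "w \<in> set l \<and> distinct l")
    case True
    let ?m = "enum (set l - {w})"
    have d: "distinct (w # ?m)" "set l = set (w # ?m)" using True by (auto simp: enum)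
    have "boundary (wedge w c) l + (wedge w (boundary c) l - c l) = 0"
      using alternating_zero_iff[OF alt2 d(1) _ d(2)] front[OF d(1)] True by simp
    then show ?thesis by (rule arith)
  next
    case False
    have "boundary (wedge w c) l + (wedge w (boundary c) l - c l) = 0" if "\<not> distinct l"
      using alternating_nondistinct[OF alt2 that] by simp
    then show ?thesis using no False arith by blast
  qed
qed

end


section \<open>Relative acyclicity\<close>

definition down_closed :: "'v set set \<Rightarrow> bool" where
  "down_closed \<Delta> \<longleftrightarrow> (\<forall>\<sigma>\<in>\<Delta>. \<forall>\<tau>. \<tau> \<subseteq> \<sigma> \<longrightarrow> \<tau> \<in> \<Delta>)"

text \<open>
  This says that the quotient of the chain complex of \<open>\<Delta>'\<close> by that of \<open>\<Delta>\<close> is exact. Phrasing it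
  with chains of \<open>\<Delta>'\<close> instead of cosets gives surjectivity and injectivity of
  the map induced on homology at once, and composes without a long exact sequence.
\<close>

definition rel_acyclic :: "'v set set \<Rightarrow> 'v set set \<Rightarrow> bool" where
  "rel_acyclic \<Delta> \<Delta>' \<longleftrightarrow> (\<forall>k. \<forall>c \<in> chains \<Delta>' k. boundary c \<in> chains \<Delta> (k - 1) \<longrightarrow>
     (\<exists>b \<in> chains \<Delta>' (k + 1). (\<lambda>l. c l - boundary b l) \<in> chains \<Delta> k))"

lemma boundary_zero [simp]: "boundary (\<lambda>_. 0) = (\<lambda>_. 0)"
  by (simp add: boundary_def fun_eq_iff)

context vertex_set
begin

lemma boundary_chains:
  assumes "c \<in> chains \<Delta> k" "\<Delta> \<subseteq> Pow V" "down_closed \<Delta>"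
  shows "boundary c \<in> chains \<Delta> (k - 1)"
  using boundary_in_chains[of c \<Delta> "k - 1"] assms by (auto simp: down_closed_def)

text \<open>
  Coning off with apex \<open>w\<close> contracts the relative chain complex. Subtracting the boundary of the cone over
  the part of \<open>c\<close> on new faces without \<open>w\<close> removes that part; the coefficient of a new face
  \<open>insert w \<tau>\<close> is then the coefficient of \<open>\<tau>\<close> in the boundary, which vanishes by hypothesis.
\<close>

lemma rel_acyclic_toggle:
  assumes sub: "\<Delta> \<subseteq> \<Delta>'" "\<Delta>' \<subseteq> Pow V" and dc: "down_closed \<Delta>" "down_closed \<Delta>'"
    and w: "w \<in> V" and toggle: "\<And>\<sigma>. \<sigma> \<in> \<Delta>' - \<Delta> \<Longrightarrow> insert w \<sigma> \<in> \<Delta>' \<and> \<sigma> - {w} \<in> \<Delta>' - \<Delta>"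
  shows "rel_acyclic \<Delta> \<Delta>'"
  unfolding rel_acyclic_def
proof (intro allI ballI impI)
  fix k c assume c: "c \<in> chains \<Delta>' k" and bc: "boundary c \<in> chains \<Delta> (k - 1)"
  define D where "D = {\<sigma> \<in> \<Delta>' - \<Delta>. w \<notin> \<sigma>}"
  define d where "d = restrict_chain D c"
  define b where "b = wedge w d"
  have d: "d \<in> chains D k"
    using restrict_chain_in[OF c, of D] chains_mono unfolding d_def by blast
  have D: "D \<subseteq> Pow V" using sub by (auto simp: D_def)
  have b: "b \<in> chains \<Delta>' (k + 1)"
    unfolding b_def by (rule wedge_in_chains[OF d w sub(2)]) (use toggle in \<open>auto simp: D_def\<close>)
  have bb: "boundary b \<in> chains \<Delta>' k"
    using boundary_chains[OF b sub(2) dc(2)] by simp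
  define c' where "c' = (\<lambda>l. c l - boundary b l)"
  have c': "c' \<in> chains \<Delta>' k"
    unfolding c'_def by (rule chains_diff[OF c bb])
  have val: "c' l = c l - (d l - wedge w (boundary d) l)" for l
    unfolding c'_def b_def using boundary_wedge[OF d D w] by simp
  have "boundary c' = (\<lambda>l. boundary c l - boundary (boundary b) l)"
    unfolding c'_def by (rule boundary_diff[OF c bb sub(2)])
  then have bc': "boundary c' = boundary c"
    using boundary_boundary[OF b sub(2)] by simp
  have no: "c' l = 0" if "set l \<notin> \<Delta>" "w \<notin> set l" for l
  proof -
    have "d l = c l"
      using that chainsD[OF c, of l] by (auto simp: d_def restrict_chain_def D_def)
    then show ?thesis using that val[of l] by (simp add: wedge_def)
  qed
  have yes: "c' (w # m) = 0" if "insert w (set m) \<in> \<Delta>' - \<Delta>" "w \<notin> set m" for m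
  proof -
    have m: "set m \<notin> \<Delta>" using toggle[OF that(1)] that(2) by simp
    have "c' (v # m) = 0" if "v \<noteq> w" for v
    proof -
      have "set (v # m) \<notin> \<Delta>"
        using m dc(1) unfolding down_closed_def by (metis set_subset_Cons)
      then show ?thesis using no[of "v # m"] that \<open>w \<notin> set m\<close> by simp
    qed
    then have "(\<Sum>v\<in>V. c' (v # m)) = (\<Sum>v\<in>{w}. c' (v # m))"
      by (intro sum.mono_neutral_right) (use w finite_V in auto)
    moreover have "boundary c' m = 0"
      using chainsD[OF bc, of m] m unfolding bc' by blast
    ultimately show ?thesis using boundary_eq[OF c' sub(2)] by simp
  qed
  have "c' \<in> chains \<Delta> k"
  proof (rule chainsI[OF chains_alternating[OF c']])
    fix l assume nz: "c' l \<noteq> 0"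
    have "set l \<in> \<Delta>"
    proof (rule ccontr)
      assume l: "set l \<notin> \<Delta>"
      then have "w \<in> set l" using no nz by blast
      have dist: "distinct l" using alternating_nondistinct[OF chains_alternating[OF c']] nz by metis
      let ?m = "enum (set l - {w})"
      have m: "distinct (w # ?m)" "set l = set (w # ?m)" using \<open>w \<in> set l\<close> by (auto simp: enum)
      have "c' (w # ?m) = 0"
        by (rule yes) (use l m chainsD[OF c' nz] in auto)
      then show False
        using alternating_zero_iff[OF chains_alternating[OF c'] m(1) dist m(2)] nz by simp
    qed
    then show "set l \<in> \<Delta> \<and> int (length l) = k + 1" using chainsD[OF c' nz] by simp
  qed (use sub in auto)
  then show "\<exists>b\<in>chains \<Delta>' (k + 1). (\<lambda>l. c l - boundary b l) \<in> chains \<Delta> k"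
    using b unfolding c'_def by blast
qed

lemma rel_acyclic_refl: "rel_acyclic \<Delta> \<Delta>"
  unfolding rel_acyclic_def by (intro allI ballI impI bexI[of _ "\<lambda>_. 0"]) auto

lemma rel_acyclic_trans:
  assumes "rel_acyclic \<Delta> \<Delta>'" "rel_acyclic \<Delta>' \<Delta>''" "\<Delta> \<subseteq> \<Delta>'" "\<Delta>' \<subseteq> \<Delta>''" "\<Delta>'' \<subseteq> Pow V"
    and dc: "down_closed \<Delta>''"
  shows "rel_acyclic \<Delta> \<Delta>''"
  unfolding rel_acyclic_def
proof (intro allI ballI impI)
  fix k c assume c: "c \<in> chains \<Delta>'' k" and bc: "boundary c \<in> chains \<Delta> (k - 1)"
  have "boundary c \<in> chains \<Delta>' (k - 1)" using chains_mono[OF bc assms(3)] .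
  then obtain b where b: "b \<in> chains \<Delta>'' (k + 1)" and c': "(\<lambda>l. c l - boundary b l) \<in> chains \<Delta>' k"
    using assms(2) c unfolding rel_acyclic_def by blast
  have bb: "boundary b \<in> chains \<Delta>'' k" using boundary_chains[OF b assms(5) dc] by simp
  have "boundary (\<lambda>l. c l - boundary b l) = boundary c"
    using boundary_diff[OF c bb assms(5)] boundary_boundary[OF b assms(5)] by simp
  then have "boundary (\<lambda>l. c l - boundary b l) \<in> chains \<Delta> (k - 1)" using bc by simp
  from assms(1)[unfolded rel_acyclic_def, rule_format, OF c' this] obtain b' where b': "b' \<in> chains \<Delta>' (k + 1)"
    and c'': "(\<lambda>l. c l - boundary b l - boundary b' l) \<in> chains \<Delta> k"
    by blast
  have b'2: "b' \<in> chains \<Delta>'' (k + 1)" using chains_mono[OF b' assms(4)] .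
  have "boundary (\<lambda>l. b l + b' l) = (\<lambda>l. boundary b l + boundary b' l)"
    by (rule boundary_add[OF b b'2 assms(5)])
  then show "\<exists>b\<in>chains \<Delta>'' (k + 1). (\<lambda>l. c l - boundary b l) \<in> chains \<Delta> k"
    using c'' chains_add[OF b b'2] by (auto simp: algebra_simps intro!: bexI[of _ "\<lambda>l. b l + b' l"])
qed

text \<open>
  Injectivity on homology: the definition is applied to a chain with boundary \<open>z\<close>.
\<close>

lemma boundaries_of_rel_acyclic:
  assumes "rel_acyclic \<Delta> \<Delta>'" "\<Delta> \<subseteq> \<Delta>'" "\<Delta>' \<subseteq> Pow V" "down_closed \<Delta>'"
    and z: "z \<in> chains \<Delta> k" "z \<in> boundaries \<Delta>' k"
  shows "z \<in> boundaries \<Delta> k"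
proof -
  obtain c where c: "c \<in> chains \<Delta>' (k + 1)" "z = boundary c"
    using z(2) by (auto simp: boundaries_def)
  then obtain b where b: "b \<in> chains \<Delta>' (k + 1 + 1)" "(\<lambda>l. c l - boundary b l) \<in> chains \<Delta> (k + 1)"
    using assms(1)[unfolded rel_acyclic_def, rule_format, OF c(1)] z(1) by auto
  have bb: "boundary b \<in> chains \<Delta>' (k + 1)"
    using boundary_chains[OF b(1) assms(3,4)] by (simp add: add.commute)
  have "boundary (\<lambda>l. c l - boundary b l) = z"
    using boundary_diff[OF c(1) bb assms(3)] boundary_boundary[OF b(1) assms(3)] c(2) by simp
  then show ?thesis using b(2) unfolding boundaries_def by blast
qed

lemma Pow_acyclic:
  assumes "V \<noteq> {}" "x \<in> chains (Pow V) k" "boundary x = (\<lambda>_. 0)"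
  shows "\<exists>c \<in> chains (Pow V) (k + 1). boundary c = x"
proof -
  obtain w where w: "w \<in> V" using assms(1) by blast
  have "rel_acyclic {} (Pow V)"
    by (rule rel_acyclic_toggle[OF _ _ _ _ w]) (use w in \<open>auto simp: down_closed_def\<close>)
  then obtain b where b: "b \<in> chains (Pow V) (k + 1)" "(\<lambda>l. x l - boundary b l) \<in> chains {} k"
    using assms(2,3) unfolding rel_acyclic_def by fastforce
  have "x l - boundary b l = 0" for l
    using chainsD[OF b(2), of l] by blast
  then have "boundary b = x" by (intro ext) simp
  then show ?thesis using b(1) by blast
qed

end

section \<open>Transport along injective vertex maps\<close>

text \<open>
  Unlike \<open>chain_map\<close>, this allows a change of vertex type, which is needed to place sets of
  vertices and chains of flats into one complex.
\<close>

definition push_chain :: "('v \<Rightarrow> 'w) \<Rightarrow> ('v list \<Rightarrow> complex) \<Rightarrow> 'w list \<Rightarrow> complex" where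
  "push_chain f c l = (if set l \<subseteq> range f then c (map (inv_into UNIV f) l) else 0)"

lemma chain_map_eq_push: "bij h \<Longrightarrow> chain_map h = push_chain h"
  by (auto simp: fun_eq_iff chain_map_def push_chain_def bij_is_surj)

lemma push_chain_map:
  assumes "inj f"
  shows "push_chain f c (map f l) = c l"
  using assms by (simp add: push_chain_def image_mono o_def)

lemma push_chain_comp:
  assumes "inj f" "inj g"
  shows "push_chain g (push_chain f c) = push_chain (g \<circ> f) c"
proof
  fix l
  show "push_chain g (push_chain f c) l = push_chain (g \<circ> f) c l"
  proof (cases "set l \<subseteq> range (g \<circ> f)")
    case True
    then obtain m where "l = map (g \<circ> f) m"
      by (metis ex_map_conv subsetD rangeE)
    then have "l = map g (map f m)" by simp
    then show ?thesis
      using push_chain_map[OF inj_compose[OF assms(2,1)], of c m] push_chain_map[OF assms(2), of _ "map f m"]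
        push_chain_map[OF assms(1)] by simp
  next
    case False
    have "\<not> (set l \<subseteq> range g \<and> set (map (inv_into UNIV g) l) \<subseteq> range f)"
    proof
      assume a: "set l \<subseteq> range g \<and> set (map (inv_into UNIV g) l) \<subseteq> range f"
      have "x \<in> range (g \<circ> f)" if "x \<in> set l" for x
      proof -
        have "x = g (inv_into UNIV g x)" using a that by (metis f_inv_into_f subsetD)
        moreover have "inv_into UNIV g x \<in> range f" using a that by auto
        ultimately show ?thesis by (metis comp_apply rangeE rangeI)
      qed
      then show False using False by blast
    qed
    then show ?thesis using False by (auto simp: push_chain_def)
  qed
qed

lemma push_chain_zero [simp]: "push_chain f (\<lambda>_. 0) = (\<lambda>_. 0)"
  by (auto simp: push_chain_def)

lemma push_chain_add: "push_chain f (\<lambda>l. c l + d l) = (\<lambda>l. push_chain f c l + push_chain f d l)"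
  by (auto simp: push_chain_def)

lemma push_chain_scale: "push_chain f (\<lambda>l. a * c l) = (\<lambda>l. a * push_chain f c l)"
  by (auto simp: push_chain_def)

lemma push_chain_inject: "inj f \<Longrightarrow> push_chain f c = push_chain f d \<Longrightarrow> c = d"
  using push_chain_map by (metis ext)

lemma push_chain_in:
  assumes f: "inj f" and c: "c \<in> chains \<Delta> k"
  shows "push_chain f c \<in> chains ((`) f ` \<Delta>) k"
proof -
  have form: "\<exists>m. l = map f m \<and> c m \<noteq> 0" if "push_chain f c l \<noteq> 0" for l
  proof -
    have "set l \<subseteq> range f" using that by (auto simp: push_chain_def split: if_splits)
    then obtain m where "l = map f m" by (metis ex_map_conv subsetD rangeE)
    then show ?thesis using that push_chain_map[OF f] by metis
  qed
  have "{l. push_chain f c l \<noteq> 0} \<subseteq> map f ` {m. c m \<noteq> 0}"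
    using form by blast
  moreover have "finite {m. c m \<noteq> 0}" using c by (simp add: chains_def)
  ultimately have fin: "finite {l. push_chain f c l \<noteq> 0}" by (meson finite_imageI finite_subset)
  have supp: "distinct l \<and> set l \<in> (`) f ` \<Delta> \<and> int (length l) = k + 1" if nz: "push_chain f c l \<noteq> 0" for l
  proof -
    obtain m where m: "l = map f m" "c m \<noteq> 0" using form[OF nz] by blast
    have "distinct m" using alternating_nondistinct[OF chains_alternating[OF c]] m(2) by metis
    then show ?thesis
      using chainsD[OF c m(2)] m(1) inj_on_subset[OF f] by (simp add: distinct_map)
  qed
  have perm: "push_chain f c (map \<pi> l) = of_int (sign \<pi>) * push_chain f c l" if p: "\<pi> permutes set l" for \<pi> l
  proof (cases "set l \<subseteq> range f")
    case True
    then show ?thesis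
      using alternating_map[OF chains_alternating[OF c] inj_on_inv_into[OF True] p] permutes_image[OF p]
      by (simp add: push_chain_def)
  next
    case False
    then show ?thesis using permutes_image[OF p] by (simp add: push_chain_def)
  qed
  show ?thesis unfolding chains_def using fin supp perm by blast
qed

lemma push_chain_surj:
  assumes f: "inj f" and d: "d \<in> chains ((`) f ` \<Delta>) k"
  shows "\<exists>c \<in> chains \<Delta> k. d = push_chain f c"
proof (intro bexI)
  let ?c = "\<lambda>l. d (map f l)"
  have inj: "inj (map f)" using f by simp
  have "finite {l. ?c l \<noteq> 0}"
    using finite_vimageI[OF _ inj, of "{l. d l \<noteq> 0}"] d by (simp add: chains_def vimage_def)
  moreover have "distinct l \<and> set l \<in> \<Delta> \<and> int (length l) = k + 1" if "?c l \<noteq> 0" for l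
  proof -
    have "distinct (map f l)"
      using alternating_nondistinct[OF chains_alternating[OF d]] that by metis
    moreover have "f ` set l \<in> (`) f ` \<Delta>" "int (length l) = k + 1"
      using chainsD[OF d that] by auto
    ultimately show ?thesis
      using f by (auto simp: distinct_map inj_image_eq_iff)
  qed
  moreover have "?c (map \<pi> l) = of_int (sign \<pi>) * ?c l" if "\<pi> permutes set l" for \<pi> l
    by (rule alternating_map[OF chains_alternating[OF d] inj_on_subset[OF f] that]) simp
  ultimately show "?c \<in> chains \<Delta> k" unfolding chains_def by blast
  show "d = push_chain f ?c"
  proof
    fix l
    show "d l = push_chain f ?c l"
    proof (cases "set l \<subseteq> range f")
      case True
      then have "map f (map (inv_into UNIV f) l) = l"
        by (auto intro!: map_idI simp: f_inv_into_f subsetD)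
      then show ?thesis using True by (simp add: push_chain_def)
    next
      case False
      then have "d l = 0" using chainsD[OF d, of l] by auto
      then show ?thesis using False by (simp add: push_chain_def)
    qed
  qed
qed

lemma boundary_push_chain:
  assumes f: "inj f"
  shows "boundary (push_chain f c) = push_chain f (boundary c)"
proof
  fix l
  show "boundary (push_chain f c) l = push_chain f (boundary c) l"
  proof (cases "set l \<subseteq> range f")
    case True
    then obtain m where m: "l = map f m" by (metis ex_map_conv subsetD rangeE)
    have ev: "push_chain f c (f v # l) = c (v # m)" for v
      using push_chain_map[OF f, of c "v # m"] m by simp
    have "{v. push_chain f c (v # l) \<noteq> 0} = f ` {v. c (v # m) \<noteq> 0}"
    proof (rule Set.set_eqI)
      fix x
      have "x \<in> range f" if "push_chain f c (x # l) \<noteq> 0"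
        using that unfolding push_chain_def by (metis insert_subset list.simps(15))
      then show "x \<in> {v. push_chain f c (v # l) \<noteq> 0} \<longleftrightarrow> x \<in> f ` {v. c (v # m) \<noteq> 0}"
        using ev by (metis (mono_tags, lifting) image_iff mem_Collect_eq)
    qed
    then have "boundary (push_chain f c) l = boundary c m"
      unfolding boundary_def
      by (rule sum.reindex_cong[OF inj_on_subset[OF f subset_UNIV]]) (rule ev)
    then show ?thesis using push_chain_map[OF f, of "boundary c" m] m by simp
  next
    case False
    then show ?thesis by (simp add: push_chain_def boundary_def)
  qed
qed


section \<open>Homology classes and correspondences\<close>

abbreviation hclass :: "'v set set \<Rightarrow> int \<Rightarrow> ('v list \<Rightarrow> complex) \<Rightarrow> ('v list \<Rightarrow> complex) set" where
  "hclass \<Delta> k x \<equiv> homologous \<Delta> k `` {x}"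

lemma cyclesD: "x \<in> cycles \<Delta> k \<Longrightarrow> x \<in> chains \<Delta> k" "x \<in> cycles \<Delta> k \<Longrightarrow> boundary x = (\<lambda>_. 0)"
  by (auto simp: cycles_def)

lemma zero_cycle [simp]: "(\<lambda>_. 0) \<in> cycles \<Delta> k"
  by (simp add: cycles_def)

lemma zero_boundary [simp]: "(\<lambda>_. 0) \<in> boundaries \<Delta> k"
  unfolding boundaries_def by (rule image_eqI[of _ _ "\<lambda>_. 0"]) auto

context vertex_set
begin

lemma cycles_add:
  assumes "\<Delta> \<subseteq> Pow V" "x \<in> cycles \<Delta> k" "y \<in> cycles \<Delta> k"
  shows "(\<lambda>l. x l + y l) \<in> cycles \<Delta> k"
  using assms boundary_add[of x \<Delta> k y] by (simp add: cycles_def chains_add)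

lemma cycles_scale:
  assumes "\<Delta> \<subseteq> Pow V" "x \<in> cycles \<Delta> k"
  shows "(\<lambda>l. a * x l) \<in> cycles \<Delta> k"
  using assms boundary_scale[of x \<Delta> k a] by (simp add: cycles_def chains_scale)

lemma boundaries_add:
  assumes "\<Delta> \<subseteq> Pow V" "x \<in> boundaries \<Delta> k" "y \<in> boundaries \<Delta> k"
  shows "(\<lambda>l. x l + y l) \<in> boundaries \<Delta> k"
proof -
  obtain c d where c: "c \<in> chains \<Delta> (k + 1)" "x = boundary c" and d: "d \<in> chains \<Delta> (k + 1)" "y = boundary d"
    using assms(2,3) by (auto simp: boundaries_def)
  then show ?thesis unfolding boundaries_def
    by (intro image_eqI[of _ _ "\<lambda>l. c l + d l"]) (simp_all add: boundary_add[OF c(1) d(1) assms(1)] chains_add)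
qed

lemma boundaries_scale:
  assumes "\<Delta> \<subseteq> Pow V" "x \<in> boundaries \<Delta> k"
  shows "(\<lambda>l. a * x l) \<in> boundaries \<Delta> k"
proof -
  obtain c where c: "c \<in> chains \<Delta> (k + 1)" "x = boundary c"
    using assms(2) by (auto simp: boundaries_def)
  then show ?thesis unfolding boundaries_def
    by (intro image_eqI[of _ _ "\<lambda>l. a * c l"]) (simp_all add: boundary_scale[OF c(1) assms(1)] chains_scale)
qed

lemma boundaries_diff:
  assumes "\<Delta> \<subseteq> Pow V" "x \<in> boundaries \<Delta> k" "y \<in> boundaries \<Delta> k"
  shows "(\<lambda>l. x l - y l) \<in> boundaries \<Delta> k"
  using boundaries_add[OF assms(1,2) boundaries_scale[OF assms(1,3), of "-1"]] by simp

lemma equiv_homologous: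
  assumes "\<Delta> \<subseteq> Pow V"
  shows "equiv (cycles \<Delta> k) (homologous \<Delta> k)"
proof (rule equivI)
  show "refl_on (cycles \<Delta> k) (homologous \<Delta> k)"
    by (auto simp: refl_on_def homologous_def)
  show "sym (homologous \<Delta> k)"
  proof (rule symI)
    fix x y assume a: "(x, y) \<in> homologous \<Delta> k"
    then have "(\<lambda>l. (-1) * (x l - y l)) \<in> boundaries \<Delta> k"
      by (intro boundaries_scale[OF assms]) (simp add: homologous_def)
    then show "(y, x) \<in> homologous \<Delta> k" using a by (simp add: homologous_def)
  qed
  show "trans (homologous \<Delta> k)"
  proof (rule transI)
    fix x y z assume a: "(x, y) \<in> homologous \<Delta> k" "(y, z) \<in> homologous \<Delta> k"
    then have "(\<lambda>l. (x l - y l) + (y l - z l)) \<in> boundaries \<Delta> k"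
      by (intro boundaries_add[OF assms]) (simp_all add: homologous_def)
    then show "(x, z) \<in> homologous \<Delta> k" using a by (simp add: homologous_def)
  qed
qed (auto simp: homologous_def)

lemma hclass_eq_iff:
  assumes "\<Delta> \<subseteq> Pow V" "x \<in> cycles \<Delta> k" "y \<in> cycles \<Delta> k"
  shows "hclass \<Delta> k x = hclass \<Delta> k y \<longleftrightarrow> (\<lambda>l. x l - y l) \<in> boundaries \<Delta> k"
  using eq_equiv_class_iff[OF equiv_homologous[OF assms(1)] assms(2,3)] assms(2,3)
  by (simp add: homologous_def)

lemma homology_rep_add:
  assumes "\<Delta> \<subseteq> Pow V" "x \<in> cycles \<Delta> k" "y \<in> cycles \<Delta> k"
  shows "rep_add (homology_rep \<phi> \<Delta> k) (hclass \<Delta> k x) (hclass \<Delta> k y) = hclass \<Delta> k (\<lambda>l. x l + y l)"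
proof -
  have "hclass \<Delta> k (\<lambda>l. x' l + y' l) = hclass \<Delta> k (\<lambda>l. x'' l + y'' l)"
    if "(x', x'') \<in> homologous \<Delta> k" "(y', y'') \<in> homologous \<Delta> k" for x' x'' y' y''
  proof -
    have "(\<lambda>l. (x' l - x'' l) + (y' l - y'' l)) \<in> boundaries \<Delta> k"
      using that by (intro boundaries_add[OF assms(1)]) (simp_all add: homologous_def)
    then have "(\<lambda>l. (x' l + y' l) - (x'' l + y'' l)) \<in> boundaries \<Delta> k"
      by (simp add: add_diff_add)
    then show ?thesis
      using that hclass_eq_iff[OF assms(1) cycles_add[OF assms(1)] cycles_add[OF assms(1)], of x' k y' x'' y'']
      by (auto simp: homologous_def)
  qed
  then have "congruent2 (homologous \<Delta> k) (homologous \<Delta> k) (\<lambda>x y. hclass \<Delta> k (\<lambda>l. x l + y l))"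
    by (rule congruent2I')
  from UN_equiv_class2[OF equiv_homologous[OF assms(1)] equiv_homologous[OF assms(1)] this assms(2,3)]
  show ?thesis by (simp add: homology_rep_def)
qed

lemma homology_rep_scale:
  assumes "\<Delta> \<subseteq> Pow V" "x \<in> cycles \<Delta> k"
  shows "rep_scale (homology_rep \<phi> \<Delta> k) a (hclass \<Delta> k x) = hclass \<Delta> k (\<lambda>l. a * x l)"
proof -
  have "hclass \<Delta> k (\<lambda>l. a * x' l) = hclass \<Delta> k (\<lambda>l. a * x'' l)"
    if "(x', x'') \<in> homologous \<Delta> k" for x' x''
  proof -
    have "(\<lambda>l. a * (x' l - x'' l)) \<in> boundaries \<Delta> k"
      using that by (intro boundaries_scale[OF assms(1)]) (simp add: homologous_def)
    then show ?thesis
      using that hclass_eq_iff[OF assms(1) cycles_scale[OF assms(1)] cycles_scale[OF assms(1)], of x' k x'' a a]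
      by (auto simp: homologous_def right_diff_distrib)
  qed
  then have "congruent (homologous \<Delta> k) (\<lambda>x. hclass \<Delta> k (\<lambda>l. a * x l))"
    by (rule congruentI)
  from UN_equiv_class[OF equiv_homologous[OF assms(1)] this assms(2)]
  show ?thesis by (simp add: homology_rep_def)
qed

lemma chain_map_in_chains:
  assumes "bij h" "\<forall>\<sigma>\<in>\<Delta>. h ` \<sigma> \<in> \<Delta>" "x \<in> chains \<Delta> k"
  shows "chain_map h x \<in> chains \<Delta> k"
  unfolding chain_map_eq_push[OF assms(1)]
  by (rule chains_mono[OF push_chain_in[OF bij_is_inj[OF assms(1)] assms(3)]]) (use assms(2) in auto)

lemma boundary_chain_map: "bij h \<Longrightarrow> boundary (chain_map h x) = chain_map h (boundary x)"
  by (simp add: chain_map_eq_push boundary_push_chain bij_is_inj)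

lemma chain_map_cycles:
  assumes "bij h" "\<forall>\<sigma>\<in>\<Delta>. h ` \<sigma> \<in> \<Delta>" "x \<in> cycles \<Delta> k"
  shows "chain_map h x \<in> cycles \<Delta> k"
  using chain_map_in_chains[OF assms(1,2)] boundary_chain_map[OF assms(1)] assms(3)
  by (auto simp: cycles_def chain_map_def)

lemma chain_map_boundaries:
  assumes "bij h" "\<forall>\<sigma>\<in>\<Delta>. h ` \<sigma> \<in> \<Delta>" "x \<in> boundaries \<Delta> k"
  shows "chain_map h x \<in> boundaries \<Delta> k"
proof -
  obtain c where "c \<in> chains \<Delta> (k + 1)" "x = boundary c"
    using assms(3) by (auto simp: boundaries_def)
  then show ?thesis
    using chain_map_in_chains[OF assms(1,2)] boundary_chain_map[OF assms(1)]
    by (auto simp: boundaries_def intro!: image_eqI[of _ _ "chain_map h c"])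
qed

lemma homology_rep_act:
  assumes "\<Delta> \<subseteq> Pow V" "x \<in> cycles \<Delta> k" and h: "bij (\<phi> g)" "\<forall>\<sigma>\<in>\<Delta>. \<phi> g ` \<sigma> \<in> \<Delta>"
  shows "rep_act (homology_rep \<phi> \<Delta> k) g (hclass \<Delta> k x) = hclass \<Delta> k (chain_map (\<phi> g) x)"
proof -
  have "hclass \<Delta> k (chain_map (\<phi> g) x') = hclass \<Delta> k (chain_map (\<phi> g) x'')"
    if "(x', x'') \<in> homologous \<Delta> k" for x' x''
  proof -
    have "chain_map (\<phi> g) (\<lambda>l. x' l - x'' l) \<in> boundaries \<Delta> k"
      using that by (intro chain_map_boundaries[OF h]) (simp add: homologous_def)
    then show ?thesis
      using that hclass_eq_iff[OF assms(1) chain_map_cycles[OF h] chain_map_cycles[OF h], of x' k x'']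
      by (auto simp: homologous_def chain_map_def)
  qed
  then have "congruent (homologous \<Delta> k) (\<lambda>x. hclass \<Delta> k (chain_map (\<phi> g) x))"
    by (rule congruentI)
  from UN_equiv_class[OF equiv_homologous[OF assms(1)] this assms(2)]
  show ?thesis by (simp add: homology_rep_def)
qed

lemma zero_homology_rep_iff:
  assumes "\<Delta> \<subseteq> Pow V"
  shows "zero_rep (homology_rep \<phi> \<Delta> k) \<longleftrightarrow> cycles \<Delta> k \<subseteq> boundaries \<Delta> k"
proof -
  have image_const: "h ` C = {h z} \<longleftrightarrow> (\<forall>x\<in>C. h x = h z)" if "z \<in> C" for h :: "'x \<Rightarrow> 'y" and C z
    using that by auto
  have "zero_rep (homology_rep \<phi> \<Delta> k) \<longleftrightarrow> hclass \<Delta> k ` cycles \<Delta> k = {hclass \<Delta> k (\<lambda>_. 0)}"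
    unfolding zero_rep_def homology_rep_def quotient_def by (simp add: UNION_singleton_eq_range)
  also have "\<dots> \<longleftrightarrow> (\<forall>x \<in> cycles \<Delta> k. hclass \<Delta> k x = hclass \<Delta> k (\<lambda>_. 0))"
    by (rule image_const) (rule zero_cycle)
  also have "\<dots> \<longleftrightarrow> cycles \<Delta> k \<subseteq> boundaries \<Delta> k"
    using hclass_eq_iff[OF assms _ zero_cycle] by auto
  finally show ?thesis .
qed

end

lemma rep_space_homology: "rep_space (homology_rep \<phi> \<Delta> k) = hclass \<Delta> k ` cycles \<Delta> k"
  by (simp add: homology_rep_def quotient_def UNION_singleton_eq_range)

text \<open>
  A linear relation \<open>T\<close> between cycles that meets every class on either side and matches boundaries with
  boundaries is the graph of a bijection between the homology groups. A relation is convenient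
  because its members can be constrained (to harmonic cycles, say), while equivariance need only hold for related
  pairs. Being symmetric in its two sides, it also replaces the composition of an isomorphism with the
  inverse of another.
\<close>

lemma rep_iso_of_correspondence:
  fixes \<Delta>1 :: "'v set set" and \<Delta>2 :: "'w set set"
  assumes "finite V1" "finite V2" and sub: "\<Delta>1 \<subseteq> Pow V1" "\<Delta>2 \<subseteq> Pow V2"
    and act1: "\<And>g. g \<in> G \<Longrightarrow> bij (\<phi>1 g) \<and> (\<forall>\<sigma>\<in>\<Delta>1. \<phi>1 g ` \<sigma> \<in> \<Delta>1)"
    and act2: "\<And>g. g \<in> G \<Longrightarrow> bij (\<phi>2 g) \<and> (\<forall>\<sigma>\<in>\<Delta>2. \<phi>2 g ` \<sigma> \<in> \<Delta>2)"
    and T: "T \<subseteq> cycles \<Delta>1 k1 \<times> cycles \<Delta>2 k2"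
    and T_add: "\<And>x y x' y'. (x, y) \<in> T \<Longrightarrow> (x', y') \<in> T \<Longrightarrow> (\<lambda>l. x l + x' l, \<lambda>l. y l + y' l) \<in> T"
    and T_scale: "\<And>a x y. (x, y) \<in> T \<Longrightarrow> (\<lambda>l. a * x l, \<lambda>l. a * y l) \<in> T"
    and T_act: "\<And>g x y. g \<in> G \<Longrightarrow> (x, y) \<in> T \<Longrightarrow>
        (\<lambda>l. \<chi> g * chain_map (\<phi>1 g) x l, chain_map (\<phi>2 g) y) \<in> T"
    and T_left: "\<And>x. x \<in> cycles \<Delta>1 k1 \<Longrightarrow> \<exists>(x', y) \<in> T. (\<lambda>l. x l - x' l) \<in> boundaries \<Delta>1 k1"
    and T_right: "\<And>y. y \<in> cycles \<Delta>2 k2 \<Longrightarrow> \<exists>(x, y') \<in> T. (\<lambda>l. y l - y' l) \<in> boundaries \<Delta>2 k2"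
    and T_boundary: "\<And>x y. (x, y) \<in> T \<Longrightarrow> x \<in> boundaries \<Delta>1 k1 \<longleftrightarrow> y \<in> boundaries \<Delta>2 k2"
  shows "rep_iso G (tensor_character (homology_rep \<phi>1 \<Delta>1 k1) \<chi>) (homology_rep \<phi>2 \<Delta>2 k2)"
proof -
  interpret A: vertex_set V1 by standard (rule assms(1))
  interpret B: vertex_set V2 by standard (rule assms(2))
  let ?c1 = "hclass \<Delta>1 k1" and ?c2 = "hclass \<Delta>2 k2"
  define f where "f X = homologous \<Delta>2 k2 `` (T `` X)" for X
  have TD: "x \<in> cycles \<Delta>1 k1" "y \<in> cycles \<Delta>2 k2" if "(x, y) \<in> T" for x y
    using T that by auto
  have T_eq: "?c1 x = ?c1 x' \<longleftrightarrow> ?c2 y = ?c2 y'" if "(x, y) \<in> T" "(x', y') \<in> T" for x y x' y'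
  proof -
    have "(\<lambda>l. x l - x' l, \<lambda>l. y l - y' l) \<in> T"
      using T_add[OF that(1) T_scale[OF that(2), of "-1"]] by simp
    from T_boundary[OF this] show ?thesis
      unfolding A.hclass_eq_iff[OF sub(1) TD(1)[OF that(1)] TD(1)[OF that(2)]]
        B.hclass_eq_iff[OF sub(2) TD(2)[OF that(1)] TD(2)[OF that(2)]] .
  qed
  \<comment> \<open>The value does not depend on the pair of \<open>T\<close> that is used, by \<open>T_eq\<close>.\<close>
  have f: "f (?c1 x) = ?c2 y" if t: "(x, y) \<in> T" for x y
  proof -
    have "?c2 y' = ?c2 y" if "x' \<in> ?c1 x" "(x', y') \<in> T" for x' y'
    proof -
      have "(x, x') \<in> homologous \<Delta>1 k1" using that(1) by (simp only: Image_singleton_iff)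
      from equiv_class_eq[OF A.equiv_homologous[OF sub(1)] this]
      show ?thesis using T_eq[OF t that(2)] by (simp only:)
    qed
    moreover have "x \<in> ?c1 x" using TD[OF t] by (simp add: homologous_def)
    moreover have "f (?c1 x) = (\<Union>x' \<in> ?c1 x. \<Union>y' \<in> T `` {x'}. ?c2 y')"
      unfolding f_def by blast
    ultimately show ?thesis using t by blast
  qed
  have rep1: "\<exists>x y. (x, y) \<in> T \<and> X = ?c1 x" if X: "X \<in> rep_space (homology_rep \<phi>1 \<Delta>1 k1)" for X
  proof -
    obtain x where x: "x \<in> cycles \<Delta>1 k1" "X = ?c1 x"
      using X unfolding rep_space_homology by blast
    then obtain x' y where t: "(x', y) \<in> T" "(\<lambda>l. x l - x' l) \<in> boundaries \<Delta>1 k1"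
      using T_left by blast
    have "X = ?c1 x'" unfolding x(2) A.hclass_eq_iff[OF sub(1) x(1) TD(1)[OF t(1)]] by (rule t(2))
    then show ?thesis using t(1) by blast
  qed
  have rep2: "\<exists>x y. (x, y) \<in> T \<and> Y = ?c2 y" if Y: "Y \<in> rep_space (homology_rep \<phi>2 \<Delta>2 k2)" for Y
  proof -
    obtain y where y: "y \<in> cycles \<Delta>2 k2" "Y = ?c2 y"
      using Y unfolding rep_space_homology by blast
    then obtain x y' where t: "(x, y') \<in> T" "(\<lambda>l. y l - y' l) \<in> boundaries \<Delta>2 k2"
      using T_right by blast
    have "Y = ?c2 y'" unfolding y(2) B.hclass_eq_iff[OF sub(2) y(1) TD(2)[OF t(1)]] by (rule t(2))
    then show ?thesis using t(1) by blast
  qed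
  have in1: "?c1 x \<in> rep_space (homology_rep \<phi>1 \<Delta>1 k1)"
    and in2: "?c2 y \<in> rep_space (homology_rep \<phi>2 \<Delta>2 k2)" if "(x, y) \<in> T" for x y
    unfolding rep_space_homology using TD[OF that] by blast+
  have tensor: "rep_space (tensor_character (homology_rep \<phi>1 \<Delta>1 k1) \<chi>) = rep_space (homology_rep \<phi>1 \<Delta>1 k1)"
    "rep_add (tensor_character (homology_rep \<phi>1 \<Delta>1 k1) \<chi>) = rep_add (homology_rep \<phi>1 \<Delta>1 k1)"
    "rep_scale (tensor_character (homology_rep \<phi>1 \<Delta>1 k1) \<chi>) = rep_scale (homology_rep \<phi>1 \<Delta>1 k1)"
    "rep_act (tensor_character (homology_rep \<phi>1 \<Delta>1 k1) \<chi>) g X =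
      rep_scale (homology_rep \<phi>1 \<Delta>1 k1) (\<chi> g) (rep_act (homology_rep \<phi>1 \<Delta>1 k1) g X)" for g X
    by (simp_all add: tensor_character_def)
  have "bij_betw f (rep_space (homology_rep \<phi>1 \<Delta>1 k1)) (rep_space (homology_rep \<phi>2 \<Delta>2 k2))"
  proof (rule bij_betwI')
    fix X X' assume "X \<in> rep_space (homology_rep \<phi>1 \<Delta>1 k1)" "X' \<in> rep_space (homology_rep \<phi>1 \<Delta>1 k1)"
    then obtain x y x' y' where "(x, y) \<in> T" "X = ?c1 x" "(x', y') \<in> T" "X' = ?c1 x'"
      using rep1 by blast
    then show "f X = f X' \<longleftrightarrow> X = X'" using T_eq by (simp only: f)
  next
    fix X assume "X \<in> rep_space (homology_rep \<phi>1 \<Delta>1 k1)"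
    then obtain x y where "(x, y) \<in> T" "X = ?c1 x" using rep1 by blast
    then show "f X \<in> rep_space (homology_rep \<phi>2 \<Delta>2 k2)" by (simp only: f in2)
  next
    fix Y assume "Y \<in> rep_space (homology_rep \<phi>2 \<Delta>2 k2)"
    then obtain x y where "(x, y) \<in> T" "Y = ?c2 y" using rep2 by blast
    then show "\<exists>X\<in>rep_space (homology_rep \<phi>1 \<Delta>1 k1). Y = f X"
      by (intro bexI[of _ "?c1 x"]) (simp_all only: f in1)
  qed
  moreover have "f (rep_add (homology_rep \<phi>1 \<Delta>1 k1) X X') = rep_add (homology_rep \<phi>2 \<Delta>2 k2) (f X) (f X')"
    if "X \<in> rep_space (homology_rep \<phi>1 \<Delta>1 k1)" "X' \<in> rep_space (homology_rep \<phi>1 \<Delta>1 k1)" for X X'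
  proof -
    obtain x y x' y' where t: "(x, y) \<in> T" "X = ?c1 x" "(x', y') \<in> T" "X' = ?c1 x'"
      using rep1 \<open>X \<in> _\<close> \<open>X' \<in> _\<close> by blast
    show ?thesis
      unfolding t(2,4) f[OF t(1)] f[OF t(3)] A.homology_rep_add[OF sub(1) TD(1)[OF t(1)] TD(1)[OF t(3)]]
        B.homology_rep_add[OF sub(2) TD(2)[OF t(1)] TD(2)[OF t(3)]]
      by (rule f[OF T_add[OF t(1,3)]])
  qed
  moreover have "f (rep_scale (homology_rep \<phi>1 \<Delta>1 k1) a X) = rep_scale (homology_rep \<phi>2 \<Delta>2 k2) a (f X)"
    if "X \<in> rep_space (homology_rep \<phi>1 \<Delta>1 k1)" for a X
  proof -
    obtain x y where t: "(x, y) \<in> T" "X = ?c1 x"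
      using rep1 \<open>X \<in> _\<close> by blast
    show ?thesis
      unfolding t(2) f[OF t(1)] A.homology_rep_scale[OF sub(1) TD(1)[OF t(1)]]
        B.homology_rep_scale[OF sub(2) TD(2)[OF t(1)]]
      by (rule f[OF T_scale[OF t(1)]])
  qed
  moreover have "f (rep_scale (homology_rep \<phi>1 \<Delta>1 k1) (\<chi> g) (rep_act (homology_rep \<phi>1 \<Delta>1 k1) g X))
      = rep_act (homology_rep \<phi>2 \<Delta>2 k2) g (f X)"
    if g: "g \<in> G" and "X \<in> rep_space (homology_rep \<phi>1 \<Delta>1 k1)" for g X
  proof -
    obtain x y where t: "(x, y) \<in> T" "X = ?c1 x"
      using rep1 \<open>X \<in> _\<close> by blast
    have b1: "bij (\<phi>1 g)" "\<forall>\<sigma>\<in>\<Delta>1. \<phi>1 g ` \<sigma> \<in> \<Delta>1" and b2: "bij (\<phi>2 g)" "\<forall>\<sigma>\<in>\<Delta>2. \<phi>2 g ` \<sigma> \<in> \<Delta>2"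
      using act1[OF g] act2[OF g] by auto
    show ?thesis
      unfolding t(2) f[OF t(1)] A.homology_rep_act[where \<phi> = \<phi>1, OF sub(1) TD(1)[OF t(1)] b1]
        A.homology_rep_scale[OF sub(1) A.chain_map_cycles[OF b1 TD(1)[OF t(1)]]]
        B.homology_rep_act[where \<phi> = \<phi>2, OF sub(2) TD(2)[OF t(1)] b2]
      by (rule f[OF T_act[OF g t(1)]])
  qed
  ultimately show ?thesis
    unfolding rep_iso_def tensor by (intro exI[of _ f] conjI ballI allI) auto
qed

lemma rep_iso_untensor:
  assumes "finite V" "\<Delta> \<subseteq> Pow V" "\<And>g. g \<in> G \<Longrightarrow> bij (\<phi> g) \<and> (\<forall>\<sigma>\<in>\<Delta>. \<phi> g ` \<sigma> \<in> \<Delta>)"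
    and "rep_iso G (tensor_character (homology_rep \<phi> \<Delta> k) (\<lambda>_. 1)) W"
  shows "rep_iso G (homology_rep \<phi> \<Delta> k) W"
proof -
  interpret vertex_set V by standard (rule assms(1))
  have "rep_act (tensor_character (homology_rep \<phi> \<Delta> k) (\<lambda>_. 1)) g X = rep_act (homology_rep \<phi> \<Delta> k) g X"
    if g: "g \<in> G" and X: "X \<in> rep_space (homology_rep \<phi> \<Delta> k)" for g X
  proof -
    obtain x where x: "x \<in> cycles \<Delta> k" "X = hclass \<Delta> k x"
      using X unfolding rep_space_homology by blast
    have b: "bij (\<phi> g)" "\<forall>\<sigma>\<in>\<Delta>. \<phi> g ` \<sigma> \<in> \<Delta>" using assms(3)[OF g] by auto
    show ?thesis
      unfolding x(2) tensor_character_def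
      using homology_rep_act[where \<phi> = \<phi>, OF assms(2) x(1) b]
        homology_rep_scale[OF assms(2) chain_map_cycles[OF b x(1)], of \<phi> 1]
      by simp
  qed
  then show ?thesis
    using assms(4) unfolding rep_iso_def by (simp add: tensor_character_def)
qed

lemma zero_rep_transfer:
  assumes "rep_iso G V W" "rep_zero V \<in> rep_space V" "rep_zero W \<in> rep_space W"
  shows "zero_rep V \<longleftrightarrow> zero_rep W"
proof -
  obtain f where f: "bij_betw f (rep_space V) (rep_space W)"
    using assms(1) by (auto simp: rep_iso_def)
  have "zero_rep V \<longleftrightarrow> is_singleton (rep_space V)" "zero_rep W \<longleftrightarrow> is_singleton (rep_space W)"
    using assms(2,3) by (auto simp: zero_rep_def is_singleton_def)
  moreover have "is_singleton (rep_space V) \<longleftrightarrow> is_singleton (rep_space W)"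
    using bij_betw_same_card[OF f] by (simp add: is_singleton_altdef)
  ultimately show ?thesis by simp
qed


section \<open>Comparison inside a larger complex\<close>

context vertex_set
begin

lemma push_cycles:
  assumes "inj e" "(`) e ` \<Delta>' \<subseteq> \<Delta>" "x \<in> cycles \<Delta>' k"
  shows "push_chain e x \<in> cycles \<Delta> k"
  using chains_mono[OF push_chain_in[OF assms(1) cyclesD(1)[OF assms(3)]] assms(2)]
  by (simp add: cycles_def boundary_push_chain[OF assms(1)] cyclesD(2)[OF assms(3)])

lemma push_boundaries:
  assumes "inj e" "(`) e ` \<Delta>' \<subseteq> \<Delta>" "x \<in> boundaries \<Delta>' k"
  shows "push_chain e x \<in> boundaries \<Delta> k"
proof -
  obtain c where c: "c \<in> chains \<Delta>' (k + 1)" "x = boundary c"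
    using assms(3) by (auto simp: boundaries_def)
  show ?thesis unfolding boundaries_def
    using chains_mono[OF push_chain_in[OF assms(1) c(1)] assms(2)]
    by (intro image_eqI[of _ _ "push_chain e c"]) (simp_all add: boundary_push_chain[OF assms(1)] c(2))
qed

lemma boundary_if_push_boundary:
  assumes "\<Delta> \<subseteq> Pow V" "down_closed \<Delta>" and e: "inj e" "(`) e ` \<Delta>' \<subseteq> \<Delta>" "rel_acyclic ((`) e ` \<Delta>') \<Delta>"
    and y: "y \<in> chains \<Delta>' k" "push_chain e y \<in> boundaries \<Delta> k"
  shows "y \<in> boundaries \<Delta>' k"
proof -
  have "push_chain e y \<in> boundaries ((`) e ` \<Delta>') k"
    by (rule boundaries_of_rel_acyclic[OF e(3,2) assms(1,2) push_chain_in[OF e(1) y(1)] y(2)])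
  then obtain c where c: "c \<in> chains \<Delta>' (k + 1)" "push_chain e y = boundary (push_chain e c)"
    unfolding boundaries_def using push_chain_surj[OF e(1)] by blast
  then have "y = boundary c"
    unfolding boundary_push_chain[OF e(1)] by (intro push_chain_inject[OF e(1)])
  then show ?thesis using c(1) by (simp add: boundaries_def)
qed

lemma cycle_homologous_to_push:
  assumes "\<Delta> \<subseteq> Pow V" "down_closed \<Delta>" and e: "inj e" "(`) e ` \<Delta>' \<subseteq> \<Delta>" "rel_acyclic ((`) e ` \<Delta>') \<Delta>"
    and x: "x \<in> cycles \<Delta> k"
  shows "\<exists>y \<in> cycles \<Delta>' k. (\<lambda>l. x l - push_chain e y l) \<in> boundaries \<Delta> k"
proof -
  obtain b where b: "b \<in> chains \<Delta> (k + 1)" "(\<lambda>l. x l - boundary b l) \<in> chains ((`) e ` \<Delta>') k"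
    using e(3)[unfolded rel_acyclic_def, rule_format, OF cyclesD(1)[OF x]] cyclesD(2)[OF x] by auto
  obtain y where y: "y \<in> chains \<Delta>' k" "(\<lambda>l. x l - boundary b l) = push_chain e y"
    using push_chain_surj[OF e(1) b(2)] by blast
  have bb: "boundary b \<in> chains \<Delta> k" using boundary_chains[OF b(1) assms(1,2)] by simp
  have "boundary (push_chain e y) = (\<lambda>_. 0)"
    unfolding y(2)[symmetric] boundary_diff[OF cyclesD(1)[OF x] bb assms(1)]
      boundary_boundary[OF b(1) assms(1)] cyclesD(2)[OF x] by simp
  then have "boundary y = (\<lambda>_. 0)"
    using push_chain_inject[OF e(1), of "boundary y" "\<lambda>_. 0"] by (simp add: boundary_push_chain[OF e(1)])
  then have "y \<in> cycles \<Delta>' k" using y(1) by (simp add: cycles_def)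
  moreover have "(\<lambda>l. x l - push_chain e y l) = boundary b"
    unfolding y(2)[symmetric] by simp
  ultimately show ?thesis using b(1) by (auto simp: boundaries_def)
qed

end

text \<open>
  Two cycles correspond when their images in the larger complex are homologous there. Equivariance
  is immediate because the maps involved are inclusions.
\<close>

lemma rep_iso_of_common_supercomplex:
  assumes fin: "finite V" "finite V1" "finite V2"
    and sub: "\<Delta> \<subseteq> Pow V" "\<Delta>1 \<subseteq> Pow V1" "\<Delta>2 \<subseteq> Pow V2" and dc: "down_closed \<Delta>"
    and e1: "inj e1" "(`) e1 ` \<Delta>1 \<subseteq> \<Delta>" "rel_acyclic ((`) e1 ` \<Delta>1) \<Delta>"
    and e2: "inj e2" "(`) e2 ` \<Delta>2 \<subseteq> \<Delta>" "rel_acyclic ((`) e2 ` \<Delta>2) \<Delta>"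
    and act1: "\<And>g. g \<in> G \<Longrightarrow> bij (\<phi>1 g) \<and> (\<forall>\<sigma>\<in>\<Delta>1. \<phi>1 g ` \<sigma> \<in> \<Delta>1)"
    and act2: "\<And>g. g \<in> G \<Longrightarrow> bij (\<phi>2 g) \<and> (\<forall>\<sigma>\<in>\<Delta>2. \<phi>2 g ` \<sigma> \<in> \<Delta>2)"
    and act: "\<And>g. g \<in> G \<Longrightarrow> bij (\<psi> g) \<and> (\<forall>\<sigma>\<in>\<Delta>. \<psi> g ` \<sigma> \<in> \<Delta>)"
    and eq1: "\<And>g. g \<in> G \<Longrightarrow> \<psi> g \<circ> e1 = e1 \<circ> \<phi>1 g"
    and eq2: "\<And>g. g \<in> G \<Longrightarrow> \<psi> g \<circ> e2 = e2 \<circ> \<phi>2 g"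
  shows "rep_iso G (homology_rep \<phi>1 \<Delta>1 k) (homology_rep \<phi>2 \<Delta>2 k)"
proof (rule rep_iso_untensor[OF fin(2) sub(2) act1])
  interpret vertex_set V by standard (rule fin(1))
  interpret A: vertex_set V1 by standard (rule fin(2))
  interpret B: vertex_set V2 by standard (rule fin(3))
  let ?d = "\<lambda>x y l. push_chain e1 x l - push_chain e2 y l"
  let ?T = "{(x, y). x \<in> cycles \<Delta>1 k \<and> y \<in> cycles \<Delta>2 k \<and> ?d x y \<in> boundaries \<Delta> k}"
  show "rep_iso G (tensor_character (homology_rep \<phi>1 \<Delta>1 k) (\<lambda>_. 1)) (homology_rep \<phi>2 \<Delta>2 k)"
  proof (rule rep_iso_of_correspondence[OF fin(2,3) sub(2,3) act1 act2, where T = ?T])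
    show "?T \<subseteq> cycles \<Delta>1 k \<times> cycles \<Delta>2 k" by auto
  next
    fix x y x' y' assume a: "(x, y) \<in> ?T" "(x', y') \<in> ?T"
    then have "(\<lambda>l. ?d x y l + ?d x' y' l) \<in> boundaries \<Delta> k"
      by (intro boundaries_add[OF sub(1)]) simp_all
    then have "?d (\<lambda>l. x l + x' l) (\<lambda>l. y l + y' l) \<in> boundaries \<Delta> k"
      by (simp add: push_chain_add algebra_simps)
    then show "(\<lambda>l. x l + x' l, \<lambda>l. y l + y' l) \<in> ?T"
      using a A.cycles_add[OF sub(2)] B.cycles_add[OF sub(3)] by simp
  next
    fix a x y assume xy: "(x, y) \<in> ?T"
    then have "(\<lambda>l. a * ?d x y l) \<in> boundaries \<Delta> k"
      by (intro boundaries_scale[OF sub(1)]) simp_all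
    then have "?d (\<lambda>l. a * x l) (\<lambda>l. a * y l) \<in> boundaries \<Delta> k"
      by (simp add: push_chain_scale right_diff_distrib)
    then show "(\<lambda>l. a * x l, \<lambda>l. a * y l) \<in> ?T"
      using xy A.cycles_scale[OF sub(2)] B.cycles_scale[OF sub(3)] by simp
  next
    fix g x y assume g: "g \<in> G" and xy: "(x, y) \<in> ?T"
    have b: "bij (\<psi> g)" "\<forall>\<sigma>\<in>\<Delta>. \<psi> g ` \<sigma> \<in> \<Delta>" and b1: "bij (\<phi>1 g)" "\<forall>\<sigma>\<in>\<Delta>1. \<phi>1 g ` \<sigma> \<in> \<Delta>1"
      and b2: "bij (\<phi>2 g)" "\<forall>\<sigma>\<in>\<Delta>2. \<phi>2 g ` \<sigma> \<in> \<Delta>2"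
      using act[OF g] act1[OF g] act2[OF g] by auto
    have p1: "chain_map (\<psi> g) (push_chain e1 x) = push_chain e1 (chain_map (\<phi>1 g) x)"
      using b(1) b1(1) e1(1) by (simp add: chain_map_eq_push push_chain_comp bij_is_inj eq1[OF g])
    have p2: "chain_map (\<psi> g) (push_chain e2 y) = push_chain e2 (chain_map (\<phi>2 g) y)"
      using b(1) b2(1) e2(1) by (simp add: chain_map_eq_push push_chain_comp bij_is_inj eq2[OF g])
    have "chain_map (\<psi> g) (?d x y) \<in> boundaries \<Delta> k"
      using xy by (intro chain_map_boundaries[OF b]) simp
    also have "chain_map (\<psi> g) (?d x y) = ?d (chain_map (\<phi>1 g) x) (chain_map (\<phi>2 g) y)"
      unfolding p1[symmetric] p2[symmetric] by (simp add: chain_map_def)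
    finally show "(\<lambda>l. 1 * chain_map (\<phi>1 g) x l, chain_map (\<phi>2 g) y) \<in> ?T"
      using xy chain_map_cycles[OF b1] chain_map_cycles[OF b2] by simp
  next
    fix x assume x: "x \<in> cycles \<Delta>1 k"
    obtain y where "y \<in> cycles \<Delta>2 k" "?d x y \<in> boundaries \<Delta> k"
      using cycle_homologous_to_push[OF sub(1) dc e2 push_cycles[OF e1(1,2) x]] by blast
    then show "\<exists>(x', y) \<in> ?T. (\<lambda>l. x l - x' l) \<in> boundaries \<Delta>1 k"
      using x by (intro bexI[of _ "(x, y)"]) auto
  next
    fix y assume y: "y \<in> cycles \<Delta>2 k"
    obtain x where x: "x \<in> cycles \<Delta>1 k" "(\<lambda>l. push_chain e2 y l - push_chain e1 x l) \<in> boundaries \<Delta> k"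
      using cycle_homologous_to_push[OF sub(1) dc e1 push_cycles[OF e2(1,2) y]] by blast
    then have "?d x y \<in> boundaries \<Delta> k"
      using boundaries_scale[OF sub(1) x(2), of "-1"] by simp
    then show "\<exists>(x, y') \<in> ?T. (\<lambda>l. y l - y' l) \<in> boundaries \<Delta>2 k"
      using x(1) y by (intro bexI[of _ "(x, y)"]) auto
  next
    fix x y assume "(x, y) \<in> ?T"
    then have x: "x \<in> cycles \<Delta>1 k" and y: "y \<in> cycles \<Delta>2 k" and d: "?d x y \<in> boundaries \<Delta> k" by auto
    show "x \<in> boundaries \<Delta>1 k \<longleftrightarrow> y \<in> boundaries \<Delta>2 k"
    proof
      assume "x \<in> boundaries \<Delta>1 k"
      from boundaries_diff[OF sub(1) push_boundaries[OF e1(1,2) this] d]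
      have "push_chain e2 y \<in> boundaries \<Delta> k" by simp
      then show "y \<in> boundaries \<Delta>2 k"
        by (rule boundary_if_push_boundary[OF sub(1) dc e2 cyclesD(1)[OF y]])
    next
      assume "y \<in> boundaries \<Delta>2 k"
      from boundaries_add[OF sub(1) d push_boundaries[OF e2(1,2) this]]
      have "push_chain e1 x \<in> boundaries \<Delta> k" by simp
      then show "x \<in> boundaries \<Delta>1 k"
        by (rule boundary_if_push_boundary[OF sub(1) dc e1 cyclesD(1)[OF x]])
    qed
  qed
qed

section \<open>Complexes with a closure operator\<close>

text \<open>
  A simplicial model of the mapping cylinder of the closure operator: the faces with empty second part form
  \<open>N\<close>, those with empty first part form the order complex of \<open>P\<close>.
\<close>

definition mixed_complex :: "'a set set \<Rightarrow> 'a set set \<Rightarrow> ('a + 'a set) set set" where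
  "mixed_complex N P = {X. Inl -` X \<in> N \<and> Inr -` X \<in> order_complex P \<and> (\<forall>F \<in> Inr -` X. Inl -` X \<subseteq> F)}"

lemma order_complex_iff:
  "C \<in> order_complex P \<longleftrightarrow> finite C \<and> C \<subseteq> P \<and> (\<forall>X\<in>C. \<forall>Y\<in>C. X \<subseteq> Y \<or> Y \<subseteq> X)"
  by (simp add: order_complex_def subset_chain_def)

lemma order_complex_subset: "C \<in> order_complex P \<Longrightarrow> C' \<subseteq> C \<Longrightarrow> C' \<in> order_complex P"
  unfolding order_complex_iff by (meson finite_subset subsetD order_trans)

lemma mixed_complexD:
  assumes "X \<in> mixed_complex N P"
  shows "Inl -` X \<in> N" "Inr -` X \<in> order_complex P" "F \<in> Inr -` X \<Longrightarrow> Inl -` X \<subseteq> F" "Inr -` X \<subseteq> P"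
  using assms by (simp_all add: mixed_complex_def order_complex_iff)

lemma vimage_sum_simps [simp]:
  "Inl -` insert (Inl v) X = insert v (Inl -` X)" "Inr -` insert (Inl v) X = Inr -` X"
  "Inl -` insert (Inr F) X = Inl -` X" "Inr -` insert (Inr F) X = insert F (Inr -` X)"
  "Inl -` (X - {Inl v}) = (Inl -` X) - {v}" "Inr -` (X - {Inl v}) = Inr -` X"
  "Inl -` (X - {Inr F}) = Inl -` X" "Inr -` (X - {Inr F}) = (Inr -` X) - {F}"
  "Inl -` (Inl ` A) = A" "Inr -` (Inr ` C) = C" "Inl -` (Inr ` C) = {}" "Inr -` (Inl ` A) = {}"
  by auto

lemma vimage_map_sum:
  "Inl -` (map_sum f h ` X) = f ` (Inl -` X)" "Inr -` (map_sum f h ` X) = h ` (Inr -` X)"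
proof -
  have "Inl y = map_sum f h x \<longleftrightarrow> (\<exists>a. x = Inl a \<and> y = f a)"
    and "Inr z = map_sum f h x \<longleftrightarrow> (\<exists>b. x = Inr b \<and> z = h b)" for x y z
    by (cases x; auto)+
  note * = this
  show "Inl -` (map_sum f h ` X) = f ` (Inl -` X)" "Inr -` (map_sum f h ` X) = h ` (Inr -` X)"
    by (rule Set.set_eqI; simp add: image_iff *; auto)+
qed

lemma sum_set_eqI: "Inl -` X = Inl -` Y \<Longrightarrow> Inr -` X = Inr -` Y \<Longrightarrow> X = Y"
  by (rule Set.set_eqI) (metis sum.exhaust_sel vimageE vimageI)

lemma mixed_complex_no_flats: "mixed_complex N {} = (`) Inl ` N"
proof (intro subset_antisym subsetI)
  fix X assume "X \<in> mixed_complex N {}"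
  then have X: "Inl -` X \<in> N" "Inr -` X = {}"
    by (simp_all add: mixed_complex_def order_complex_iff)
  have "X = Inl ` (Inl -` X)" by (rule sum_set_eqI) (simp_all add: X(2))
  with X(1) show "X \<in> (`) Inl ` N" by blast
qed (auto simp: mixed_complex_def order_complex_iff)

lemma mixed_complex_no_sets: "mixed_complex {{}} P = (`) Inr ` order_complex P"
proof (intro subset_antisym subsetI)
  fix X assume "X \<in> mixed_complex {{}} P"
  then have X: "Inr -` X \<in> order_complex P" "Inl -` X = {}"
    by (simp_all add: mixed_complex_def)
  have "X = Inr ` (Inr -` X)" by (rule sum_set_eqI) (simp_all add: X(2))
  with X(1) show "X \<in> (`) Inr ` order_complex P" by blast
qed (auto simp: mixed_complex_def)

lemma down_closedD: "down_closed \<Delta> \<Longrightarrow> \<sigma> \<in> \<Delta> \<Longrightarrow> \<tau> \<subseteq> \<sigma> \<Longrightarrow> \<tau> \<in> \<Delta>"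
  unfolding down_closed_def by blast

lemma down_closed_mixed:
  assumes "down_closed N"
  shows "down_closed (mixed_complex N P)"
  unfolding down_closed_def
proof (intro ballI allI impI)
  fix X Y :: "('a + 'a set) set" assume X: "X \<in> mixed_complex N P" and "Y \<subseteq> X"
  then have s: "Inl -` Y \<subseteq> Inl -` X" "Inr -` Y \<subseteq> Inr -` X" by auto
  moreover have "Inl -` Y \<in> N" using X s(1) down_closedD[OF assms] by (auto simp: mixed_complex_def)
  moreover have "Inr -` Y \<in> order_complex P"
    by (rule order_complex_subset[OF mixed_complexD(2)[OF X] s(2)])
  moreover have "Inl -` Y \<subseteq> F" if "F \<in> Inr -` Y" for F
    using s(1) mixed_complexD(3)[OF X subsetD[OF s(2) that]] by (rule order_trans)
  ultimately show "Y \<in> mixed_complex N P"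
    unfolding mixed_complex_def by simp
qed

text \<open>
  The situation of the nonspanning sets and the proper flats, reduced to what the comparison of the two complexes
  uses: \<open>cl\<close> is only applied to nonempty faces, where it gives the least member of \<open>P\<close> above.
\<close>

locale closed_faces =
  fixes E :: "'a set" and N P :: "'a set set" and cl :: "'a set \<Rightarrow> 'a set"
  assumes finite_E: "finite E" and N_sub: "N \<subseteq> Pow E" and dc_N: "down_closed N" and empty_N: "{} \<in> N"
    and P_N: "P \<subseteq> N" and P_nonempty: "F \<in> P \<Longrightarrow> F \<noteq> {}"
    and cl_P: "A \<in> N \<Longrightarrow> A \<noteq> {} \<Longrightarrow> cl A \<in> P"
    and cl_least: "A \<in> N \<Longrightarrow> A \<noteq> {} \<Longrightarrow> F \<in> P \<Longrightarrow> cl A \<subseteq> F \<longleftrightarrow> A \<subseteq> F"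
begin

lemma finite_N: "finite N" "finite P"
  using finite_subset[OF N_sub] finite_E finite_subset[OF P_N] by auto

sublocale vertex_set "E <+> P"
  by standard (use finite_E finite_N in auto)

lemma mixed_sub:
  assumes "W \<subseteq> N" "U \<subseteq> P"
  shows "mixed_complex W U \<subseteq> Pow (E <+> P)"
proof
  fix X assume X: "X \<in> mixed_complex W U"
  have "x \<in> E <+> P" if "x \<in> X" for x
  proof (cases x)
    case (Inl v)
    then have "v \<in> Inl -` X" using that by simp
    moreover have "Inl -` X \<in> Pow E" using mixed_complexD(1)[OF X] assms(1) N_sub by (meson subsetD)
    ultimately show ?thesis using Inl by blast
  next
    case (Inr F)
    then have "F \<in> Inr -` X" using that by auto
    moreover have "Inr -` X \<subseteq> P" using mixed_complexD(4)[OF X] assms(2) by (rule order_trans)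
    ultimately show ?thesis using Inr by blast
  qed
  then show "X \<in> Pow (E <+> P)" by blast
qed

text \<open>
  The members of \<open>P\<close> are added so that each new one, \<open>F\<close>, is minimal among those present. A new face contains \<open>F\<close> as
  the least member of its chain, so its set part lies inside \<open>F\<close> and any fixed \<open>v \<in> F\<close> may be added or
  removed.
\<close>

lemma rel_acyclic_add_closed:
  assumes "U \<subseteq> P"
  shows "rel_acyclic (mixed_complex N {}) (mixed_complex N U)"
  using finite_subset[OF assms finite_N(2)] assms
proof (induction U rule: finite_psubset_induct)
  case (psubset U)
  show ?case
  proof (cases "U = {}")
    case False
    obtain F where F: "F \<in> U" "\<And>F'. F' \<in> U \<Longrightarrow> F' \<subseteq> F \<Longrightarrow> F' = F"
      using finite_has_minimal[OF psubset.hyps(1) False] by metis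
    have "F \<in> P" using F(1) psubset.prems by blast
    then obtain v where v: "v \<in> F" using P_nonempty by blast
    have FN: "F \<in> N" using \<open>F \<in> P\<close> P_N by blast
    then have "v \<in> E" using v N_sub by blast
    let ?U = "U - {F}"
    have mono: "mixed_complex N {} \<subseteq> mixed_complex N ?U" "mixed_complex N ?U \<subseteq> mixed_complex N U"
      by (auto simp: mixed_complex_def order_complex_iff)
    have "rel_acyclic (mixed_complex N ?U) (mixed_complex N U)"
    proof (rule rel_acyclic_toggle[of _ _ "Inl v"])
      fix \<sigma> assume s: "\<sigma> \<in> mixed_complex N U - mixed_complex N ?U"
      let ?A = "Inl -` \<sigma>" and ?C = "Inr -` \<sigma>"
      have C: "?C \<in> order_complex U" and AC: "\<forall>F'\<in>?C. ?A \<subseteq> F'" and AN: "?A \<in> N"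
        using s by (auto simp: mixed_complex_def)
      have FC: "F \<in> ?C"
      proof (rule ccontr)
        assume "F \<notin> ?C"
        then have "?C \<in> order_complex ?U" using C unfolding order_complex_iff by blast
        then show False using AC AN s by (simp add: mixed_complex_def)
      qed
      have "F \<subseteq> F'" if "F' \<in> ?C" for F'
        using C F(2)[of F'] that FC unfolding order_complex_iff by blast
      then have "\<forall>F'\<in>?C. insert v ?A \<subseteq> F'" using AC v by blast
      moreover have "insert v ?A \<in> N"
        using down_closedD[OF dc_N FN, of "insert v ?A"] AC FC v by blast
      moreover have "?A - {v} \<in> N" using down_closedD[OF dc_N AN] by blast
      ultimately show "insert (Inl v) \<sigma> \<in> mixed_complex N U \<and>
          \<sigma> - {Inl v} \<in> mixed_complex N U - mixed_complex N ?U"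
        using C AC FC by (auto simp: mixed_complex_def order_complex_iff)
    qed (use mono mixed_sub[OF _ psubset.prems] down_closed_mixed[OF dc_N] \<open>v \<in> E\<close> in auto)
    moreover have "rel_acyclic (mixed_complex N {}) (mixed_complex N ?U)"
      by (rule psubset.IH) (use F(1) psubset.prems in auto)
    ultimately show ?thesis
      using rel_acyclic_trans mono mixed_sub[OF subset_refl psubset.prems] down_closed_mixed[OF dc_N] by blast
  qed (simp add: rel_acyclic_refl)
qed

text \<open>
  The sets are added so that each new one, \<open>A\<close>, is maximal among those present. A new face has set part exactly
  \<open>A\<close> and a chain of members of \<open>P\<close> that contain \<open>A\<close>, hence contain \<open>cl A\<close>; so \<open>cl A\<close> may be added
  to or removed from the chain.
\<close>

lemma rel_acyclic_add_sets:
  assumes "W \<subseteq> N" "down_closed W" "{} \<in> W"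
  shows "rel_acyclic (mixed_complex {{}} P) (mixed_complex W P)"
  using finite_subset[OF assms(1) finite_N(1)] assms
proof (induction W rule: finite_psubset_induct)
  case (psubset W)
  show ?case
  proof (cases "W = {{}}")
    case False
    obtain A where A: "A \<in> W" "\<And>A'. A' \<in> W \<Longrightarrow> A \<subseteq> A' \<Longrightarrow> A' = A"
      using finite_has_maximal[OF psubset.hyps(1)] psubset.prems(3) by (metis empty_iff)
    have ne: "A \<noteq> {}"
    proof
      assume "A = {}"
      then have "W \<subseteq> {{}}" using A(2) by blast
      then show False using False psubset.prems(3) by blast
    qed
    have AN: "A \<in> N" using A(1) psubset.prems by blast
    note clA = cl_P[OF AN ne]
    let ?W = "W - {A}"
    have dcW: "down_closed ?W"
      unfolding down_closed_def
    proof (intro ballI allI impI)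
      fix \<sigma> \<tau> assume "\<sigma> \<in> W - {A}" "\<tau> \<subseteq> \<sigma>"
      then show "\<tau> \<in> W - {A}"
        using down_closedD[OF psubset.prems(2)] A(2) by blast
    qed
    have mono: "mixed_complex {{}} P \<subseteq> mixed_complex ?W P" "mixed_complex ?W P \<subseteq> mixed_complex W P"
      using psubset.prems(3) ne by (auto simp: mixed_complex_def)
    have "rel_acyclic (mixed_complex ?W P) (mixed_complex W P)"
    proof (rule rel_acyclic_toggle[of _ _ "Inr (cl A)"])
      fix \<sigma> assume s: "\<sigma> \<in> mixed_complex W P - mixed_complex ?W P"
      have C: "Inr -` \<sigma> \<in> order_complex P" and AC: "\<forall>F\<in>Inr -` \<sigma>. A \<subseteq> F" and A_eq: "Inl -` \<sigma> = A"
        using s by (auto simp: mixed_complex_def)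
      have "\<forall>F\<in>Inr -` \<sigma>. cl A \<subseteq> F"
      proof
        fix F assume F: "F \<in> Inr -` \<sigma>"
        have "F \<in> P" using C F unfolding order_complex_iff by (meson subsetD)
        then show "cl A \<subseteq> F" using cl_least[OF AN ne] bspec[OF AC F] by simp
      qed
      moreover have "A \<subseteq> cl A" using cl_least[OF AN ne clA] by simp
      ultimately show "insert (Inr (cl A)) \<sigma> \<in> mixed_complex W P \<and>
          \<sigma> - {Inr (cl A)} \<in> mixed_complex W P - mixed_complex ?W P"
        using C AC A(1) clA by (auto simp: mixed_complex_def order_complex_iff A_eq)
    qed (use mono mixed_sub[OF psubset.prems(1)] down_closed_mixed[OF dcW]
        down_closed_mixed[OF psubset.prems(2)] clA in auto)
    moreover have "rel_acyclic (mixed_complex {{}} P) (mixed_complex ?W P)"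
      by (rule psubset.IH) (use A(1) ne psubset.prems dcW in auto)
    ultimately show ?thesis
      using rel_acyclic_trans mono mixed_sub[OF psubset.prems(1) subset_refl]
        down_closed_mixed[OF psubset.prems(2)] by blast
  qed (simp add: rel_acyclic_refl)
qed

theorem rep_iso_closed_faces:
  assumes G: "\<And>g. g \<in> G \<Longrightarrow> bij g \<and> (\<forall>A\<in>N. g ` A \<in> N) \<and> (\<forall>F\<in>P. g ` F \<in> P)"
  shows "rep_iso G (homology_rep (\<lambda>g. g) N k) (homology_rep (\<lambda>g F. g ` F) (order_complex P) k)"
proof (rule rep_iso_of_common_supercomplex[where \<Delta> = "mixed_complex N P" and V = "E <+> P"
      and ?V1.0 = E and ?V2.0 = P and ?e1.0 = Inl and ?e2.0 = Inr and \<psi> = "\<lambda>g. map_sum g (image g)"])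
  show "finite (E <+> P)" "finite E" "finite P" using finite_E finite_N by auto
  show "mixed_complex N P \<subseteq> Pow (E <+> P)" by (rule mixed_sub) auto
  show "N \<subseteq> Pow E" by (rule N_sub)
  show "order_complex P \<subseteq> Pow P" by (auto simp: order_complex_iff)
  show "down_closed (mixed_complex N P)" by (rule down_closed_mixed[OF dc_N])
  show "inj Inl" "inj Inr" by auto
  show "(`) Inl ` N \<subseteq> mixed_complex N P"
    by (auto simp: mixed_complex_def order_complex_iff)
  show "(`) Inr ` order_complex P \<subseteq> mixed_complex N P"
    using empty_N by (auto simp: mixed_complex_def)
  show "rel_acyclic ((`) Inl ` N) (mixed_complex N P)"
    using rel_acyclic_add_closed[OF subset_refl] by (simp add: mixed_complex_no_flats)
  show "rel_acyclic ((`) Inr ` order_complex P) (mixed_complex N P)"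
    using rel_acyclic_add_sets[OF subset_refl dc_N empty_N] by (simp add: mixed_complex_no_sets)
next
  fix g assume g: "g \<in> G"
  have bij: "bij g" and gN: "\<And>A. A \<in> N \<Longrightarrow> g ` A \<in> N" and gP: "\<And>F. F \<in> P \<Longrightarrow> g ` F \<in> P"
    using G[OF g] by auto
  show "bij g \<and> (\<forall>A\<in>N. g ` A \<in> N)" using bij gN by blast
  have oc: "(`) g ` C \<in> order_complex P" if "C \<in> order_complex P" for C
  proof -
    have C: "finite C" "C \<subseteq> P" and ch: "\<And>X Y. X \<in> C \<Longrightarrow> Y \<in> C \<Longrightarrow> X \<subseteq> Y \<or> Y \<subseteq> X"
      using that unfolding order_complex_iff by auto
    have "g ` X \<subseteq> g ` Y \<or> g ` Y \<subseteq> g ` X" if "X \<in> C" "Y \<in> C" for X Y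
      using ch[OF that] by (meson image_mono)
    then show ?thesis
      unfolding order_complex_iff using C(1) subsetD[OF C(2)] gP by (simp add: image_subset_iff)
  qed
  have bij2: "bij ((`) g)"
    using bij_betw_Pow[OF bij] by simp
  show "bij ((`) g) \<and> (\<forall>C\<in>order_complex P. (`) g ` C \<in> order_complex P)"
    using bij2 oc by blast
  have "bij (map_sum g ((`) g))"
  proof (rule bijI)
    show "inj (map_sum g ((`) g))"
      by (rule sum.inj_map) (use bij bij2 bij_is_inj in blast)+
    show "surj (map_sum g ((`) g))"
    proof (rule surjI)
      fix y
      show "map_sum g ((`) g) (map_sum (inv_into UNIV g) (inv_into UNIV ((`) g)) y) = y"
        using bij_is_surj[OF bij] bij_is_surj[OF bij2] by (cases y) (simp_all add: surj_f_inv_f)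
    qed
  qed
  moreover have "map_sum g ((`) g) ` X \<in> mixed_complex N P" if X: "X \<in> mixed_complex N P" for X
  proof -
    have v: "Inl -` (map_sum g ((`) g) ` X) = g ` (Inl -` X)" "Inr -` (map_sum g ((`) g) ` X) = (`) g ` (Inr -` X)"
      by (rule vimage_map_sum)+
    have "g ` (Inl -` X) \<subseteq> g ` F" if "F \<in> Inr -` X" for F
      by (rule image_mono[OF mixed_complexD(3)[OF X that]])
    then show ?thesis
      using gN[OF mixed_complexD(1)[OF X]] oc[OF mixed_complexD(2)[OF X]]
      unfolding mixed_complex_def v mem_Collect_eq by blast
  qed
  ultimately show "bij (map_sum g ((`) g)) \<and> (\<forall>X\<in>mixed_complex N P. map_sum g ((`) g) ` X \<in> mixed_complex N P)"
    by blast
  show "map_sum g ((`) g) \<circ> Inl = Inl \<circ> g" "map_sum g ((`) g) \<circ> Inr = Inr \<circ> (`) g"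
    by auto
qed

end


section \<open>Orthogonal projection\<close>

text \<open>
  Projection onto a subspace \<open>W\<close> for the inner product given by a finite set of sample points. The induction is on
  the sample points, so that \<open>W\<close> may have any dimension: the members of \<open>W\<close> vanishing at the new point
  form a subspace covered by the induction hypothesis, and \<open>W\<close> exceeds it by at most one dimension.
\<close>

lemma orthogonal_projection:
  fixes e :: "'i \<Rightarrow> 'x" and c :: "'x \<Rightarrow> complex"
  assumes "finite X" "(\<lambda>_. 0) \<in> W" "\<And>a w w'. w \<in> W \<Longrightarrow> w' \<in> W \<Longrightarrow> (\<lambda>x. w x + a * w' x) \<in> W"
  shows "\<exists>w\<in>W. \<forall>w'\<in>W. (\<Sum>i\<in>X. (c (e i) - w (e i)) * cnj (w' (e i))) = 0"
  using assms
proof (induction X arbitrary: W c rule: finite_induct)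
  case empty
  then show ?case by auto
next
  case (insert a X)
  define I where "I x y = (\<Sum>i\<in>insert a X. x (e i) * cnj (y (e i)))" for x y :: "'x \<Rightarrow> complex"
  have I_lin: "I (\<lambda>s. x s + b * x' s) y = I x y + b * I x' y"
    and I_antilin: "I x (\<lambda>s. y s + b * y' s) = I x y + cnj b * I x y'" for x x' y y' b
    by (simp_all add: I_def sum.distrib sum_distrib_left algebra_simps)
  define W0 where "W0 = {w \<in> W. w (e a) = 0}"
  have IH: "\<exists>p\<in>W0. \<forall>w'\<in>W0. I (\<lambda>s. d s + (-1) * p s) w' = 0" for d
  proof -
    have "\<exists>p\<in>W0. \<forall>w'\<in>W0. (\<Sum>i\<in>X. (d (e i) - p (e i)) * cnj (w' (e i))) = 0"
      by (rule insert.IH) (use insert.prems in \<open>auto simp: W0_def\<close>)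
    then obtain p where p: "p \<in> W0" "\<And>w'. w' \<in> W0 \<Longrightarrow> (\<Sum>i\<in>X. (d (e i) - p (e i)) * cnj (w' (e i))) = 0"
      by blast
    have "I (\<lambda>s. d s + (-1) * p s) w' = 0" if "w' \<in> W0" for w'
    proof -
      have "w' (e a) = 0" using that by (simp add: W0_def)
      then show ?thesis using p(2)[OF that] insert.hyps by (simp add: I_def)
    qed
    then show ?thesis using p(1) by blast
  qed
  have goal: "\<exists>w\<in>W. \<forall>w'\<in>W. I (\<lambda>s. c s + (-1) * w s) w' = 0"
  proof (cases "W0 = W")
    case True
    then show ?thesis using IH[of c] by simp
  next
    case False
    then obtain w1 where w1: "w1 \<in> W" "w1 (e a) \<noteq> 0" by (auto simp: W0_def)
    obtain p1 where p1: "p1 \<in> W0" "\<And>w'. w' \<in> W0 \<Longrightarrow> I (\<lambda>s. w1 s + (-1) * p1 s) w' = 0"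
      using IH[of w1] by blast
    \<comment> \<open>\<open>q\<close> spans the orthogonal complement of \<open>W0\<close> in \<open>W\<close>.\<close>
    define q where "q = (\<lambda>s. w1 s + (-1) * p1 s)"
    have q: "q \<in> W" unfolding q_def by (rule insert.prems(2)) (use w1 p1 in \<open>auto simp: W0_def\<close>)
    have qa: "q (e a) \<noteq> 0" using w1(2) p1(1) by (simp add: q_def W0_def)
    have q_perp: "I q w' = 0" if "w' \<in> W0" for w' using p1(2)[OF that] by (simp add: q_def)
    have "I q q = of_real (\<Sum>i\<in>insert a X. (norm (q (e i)))\<^sup>2)"
      by (simp add: I_def complex_norm_square[symmetric])
    moreover have "(\<Sum>i\<in>insert a X. (norm (q (e i)))\<^sup>2) > 0"
      using insert.hyps qa by (intro sum_pos2[of _ a]) auto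
    ultimately have qq: "I q q \<noteq> 0" by (metis less_irrefl of_real_eq_0_iff)
    obtain p where p: "p \<in> W0" "\<And>w'. w' \<in> W0 \<Longrightarrow> I (\<lambda>s. c s + (-1) * p s) w' = 0"
      using IH[of c] by blast
    define r where "r = (\<lambda>s. c s + (-1) * p s)"
    have r_perp: "I r w' = 0" if "w' \<in> W0" for w' using p(2)[OF that] by (simp add: r_def)
    define \<alpha> where "\<alpha> = I r q / I q q"
    define w where "w = (\<lambda>s. p s + \<alpha> * q s)"
    have "w \<in> W" unfolding w_def by (rule insert.prems(2)) (use q p in \<open>auto simp: W0_def\<close>)
    moreover have "I (\<lambda>s. c s + (-1) * w s) w' = 0" if w': "w' \<in> W" for w'
    proof -
      define \<beta> where "\<beta> = w' (e a) / q (e a)"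
      define w'' where "w'' = (\<lambda>s. w' s + (- \<beta>) * q s)"
      have "w'' \<in> W" unfolding w''_def by (rule insert.prems(2)[OF w' q])
      then have w'': "w'' \<in> W0" using qa by (simp add: W0_def w''_def \<beta>_def)
      have eq1: "(\<lambda>s. c s + (-1) * w s) = (\<lambda>s. r s + (- \<alpha>) * q s)"
        by (simp add: r_def w_def algebra_simps)
      have eq2: "w' = (\<lambda>s. w'' s + \<beta> * q s)"
        by (simp add: w''_def)
      have "I (\<lambda>s. c s + (-1) * w s) w' = cnj \<beta> * (I r q - \<alpha> * I q q)"
        unfolding eq1 by (subst eq2) (simp only: I_lin I_antilin r_perp[OF w''] q_perp[OF w''], simp add: algebra_simps)
      also have "\<dots> = 0" using qq by (simp add: \<alpha>_def)
      finally show ?thesis .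
    qed
    ultimately show ?thesis by blast
  qed
  then show ?case by (simp add: I_def)
qed

section \<open>Complementation of chains\<close>

lemma alternating_append:
  assumes "alternating c" "\<pi> permutes set l" "set l \<inter> set m = {}"
  shows "c (map \<pi> l @ m) = of_int (sign \<pi>) * c (l @ m)"
    and "c (m @ map \<pi> l) = of_int (sign \<pi>) * c (m @ l)"
proof -
  have fixed: "map \<pi> m = m" using permutes_append_fix[OF assms(2)] assms(3) by blast
  have p: "\<pi> permutes set (l @ m)" "\<pi> permutes set (m @ l)"
    by (rule permutes_subset[OF assms(2)]; auto)+
  show "c (map \<pi> l @ m) = of_int (sign \<pi>) * c (l @ m)"
    "c (m @ map \<pi> l) = of_int (sign \<pi>) * c (m @ l)"
    using alternating_perm[OF assms(1) p(1)] alternating_perm[OF assms(1) p(2)] fixed by simp_all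
qed

lemma sign_square: "of_int (sign \<pi>) * (of_int (sign \<pi>) :: complex) = 1"
  by (metis of_int_1 of_int_mult sign_idempotent)

context vertex_set
begin

definition volume :: "'v list \<Rightarrow> complex" where
  "volume = oriented_simplex (enum V)"

text \<open>
  The Hodge star of the standard simplex: the coefficient of a face is that of its complement, with the
  sign that makes the two together positively oriented. As \<open>star_apply\<close> shows, any
  ordering of the complement may be used.
\<close>

definition star :: "('v list \<Rightarrow> complex) \<Rightarrow> 'v list \<Rightarrow> complex" where
  "star c m = c (enum (V - set m)) * volume (enum (V - set m) @ m)"

definition coboundary :: "('v list \<Rightarrow> complex) \<Rightarrow> 'v list \<Rightarrow> complex" where
  "coboundary c l = (\<Sum>v\<in>V. wedge v c l)"

definition inner_chain :: "('v list \<Rightarrow> complex) \<Rightarrow> ('v list \<Rightarrow> complex) \<Rightarrow> complex" where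
  "inner_chain c d = (\<Sum>A\<in>Pow V. c (enum A) * cnj (d (enum A)))"

text \<open>
  The Alexander dual of a complex \<open>N\<close> is \<open>complements (Pow V - N)\<close>.
\<close>

definition complements :: "'v set set \<Rightarrow> 'v set set" where
  "complements \<Delta> = {A. A \<subseteq> V \<and> V - A \<in> \<Delta>}"

lemma complements_complements: "\<Delta> \<subseteq> Pow V \<Longrightarrow> complements (complements \<Delta>) = \<Delta>"
  by (auto simp: complements_def double_diff)

lemma complements_sub: "complements \<Delta> \<subseteq> Pow V"
  by (auto simp: complements_def)

lemma alternating_volume: "alternating volume"
  unfolding volume_def by (rule alternating_oriented_simplex) (simp add: enum finite_V)

lemma volume_nonzero: "volume l \<noteq> 0 \<Longrightarrow> distinct l \<and> set l = V"
  unfolding volume_def using oriented_simplex_support[of "enum V" l] enum[OF finite_V] by auto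

lemma volume_square: "distinct l \<Longrightarrow> set l = V \<Longrightarrow> volume l * volume l = 1"
  using oriented_simplex_cases[of "enum V" l] enum[OF finite_V] by (auto simp: volume_def)

lemma volume_move: "volume (v # xs @ ys) = (- 1) ^ length xs * volume (xs @ v # ys)"
  unfolding volume_def by (rule oriented_simplex_move) (simp add: enum finite_V)

lemma volume_move_back: "volume (xs @ v # ys) = (- 1) ^ length xs * volume (v # xs @ ys)"
  by (simp add: volume_move mult.assoc[symmetric])

lemma volume_swap_blocks: "volume (m @ l @ p) = (- 1) ^ (length m * length l) * volume (l @ m @ p)"
proof (induction m arbitrary: p)
  case (Cons a m)
  have "volume ((a # m) @ l @ p) = (- 1) ^ length (m @ l) * volume (m @ l @ a # p)"
    using volume_move[of a "m @ l" p] by simp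
  also have "volume (m @ l @ a # p) = (- 1) ^ (length m * length l) * volume (l @ m @ a # p)"
    by (rule Cons.IH)
  also have "volume (l @ m @ a # p) = (- 1) ^ length (l @ m) * volume (a # l @ m @ p)"
    using volume_move_back[of "l @ m" a p] by simp
  also have "volume (a # l @ m @ p) = (- 1) ^ length l * volume (l @ (a # m) @ p)"
    using volume_move[of a l "m @ p"] by simp
  finally have "volume ((a # m) @ l @ p) =
      ((- 1) ^ length (m @ l) * (- 1) ^ length (l @ m)) * (- 1) ^ (length m * length l + length l) * volume (l @ (a # m) @ p)"
    by (simp add: power_add)
  also have "(- 1) ^ length (m @ l) * (- 1) ^ length (l @ m) = (1 :: complex)"
    by (simp add: add.commute minus_one_mult_self)
  finally show ?case by (simp add: add.commute)
qed simp

lemma star_apply: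
  assumes "alternating c" "distinct l" "set l = V - set m"
  shows "star c m = c l * volume (l @ m)"
proof -
  let ?l = "enum (V - set m)"
  have l0: "distinct ?l" "set ?l = V - set m" by (simp_all add: enum finite_V)
  obtain \<pi> where p: "\<pi> permutes set ?l" "l = map \<pi> ?l"
    using oriented_simplex_permutation[OF l0(1) assms(2)] l0(2) assms(3) by metis
  have "c l = of_int (sign \<pi>) * c ?l" using alternating_perm[OF assms(1) p(1)] p(2) by simp
  moreover have "volume (l @ m) = of_int (sign \<pi>) * volume (?l @ m)"
    using alternating_append(1)[OF alternating_volume p(1)] p(2) l0(2) by auto
  ultimately have "c l * volume (l @ m) = (of_int (sign \<pi>) * of_int (sign \<pi>)) * (c ?l * volume (?l @ m))"
    by simp
  then show ?thesis by (simp only: sign_square star_def mult_1)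
qed

lemma alternating_star: "alternating (star c)"
  unfolding alternating_def
proof (intro conjI allI impI)
  fix m assume "star c m \<noteq> 0"
  then have "volume (enum (V - set m) @ m) \<noteq> 0" by (auto simp: star_def)
  then show "distinct m" using volume_nonzero by fastforce
next
  fix m and \<pi> :: "'v \<Rightarrow> 'v" assume p: "\<pi> permutes set m"
  have "set m \<inter> set (enum (V - set m)) = {}" by (simp add: enum finite_V)
  from alternating_append(2)[OF alternating_volume p this]
  show "star c (map \<pi> m) = of_int (sign \<pi>) * star c m"
    by (simp add: star_def permutes_image[OF p])
qed

lemma star_in_chains:
  assumes "c \<in> chains \<Delta> k"
  shows "star c \<in> chains (complements \<Delta>) (int (card V) - 2 - k)"
proof (rule chainsI[OF alternating_star complements_sub])
  fix m assume nz: "star c m \<noteq> 0"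
  let ?l = "enum (V - set m)"
  have v: "volume (?l @ m) \<noteq> 0" and c: "c ?l \<noteq> 0" using nz by (auto simp: star_def)
  have d: "distinct (?l @ m)" "set (?l @ m) = V" using volume_nonzero[OF v] by auto
  have "length (?l @ m) = card V" using distinct_card[OF d(1)] d(2) by metis
  moreover have "set m \<subseteq> V" using d(2) by auto
  ultimately show "set m \<in> complements \<Delta> \<and> int (length m) = int (card V) - 2 - k + 1"
    using chainsD[OF assms c]
    by (simp add: complements_def enum finite_V)
qed

text \<open>
  The sign is that of moving one block of a volume-form argument past the complementary block. It makes
  \<open>star\<close> bijective.
\<close>

lemma star_star:
  assumes "c \<in> chains \<Delta> k" "\<Delta> \<subseteq> Pow V"
  shows "star (star c) = (\<lambda>l. (- 1) ^ (nat (k + 1) * (card V - nat (k + 1))) * c l)"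
proof
  fix l
  let ?m = "enum (V - set l)"
  show "star (star c) l = (- 1) ^ (nat (k + 1) * (card V - nat (k + 1))) * c l"
  proof (cases "distinct l \<and> set l \<subseteq> V")
    case True
    have m: "distinct ?m" "set ?m = V - set l" by (simp_all add: enum finite_V)
    have "star c ?m = c l * volume (l @ ?m)"
      by (rule star_apply[OF chains_alternating[OF assms(1)]]) (use True m in auto)
    moreover have "volume (?m @ l) = (- 1) ^ (length ?m * length l) * volume (l @ ?m)"
      using volume_swap_blocks[of ?m l "[]"] by simp
    moreover have "volume (l @ ?m) * volume (l @ ?m) = 1"
      by (rule volume_square) (use True m in auto)
    ultimately have s: "star (star c) l = (- 1) ^ (length ?m * length l) * c l"
      by (simp add: star_def mult.assoc mult.left_commute)
    show ?thesis
    proof (cases "c l = 0")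
      case False
      have "nat (k + 1) = length l" using chainsD[OF assms(1) False] by (metis nat_int)
      moreover have "length ?m = card V - length l"
        using distinct_card[OF m(1)] m(2) True distinct_card[of l] by (simp add: card_Diff_subset)
      ultimately show ?thesis using s by (simp add: mult.commute)
    qed (simp add: s)
  next
    case False
    have "volume (?m @ l) = 0" using volume_nonzero[of "?m @ l"] False by auto
    moreover have "c l = 0"
      using False chainsD[OF assms(1), of l] assms(2) alternating_nondistinct[OF chains_alternating[OF assms(1)]]
      by blast
    ultimately show ?thesis by (simp add: star_def)
  qed
qed

lemma star_scale: "star (\<lambda>l. a * c l) = (\<lambda>l. a * star c l)"
  by (simp add: star_def fun_eq_iff)

lemma star_add: "star (\<lambda>l. c l + d l) = (\<lambda>l. star c l + star d l)"
  by (simp add: star_def fun_eq_iff distrib_right)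

lemma star_diff: "star (\<lambda>l. c l - d l) = (\<lambda>l. star c l - star d l)"
  by (simp add: star_def fun_eq_iff left_diff_distrib)

lemma star_zero [simp]: "star (\<lambda>_. 0) = (\<lambda>_. 0)"
  by (simp add: star_def fun_eq_iff)

lemma star_inject:
  assumes "c \<in> chains \<Delta> k" "\<Delta> \<subseteq> Pow V" "star c = (\<lambda>_. 0)"
  shows "c = (\<lambda>_. 0)"
  using star_star[OF assms(1,2)] assms(3) by (simp add: fun_eq_iff)

lemma star_surj:
  assumes "u \<in> chains (complements \<Delta>) k" "\<Delta> \<subseteq> Pow V"
  shows "\<exists>z \<in> chains \<Delta> (int (card V) - 2 - k). star z = u"
proof -
  let ?s = "(- 1) ^ (nat (k + 1) * (card V - nat (k + 1))) :: complex"
  have "star u \<in> chains \<Delta> (int (card V) - 2 - k)"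
    using star_in_chains[OF assms(1)] complements_complements[OF assms(2)] by simp
  then have "(\<lambda>l. ?s * star u l) \<in> chains \<Delta> (int (card V) - 2 - k)" by (rule chains_scale)
  moreover have "star (\<lambda>l. ?s * star u l) = u"
    unfolding star_scale star_star[OF assms(1) complements_sub]
    by (simp add: mult.assoc[symmetric] minus_one_mult_self)
  ultimately show ?thesis by blast
qed

text \<open>
  The source of the sign character: a permutation of the ground set scales the volume form by its sign.
\<close>

lemma star_chain_map:
  assumes "alternating z" "g permutes V"
  shows "star (chain_map g z) = (\<lambda>m. of_int (sign g) * chain_map g (star z) m)"
proof
  fix m
  let ?h = "inv_into UNIV g"
  have h: "?h permutes V" by (rule permutes_inv[OF assms(2)])
  have gh: "map g (map ?h m) = m" using permutes_inverses[OF assms(2)] by (simp add: o_def)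
  show "star (chain_map g z) m = of_int (sign g) * chain_map g (star z) m"
  proof (cases "set m \<subseteq> V")
    case True
    let ?l = "enum (V - set (map ?h m))"
    have l: "distinct ?l" "set ?l = V - ?h ` set m" by (simp_all add: enum finite_V)
    have "set (map g ?l) = g ` V - g ` ?h ` set m"
      using l(2) image_set_diff[OF permutes_inj[OF assms(2)]] by simp
    also have "\<dots> = V - set m"
      using permutes_image[OF assms(2)] gh by (metis list.set_map)
    finally have gl: "set (map g ?l) = V - set m" .
    have dgl: "distinct (map g ?l)"
      using l(1) inj_on_subset[OF permutes_inj[OF assms(2)] subset_UNIV] by (simp add: distinct_map)
    have alt: "alternating (chain_map g z)"
      unfolding chain_map_def alternating_def
    proof (intro conjI allI impI)
      fix l' assume "z (map ?h l') \<noteq> 0"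
      then show "distinct l'" using alternating_nondistinct[OF assms(1)] distinct_map by metis
    next
      fix l' and \<pi> :: "'v \<Rightarrow> 'v" assume "\<pi> permutes set l'"
      then show "z (map ?h (map \<pi> l')) = of_int (sign \<pi>) * z (map ?h l')"
        by (rule alternating_map[OF assms(1) inj_on_subset[OF permutes_inj[OF h] subset_UNIV]])
    qed
    have "star (chain_map g z) m = chain_map g z (map g ?l) * volume (map g ?l @ m)"
      by (rule star_apply[OF alt dgl gl])
    also have "chain_map g z (map g ?l) = z ?l"
      using permutes_inverses[OF assms(2)] by (simp add: chain_map_def o_def)
    also have "volume (map g ?l @ m) = volume (map g (?l @ map ?h m))" using gh by simp
    also have "\<dots> = of_int (sign g) * volume (?l @ map ?h m)"
    proof (rule alternating_perm[OF alternating_volume])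
      have "?h ` set m \<subseteq> V" using True permutes_image[OF h] by blast
      then have "set (?l @ map ?h m) = V" using l(2) by auto
      then show "g permutes set (?l @ map ?h m)" using assms(2) by simp
    qed
    finally show ?thesis by (simp add: chain_map_def star_def)
  next
    case False
    then have "\<not> set (map ?h m) \<subseteq> V"
      using permutes_in_image[OF h] by auto
    then have "volume (enum (V - set (map ?h m)) @ map ?h m) = 0"
      using volume_nonzero[of "enum (V - set (map ?h m)) @ map ?h m"] by fastforce
    moreover have "volume (enum (V - set m) @ m) = 0"
      using volume_nonzero[of "enum (V - set m) @ m"] False by fastforce
    ultimately show ?thesis by (simp add: chain_map_def star_def)
  qed
qed

lemma wedge_lin: "wedge v (\<lambda>l. c l + a * d l) = (\<lambda>l. wedge v c l + a * wedge v d l)"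
  by (auto simp: wedge_def algebra_simps)

lemma coboundary_lin: "coboundary (\<lambda>l. c l + a * d l) = (\<lambda>l. coboundary c l + a * coboundary d l)"
  by (rule ext) (simp add: coboundary_def wedge_lin sum.distrib sum_distrib_left)

lemma alternating_coboundary: "alternating (coboundary c)"
  unfolding coboundary_def[abs_def] by (rule alternating_sum) (rule alternating_wedge)

lemma coboundary_in_chains:
  assumes "c \<in> chains \<Delta> k" "\<Delta>' \<subseteq> Pow V" "\<And>\<sigma> v. \<sigma> \<in> \<Delta> \<Longrightarrow> v \<in> V \<Longrightarrow> insert v \<sigma> \<in> \<Delta>'"
  shows "coboundary c \<in> chains \<Delta>' (k + 1)"
proof (rule chainsI[OF alternating_coboundary assms(2)])
  fix l assume "coboundary c l \<noteq> 0"
  then obtain v where v: "v \<in> V" "wedge v c l \<noteq> 0"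
    unfolding coboundary_def by (meson sum.neutral)
  show "set l \<in> \<Delta>' \<and> int (length l) = k + 1 + 1"
    by (rule chainsD[OF wedge_in_chains[OF assms(1) v(1) assms(2)] v(2)]) (use assms(3) v in auto)
qed

text \<open>
  For \<open>v\<close> in \<open>m\<close>, removing \<open>v\<close> from \<open>m\<close> means adding it to the complement; the sign is that of
  moving \<open>v\<close> across the \<open>k\<close> vertices of the complement of \<open>m\<close>. For \<open>v\<close> outside \<open>m\<close> both contributions vanish.
\<close>

lemma coboundary_star:
  assumes z: "z \<in> chains \<Delta> k" "\<Delta> \<subseteq> Pow V"
  shows "coboundary (star z) = (\<lambda>m. (- 1) ^ nat k * star (boundary z) m)"
proof
  fix m
  note alt = chains_alternating[OF z(1)]
  let ?l = "enum (V - set m)"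
  show "coboundary (star z) m = (- 1) ^ nat k * star (boundary z) m"
  proof (cases "distinct m \<and> set m \<subseteq> V")
    case True
    have l: "distinct ?l" "set ?l = V - set m" by (simp_all add: enum finite_V)
    have "wedge v (star z) m = (- 1) ^ nat k * (z (v # ?l) * volume (?l @ m))" if "v \<in> V" for v
    proof (cases "v \<in> set m")
      case True': True
      let ?m = "enum (set m - {v})"
      have m: "distinct (v # ?m)" "set (v # ?m) = set m" using True' by (auto simp: enum)
      obtain \<pi> where p: "\<pi> permutes set (v # ?m)" "m = map \<pi> (v # ?m)"
        using oriented_simplex_permutation[OF m(1)] True m(2) by metis
      have "set (v # ?m) \<inter> set ?l = {}" using m(2) l(2) by auto
      from alternating_append(2)[OF alternating_volume p(1) this]
      have v1: "volume (?l @ m) = of_int (sign \<pi>) * volume (?l @ v # ?m)"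
        using p(2) by simp
      have v2: "oriented_simplex (v # ?m) m = of_int (sign \<pi>)"
        using oriented_simplex_map[OF m(1) p(1)] p(2) by simp
      have "star z ?m = z (v # ?l) * volume ((v # ?l) @ ?m)"
        by (rule star_apply[OF alt]) (use l True' that True in \<open>auto simp: enum\<close>)
      also have "volume ((v # ?l) @ ?m) = (- 1) ^ length ?l * volume (?l @ v # ?m)"
        using volume_move[of v ?l ?m] by simp
      finally have "wedge v (star z) m = (- 1) ^ length ?l * (z (v # ?l) * volume (?l @ m))"
        using True' by (simp add: wedge_def v1 v2)
      moreover have "length ?l = nat k" if "z (v # ?l) \<noteq> 0"
        using conjunct2[OF chainsD[OF z(1) that]] by simp
      ultimately show ?thesis by (cases "z (v # ?l) = 0") simp_all
    next
      case False
      then have "v \<in> set ?l" using that l(2) by simp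
      then have "z (v # ?l) = 0" using alternating_nondistinct[OF alt, of "v # ?l"] by simp
      then show ?thesis using False by (simp add: wedge_def)
    qed
    then have "coboundary (star z) m = (\<Sum>v\<in>V. (- 1) ^ nat k * (z (v # ?l) * volume (?l @ m)))"
      unfolding coboundary_def by (rule sum.cong[OF refl])
    also have "\<dots> = (- 1) ^ nat k * star (boundary z) m"
      unfolding star_def boundary_eq[OF z] by (simp add: sum_distrib_left sum_distrib_right)
    finally show ?thesis .
  next
    case False
    have "coboundary (star z) \<in> chains (Pow V) (int (card V) - 2 - k + 1)"
      by (rule coboundary_in_chains[OF star_in_chains[OF z(1)]]) (auto simp: complements_def)
    then have "coboundary (star z) m = 0"
      using False chainsD[of "coboundary (star z)" "Pow V" _ m]
        alternating_nondistinct[OF alternating_coboundary] by blast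
    moreover have "volume (?l @ m) = 0" using volume_nonzero[of "?l @ m"] False by fastforce
    ultimately show ?thesis by (simp add: star_def)
  qed
qed

section \<open>The inner product on chains\<close>

lemma inner_diff_right: "inner_chain d (\<lambda>l. c l - c' l) = inner_chain d c - inner_chain d c'"
  by (simp add: inner_chain_def sum_subtractf algebra_simps)

lemma inner_commute: "inner_chain c d = cnj (inner_chain d c)"
  by (simp add: inner_chain_def mult.commute)

lemma inner_scale_left: "inner_chain (\<lambda>l. a * c l) d = a * inner_chain c d"
  by (simp add: inner_chain_def sum_distrib_left mult.assoc)

lemma inner_zero_left [simp]: "inner_chain (\<lambda>_. 0) d = 0"
  by (simp add: inner_chain_def)

lemma inner_disjoint:
  assumes "c \<in> chains \<Delta> k" "d \<in> chains \<Delta>' k'" "\<Delta> \<inter> \<Delta>' = {}"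
  shows "inner_chain c d = 0"
  unfolding inner_chain_def
proof (rule sum.neutral, rule ballI)
  fix A
  show "c (enum A) * cnj (d (enum A)) = 0"
    using chainsD[OF assms(1), of "enum A"] chainsD[OF assms(2), of "enum A"] assms(3) by auto
qed

lemma inner_restrict: "inner_chain c (restrict_chain S c) = inner_chain (restrict_chain S c) (restrict_chain S c)"
  unfolding inner_chain_def by (rule sum.cong) (auto simp: restrict_chain_def)

lemma inner_restrict_right:
  assumes "c \<in> chains S k"
  shows "inner_chain c (restrict_chain S d) = inner_chain c d"
  unfolding inner_chain_def
proof (rule sum.cong[OF refl])
  fix A
  show "c (enum A) * cnj (restrict_chain S d (enum A)) = c (enum A) * cnj (d (enum A))"
    using chainsD[OF assms, of "enum A"] by (cases "c (enum A) = 0") (auto simp: restrict_chain_def)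
qed

lemma inner_self_zero:
  assumes "c \<in> chains (Pow V) k" "inner_chain c c = 0"
  shows "c = (\<lambda>_. 0)"
proof
  fix l
  have "inner_chain c c = of_real (\<Sum>A\<in>Pow V. (norm (c (enum A)))\<^sup>2)"
    by (simp add: inner_chain_def complex_norm_square[symmetric])
  then have "(\<Sum>A\<in>Pow V. (norm (c (enum A)))\<^sup>2) = 0"
    using assms(2) by (metis of_real_eq_0_iff)
  then have z: "\<forall>A\<in>Pow V. (norm (c (enum A)))\<^sup>2 = 0"
    by (subst (asm) sum_nonneg_eq_0_iff) (use finite_V in auto)
  show "c l = 0"
  proof (rule ccontr)
    assume nz: "c l \<noteq> 0"
    then have "set l \<in> Pow V" using chainsD[OF assms(1)] by blast
    then have "c (enum (set l)) = 0" using z by simp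
    then show False using alternating_zero_enum[OF chains_alternating[OF assms(1)]] nz by blast
  qed
qed

text \<open>
  Both sides are sums over pairs of a face \<open>A\<close> and a vertex \<open>v\<close> outside it, the left indexed by \<open>A\<close> and
  the right by \<open>insert v A\<close>. Summing over faces instead of lists avoids combinatorial factors.
\<close>

lemma inner_boundary:
  assumes c: "c \<in> chains (Pow V) k" and d: "d \<in> chains (Pow V) k'"
  shows "inner_chain (boundary c) d = inner_chain c (coboundary d)"
proof -
  note altc = chains_alternating[OF c] and altd = chains_alternating[OF d]
  let ?f = "\<lambda>A v. c (v # enum A) * cnj (d (enum A))"
  let ?g = "\<lambda>B v. c (enum B) * cnj (wedge v d (enum B))"
  have fin: "finite A" if "A \<in> Pow V" for A using that finite_V finite_subset by blast
  have "inner_chain (boundary c) d = (\<Sum>A\<in>Pow V. \<Sum>v\<in>V. ?f A v)"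
    by (simp add: inner_chain_def boundary_eq[OF c] sum_distrib_right)
  also have "\<dots> = (\<Sum>A\<in>Pow V. \<Sum>v\<in>V - A. ?f A v)"
  proof (rule sum.cong[OF refl], rule sum.mono_neutral_right)
    fix A assume A: "A \<in> Pow V"
    show "\<forall>v\<in>V - (V - A). ?f A v = 0"
    proof
      fix v assume "v \<in> V - (V - A)"
      then have "\<not> distinct (v # enum A)" using enum(2)[OF fin[OF A]] by simp
      then show "?f A v = 0" using alternating_nondistinct[OF altc] by simp
    qed
  qed (use finite_V in auto)
  also have "\<dots> = (\<Sum>(A, v)\<in>Sigma (Pow V) (\<lambda>A. V - A). ?f A v)"
    by (rule sum.Sigma) (use finite_V in auto)
  also have "\<dots> = (\<Sum>(B, v)\<in>Sigma (Pow V) (\<lambda>B. B). ?g B v)"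
  proof (rule sum.reindex_bij_witness[of _ "\<lambda>(B, v). (B - {v}, v)" "\<lambda>(A, v). (insert v A, v)"])
    fix p assume p: "p \<in> Sigma (Pow V) (\<lambda>A. V - A)"
    obtain A v where p_eq: "p = (A, v)" by (cases p)
    have A: "A \<subseteq> V" "v \<in> V" "v \<notin> A" using p p_eq by auto
    have e: "distinct (v # enum A)" "set (v # enum A) = insert v A"
      using A enum[OF fin, of A] by auto
    have e2: "distinct (enum (insert v A))" "set (enum (insert v A)) = insert v A"
      using enum[OF fin, of "insert v A"] A by auto
    have "?g (insert v A) v = c (v # enum A) * cnj (wedge v d (v # enum A))"
      by (rule alternating_mult_cnj[OF altc alternating_wedge e(1) e2(1)]) (simp only: e(2) e2(2))
    also have "wedge v d (v # enum A) = d (enum A)"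
      by (rule wedge_Cons[OF altd]) (use e(1) in simp)
    finally show "(case (case p of (A, v) \<Rightarrow> (insert v A, v)) of (B, v) \<Rightarrow> ?g B v) = (case p of (A, v) \<Rightarrow> ?f A v)"
      by (simp add: p_eq)
  qed auto
  also have "\<dots> = (\<Sum>B\<in>Pow V. \<Sum>v\<in>B. ?g B v)"
    by (rule sum.Sigma[symmetric]) (use finite_V fin in auto)
  also have "\<dots> = (\<Sum>B\<in>Pow V. \<Sum>v\<in>V. ?g B v)"
  proof (rule sum.cong[OF refl], rule sum.mono_neutral_left)
    fix B assume B: "B \<in> Pow V"
    then show "\<forall>v\<in>V - B. ?g B v = 0" using enum(2)[OF fin[OF B]] by (simp add: wedge_def)
  qed (use finite_V in auto)
  also have "\<dots> = inner_chain c (coboundary d)"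
    by (simp add: inner_chain_def coboundary_def sum_distrib_left)
  finally show ?thesis .
qed

lemma chain_projection:
  assumes "(\<lambda>_. 0) \<in> W" "\<And>a w w'. w \<in> W \<Longrightarrow> w' \<in> W \<Longrightarrow> (\<lambda>x. w x + a * w' x) \<in> W"
  shows "\<exists>w\<in>W. \<forall>w'\<in>W. inner_chain (\<lambda>l. c l - w l) w' = 0"
  unfolding inner_chain_def
  by (rule orthogonal_projection[of "Pow V" W c enum]) (use assms finite_V in auto)

end


section \<open>Alexander duality\<close>

lemma chain_decompose: "c = (\<lambda>l. restrict_chain S c l + restrict_chain (- S) c l)"
  by (auto simp: restrict_chain_def)

lemma permutes_image_complement: "g permutes V \<Longrightarrow> g ` (V - A) = V - g ` A"
  by (metis image_set_diff permutes_image permutes_inj)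

context vertex_set
begin

lemma coboundary_zero [simp]: "coboundary (\<lambda>_. 0) = (\<lambda>_. 0)"
  by (auto simp: coboundary_def wedge_def fun_eq_iff intro!: sum.neutral)

text \<open>
  With \<open>D\<close> the Alexander dual and \<open>S\<close> the set of non-faces of \<open>N\<close>, the map \<open>star\<close> identifies chains of \<open>D\<close>
  with chains on \<open>S\<close>. The correspondence \<open>T\<close> consists of the pairs \<open>(z, boundary (star z))\<close> with \<open>z\<close> a cycle of \<open>D\<close>
  and the second entry a chain of \<open>N\<close>; the latter is the harmonicity condition on \<open>z\<close>. Two
  orthogonal projections show that \<open>T\<close> meets all classes on both sides, and \<open>T\<close> matches boundaries with boundaries
  because in either case \<open>star z\<close> turns out to be orthogonal to itself.
\<close>

theorem alexander_duality:
  assumes N: "N \<subseteq> Pow V" "down_closed N" and ne: "V \<noteq> {}"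
    and G: "\<And>g. g \<in> G \<Longrightarrow> g permutes V \<and> (\<forall>A\<subseteq>V. g ` A \<in> N \<longleftrightarrow> A \<in> N)"
  shows "rep_iso G
    (tensor_character (homology_rep (\<lambda>g. g) (complements (Pow V - N)) (int (card V) - 3 - i)) sgn_character)
    (homology_rep (\<lambda>g. g) N i)"
proof -
  define S where "S = Pow V - N"
  define D where "D = complements S"
  define j where "j = int (card V) - 3 - i"
  have S: "S \<subseteq> Pow V" "complements D = S" and D: "D \<subseteq> Pow V"
    using complements_complements[of S] complements_sub by (auto simp: S_def D_def)
  have SN: "S \<inter> N = {}" "Pow V \<inter> - S \<subseteq> N" by (auto simp: S_def)
  have upS: "insert v \<sigma> \<in> S" if "\<sigma> \<in> S" "v \<in> V" for \<sigma> v
    using that down_closedD[OF N(2), of "insert v \<sigma>" \<sigma>] by (auto simp: S_def)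
  have dcPow: "down_closed (Pow V)" by (auto simp: down_closed_def)
  have chS: "c \<in> chains (Pow V) k" if "c \<in> chains S k" for c k by (rule chains_mono[OF that S(1)])
  have chN: "c \<in> chains (Pow V) k" if "c \<in> chains N k" for c k by (rule chains_mono[OF that N(1)])
  have resS: "restrict_chain S c \<in> chains S k" if "c \<in> chains (Pow V) k" for c k
    using chains_mono[OF restrict_chain_in[OF that, of S]] by blast
  have resN: "restrict_chain (- S) c \<in> chains N k" if "c \<in> chains (Pow V) k" for c k
    using chains_mono[OF restrict_chain_in[OF that, of "- S"] SN(2)] .
  have bd: "boundary c \<in> chains (Pow V) k" if "c \<in> chains (Pow V) (k + 1)" for c k
    using boundary_chains[OF that _ dcPow] by simp
  have starS: "star z \<in> chains S (i + 1)" if "z \<in> chains D j" for z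
  proof -
    have "int (card V) - 2 - j = i + 1" by (simp add: j_def)
    then show ?thesis using star_in_chains[OF that] S(2) by (simp only:)
  qed
  have starSurj: "\<exists>z \<in> chains D (j + k). star z = u" if "u \<in> chains S (i + 1 - k)" for u k
  proof -
    have "int (card V) - 2 - (i + 1 - k) = j + k" by (simp add: j_def)
    then show ?thesis using star_surj[of u D "i + 1 - k"] that S(2) D by (simp only:)
  qed
  have star_cob: "coboundary (star z) = (\<lambda>m. (- 1) ^ nat k * star (boundary z) m)" if "z \<in> chains D k" for z k
    by (rule coboundary_star[OF that D])
  have GD: "g ` A \<in> D" if g: "g \<in> G" and "A \<in> D" for g A
  proof -
    have p: "g permutes V" using G[OF g] by blast
    have A: "A \<subseteq> V" "V - A \<notin> N" using that by (auto simp: D_def S_def complements_def)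
    have "g ` (V - A) \<notin> N" using G[OF g] A by blast
    then have "V - g ` A \<notin> N" using permutes_image_complement[OF p, of A] by simp
    moreover have "g ` A \<subseteq> V" using image_mono[OF A(1), of g] permutes_image[OF p] by simp
    ultimately show ?thesis by (auto simp: D_def S_def complements_def)
  qed
  let ?T = "{(z, boundary (star z)) | z. z \<in> cycles D j \<and> boundary (star z) \<in> chains N i}"
  have b_star: "boundary (star z) \<in> cycles N i"
    if "z \<in> cycles D j" "boundary (star z) \<in> chains N i" for z
    using that boundary_boundary[OF starS[OF cyclesD(1)[OF that(1)]] S(1)] by (simp add: cycles_def)
  have inN: "boundary u \<in> chains N i" if "u \<in> chains (Pow V) (i + 1)" "restrict_chain S (boundary u) = (\<lambda>_. 0)" for u
  proof -
    have "boundary u = restrict_chain (- S) (boundary u)"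
      using chain_decompose[of "boundary u" S] unfolding that(2) by simp
    then show ?thesis using resN[OF bd[OF that(1)]] by simp
  qed
  have "rep_iso G (tensor_character (homology_rep (\<lambda>g. g) D j) sgn_character) (homology_rep (\<lambda>g. g) N i)"
  proof (rule rep_iso_of_correspondence[OF finite_V finite_V D N(1), where T = ?T])
    fix g assume g: "g \<in> G"
    have p: "g permutes V" "bij g" using G[OF g] permutes_bij by auto
    show "bij g \<and> (\<forall>A\<in>N. g ` A \<in> N)" using p G[OF g] N(1) by blast
    show "bij g \<and> (\<forall>A\<in>D. g ` A \<in> D)" using p GD[OF g] by blast
  next
    show "?T \<subseteq> cycles D j \<times> cycles N i" using b_star by auto
  next
    fix z y z' y' assume "(z, y) \<in> ?T" "(z', y') \<in> ?T"
    then have z: "z \<in> cycles D j" "y = boundary (star z)" "y \<in> chains N i"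
      and z': "z' \<in> cycles D j" "y' = boundary (star z')" "y' \<in> chains N i" by auto
    have "boundary (star (\<lambda>l. z l + z' l)) = (\<lambda>l. y l + y' l)"
      unfolding star_add z z'
      by (rule boundary_add[OF starS starS S(1)]) (use cyclesD z(1) z'(1) in auto)
    then show "(\<lambda>l. z l + z' l, \<lambda>l. y l + y' l) \<in> ?T"
      using cycles_add[OF D z(1) z'(1)] chains_add[OF z(3) z'(3)]
      by (intro CollectI exI[of _ "\<lambda>l. z l + z' l"]) simp
  next
    fix a z y assume "(z, y) \<in> ?T"
    then have z: "z \<in> cycles D j" "y = boundary (star z)" "y \<in> chains N i" by auto
    have "boundary (star (\<lambda>l. a * z l)) = (\<lambda>l. a * y l)"
      unfolding star_scale z(2) by (rule boundary_scale[OF starS[OF cyclesD(1)[OF z(1)]] S(1)])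
    then show "(\<lambda>l. a * z l, \<lambda>l. a * y l) \<in> ?T"
      using cycles_scale[OF D z(1)] chains_scale[OF z(3)]
      by (intro CollectI exI[of _ "\<lambda>l. a * z l"]) simp
  next
    fix g z y assume g: "g \<in> G" and "(z, y) \<in> ?T"
    then have z: "z \<in> cycles D j" "y = boundary (star z)" "y \<in> chains N i" by auto
    have p: "g permutes V" "bij g" using G[OF g] permutes_bij by auto
    have gN: "\<forall>A\<in>N. g ` A \<in> N" using G[OF g] N(1) by blast
    have gD: "\<forall>A\<in>D. g ` A \<in> D" using GD[OF g] by blast
    let ?z = "\<lambda>l. sgn_character g * chain_map g z l"
    have "star ?z = (\<lambda>m. (of_int (sign g) * of_int (sign g)) * chain_map g (star z) m)"
      unfolding star_scale star_chain_map[OF chains_alternating[OF cyclesD(1)[OF z(1)]] p(1)]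
      by (simp add: sgn_character_def mult.assoc)
    then have "star ?z = chain_map g (star z)" by (simp only: sign_square mult_1)
    then have "boundary (star ?z) = chain_map g y" by (simp add: boundary_chain_map[OF p(2)] z(2))
    moreover have "?z \<in> cycles D j" by (rule cycles_scale[OF D chain_map_cycles[OF p(2) gD z(1)]])
    ultimately show "(?z, chain_map g y) \<in> ?T"
      using chain_map_in_chains[OF p(2) gN z(3)] by (intro CollectI exI[of _ ?z]) simp
  next
    fix z0 assume z0: "z0 \<in> cycles D j"
    \<comment> \<open>Every class of \<open>D\<close> has a harmonic representative: make \<open>star z0\<close> orthogonal to the
      coboundaries of chains on \<open>S\<close>, which are the images under \<open>star\<close> of the boundaries in \<open>D\<close>.\<close>
    let ?W = "coboundary ` chains S i"
    have "(\<lambda>_. 0) \<in> ?W"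
      by (rule image_eqI[of _ _ "\<lambda>_. 0"]) simp_all
    moreover have "(\<lambda>x. w x + a * w' x) \<in> ?W" if ww: "w \<in> ?W" "w' \<in> ?W" for a w w'
    proof -
      obtain d d' where "d \<in> chains S i" "w = coboundary d" "d' \<in> chains S i" "w' = coboundary d'"
        using ww by blast
      then show ?thesis
        using chains_add[OF _ chains_scale[of d' S i a], of d]
        by (intro image_eqI[of _ _ "\<lambda>l. d l + a * d' l"]) (simp_all add: coboundary_lin)
    qed
    ultimately obtain d where d: "d \<in> chains S i"
      and perp: "\<And>d'. d' \<in> chains S i \<Longrightarrow> inner_chain (\<lambda>l. star z0 l - coboundary d l) (coboundary d') = 0"
      using chain_projection[of ?W "star z0"] by blast
    define u where "u = (\<lambda>l. star z0 l - coboundary d l)"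
    have cd: "coboundary d \<in> chains S (i + 1)" by (rule coboundary_in_chains[OF d S(1) upS])
    have u: "u \<in> chains S (i + 1)" unfolding u_def by (rule chains_diff[OF starS[OF cyclesD(1)[OF z0]] cd])
    define t where "t = restrict_chain S (boundary u)"
    have t: "t \<in> chains S i" unfolding t_def by (rule resS[OF bd[OF chS[OF u]]])
    have "inner_chain t t = inner_chain (boundary u) t"
      unfolding t_def by (rule inner_restrict[symmetric])
    also have "\<dots> = inner_chain u (coboundary t)" by (rule inner_boundary[OF chS[OF u] chS[OF t]])
    also have "\<dots> = 0" using perp[OF t] by (simp add: u_def)
    finally have "t = (\<lambda>_. 0)" by (rule inner_self_zero[OF chS[OF t]])
    then have bu: "boundary u \<in> chains N i" unfolding t_def by (rule inN[OF chS[OF u]])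
    obtain b where b: "b \<in> chains D (j + 1)" "star b = d"
      using starSurj[of d 1] d by auto
    define \<epsilon> :: complex where "\<epsilon> = (- 1) ^ nat (j + 1)"
    define b' where "b' = (\<lambda>l. \<epsilon> * b l)"
    have b': "b' \<in> chains D (j + 1)" unfolding b'_def by (rule chains_scale[OF b(1)])
    have cob: "coboundary d = star (boundary b')"
      unfolding b(2)[symmetric] star_cob[OF b(1)] b'_def boundary_scale[OF b(1) D] star_scale \<epsilon>_def by simp
    define z where "z = (\<lambda>l. z0 l - boundary b' l)"
    have dcD: "down_closed D"
      unfolding down_closed_def D_def S_def complements_def using down_closedD[OF N(2)] by blast
    have bb: "boundary b' \<in> chains D j" using boundary_chains[OF b' D dcD] by simp
    have "boundary z = (\<lambda>_. 0)"
      unfolding z_def boundary_diff[OF cyclesD(1)[OF z0] bb D] boundary_boundary[OF b' D] cyclesD(2)[OF z0]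
      by simp
    then have z: "z \<in> cycles D j"
      using chains_diff[OF cyclesD(1)[OF z0] bb] by (simp add: cycles_def z_def)
    have sz: "star z = u" unfolding z_def star_diff u_def cob ..
    have "(z, boundary (star z)) \<in> ?T" using z bu sz by auto
    moreover have "(\<lambda>l. z0 l - z l) \<in> boundaries D j"
      using b' by (auto simp: z_def boundaries_def)
    ultimately show "\<exists>(x', y)\<in>?T. (\<lambda>l. z0 l - x' l) \<in> boundaries D j" by blast
  next
    fix x assume x: "x \<in> cycles N i"
    obtain c where c: "c \<in> chains (Pow V) (i + 1)" "boundary c = x"
      using Pow_acyclic[OF ne chN[OF cyclesD(1)[OF x]] cyclesD(2)[OF x]] by blast
    \<comment> \<open>Every class of \<open>N\<close> is reached: fill \<open>x\<close> by a chain \<open>c\<close> of the full simplex and adjust the part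
      of \<open>c\<close> on \<open>S\<close> by boundaries until its coboundary vanishes, so that it is the image of a cycle of \<open>D\<close>.\<close>
    let ?W = "(\<lambda>y. restrict_chain S (boundary y)) ` chains (Pow V) (i + 1 + 1)"
    have "(\<lambda>_. 0) \<in> ?W"
      by (rule image_eqI[of _ _ "\<lambda>_. 0"]) (simp_all add: restrict_chain_def fun_eq_iff)
    moreover have "(\<lambda>x. w x + a * w' x) \<in> ?W" if ww: "w \<in> ?W" "w' \<in> ?W" for a w w'
    proof -
      obtain d d' where d: "d \<in> chains (Pow V) (i + 1 + 1)" "w = restrict_chain S (boundary d)"
        "d' \<in> chains (Pow V) (i + 1 + 1)" "w' = restrict_chain S (boundary d')"
        using ww by blast
      have "boundary (\<lambda>l. d l + a * d' l) = (\<lambda>l. boundary d l + a * boundary d' l)"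
        using boundary_add[OF d(1) chains_scale[OF d(3)] subset_refl] boundary_scale[OF d(3) subset_refl]
        by simp
      then show ?thesis
        using chains_add[OF d(1) chains_scale[OF d(3), of a]] d
        by (intro image_eqI[of _ _ "\<lambda>l. d l + a * d' l"]) (auto simp: restrict_chain_def)
    qed
    ultimately obtain y where y: "y \<in> chains (Pow V) (i + 1 + 1)"
      and perp: "\<And>y'. y' \<in> chains (Pow V) (i + 1 + 1) \<Longrightarrow>
        inner_chain (\<lambda>l. restrict_chain S c l - restrict_chain S (boundary y) l) (restrict_chain S (boundary y')) = 0"
      using chain_projection[of ?W "restrict_chain S c"] by blast
    define u where "u = (\<lambda>l. restrict_chain S c l - restrict_chain S (boundary y) l)"
    have by': "boundary y \<in> chains (Pow V) (i + 1)" by (rule bd[OF y])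
    have u: "u \<in> chains S (i + 1)"
      unfolding u_def by (rule chains_diff[OF resS[OF c(1)] resS[OF by']])
    define t where "t = coboundary u"
    have t: "t \<in> chains (Pow V) (i + 1 + 1)"
      unfolding t_def by (rule coboundary_in_chains[OF u]) (use S(1) in auto)
    have "cnj (inner_chain t t) = inner_chain u (boundary t)"
      using inner_boundary[OF t chS[OF u]] inner_commute[of u "boundary t"] inner_commute[of t t]
      by (simp add: t_def)
    also have "\<dots> = 0"
      using perp[OF t] inner_restrict_right[OF u, of "boundary t"] by (simp add: u_def)
    finally have "inner_chain t t = 0" by simp
    then have t0: "coboundary u = (\<lambda>_. 0)" using inner_self_zero[OF t] by (simp add: t_def)
    obtain z where z: "z \<in> chains D j" "star z = u"
      using starSurj[of u 0] u by auto
    have "star (boundary z) = (\<lambda>_. 0)"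
      using star_cob[OF z(1)] unfolding z(2) t0 by (auto simp: fun_eq_iff)
    moreover have "boundary z \<in> chains (Pow V) (j - 1)"
      by (rule bd) (use chains_mono[OF z(1) D] in simp)
    ultimately have "boundary z = (\<lambda>_. 0)" using star_inject[OF _ subset_refl] by blast
    then have zc: "z \<in> cycles D j" using z(1) by (simp add: cycles_def)
    define a where "a = (\<lambda>l. restrict_chain (- S) c l - restrict_chain (- S) (boundary y) l)"
    have a: "a \<in> chains N (i + 1)"
      unfolding a_def by (rule chains_diff[OF resN[OF c(1)] resN[OF by']])
    have u_eq: "u = (\<lambda>l. (c l - boundary y l) - a l)"
      unfolding u_def a_def restrict_chain_def by auto
    have bu: "boundary u = (\<lambda>l. x l - boundary a l)"
      unfolding u_eq boundary_diff[OF chains_diff[OF c(1) by'] chN[OF a] subset_refl]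
        boundary_diff[OF c(1) by' subset_refl] boundary_boundary[OF y subset_refl] c(2) by simp
    have "boundary a \<in> chains N i" using boundary_chains[OF a N] by simp
    then have "boundary u \<in> chains N i"
      unfolding bu by (rule chains_diff[OF cyclesD(1)[OF x]])
    then have "(z, boundary (star z)) \<in> ?T" using zc z(2) by auto
    moreover have "(\<lambda>l. x l - boundary (star z) l) \<in> boundaries N i"
      unfolding z(2) bu using a by (auto simp: boundaries_def)
    ultimately show "\<exists>(z, y)\<in>?T. (\<lambda>l. x l - y l) \<in> boundaries N i" by blast
  next
    fix z y assume "(z, y) \<in> ?T"
    then have z: "z \<in> cycles D j" "y = boundary (star z)" "y \<in> chains N i" by auto
    note sz = starS[OF cyclesD(1)[OF z(1)]]
    show "z \<in> boundaries D j \<longleftrightarrow> y \<in> boundaries N i"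
    proof
      \<comment> \<open>Here \<open>star z\<close> is, up to sign, the coboundary of a chain on \<open>S\<close>, while the boundary of \<open>star z\<close>
        is a chain of \<open>N\<close>.\<close>
      assume "z \<in> boundaries D j"
      then obtain b where b: "b \<in> chains D (j + 1)" "z = boundary b" by (auto simp: boundaries_def)
      have sb: "star b \<in> chains S i" using star_in_chains[OF b(1)] S(2) by (simp add: j_def)
      have "inner_chain y (star b) = inner_chain (star z) (coboundary (star b))"
        unfolding z(2) by (rule inner_boundary[OF chS[OF sz] chS[OF sb]])
      moreover have "inner_chain y (star b) = 0"
        by (rule inner_disjoint[OF z(3) sb]) (use SN in blast)
      ultimately have "inner_chain (coboundary (star b)) (star z) = 0"
        using inner_commute[of "coboundary (star b)" "star z"] by simp
      then have "inner_chain (star z) (star z) = 0"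
        unfolding star_cob[OF b(1)] inner_scale_left b(2) by simp
      then have "star z = (\<lambda>_. 0)" by (rule inner_self_zero[OF chS[OF sz]])
      then show "y \<in> boundaries N i" unfolding z(2) by simp
    next
      \<comment> \<open>Here \<open>star z\<close> has coboundary zero and differs by a chain of \<open>N\<close> from a boundary in the full simplex.\<close>
      assume "y \<in> boundaries N i"
      then obtain b where b: "b \<in> chains N (i + 1)" "y = boundary b" by (auto simp: boundaries_def)
      define w where "w = (\<lambda>l. star z l - b l)"
      have w: "w \<in> chains (Pow V) (i + 1)" unfolding w_def by (rule chains_diff[OF chS[OF sz] chN[OF b(1)]])
      have "boundary w = (\<lambda>_. 0)"
        unfolding w_def boundary_diff[OF chS[OF sz] chN[OF b(1)] subset_refl] z(2)[symmetric] b(2)[symmetric]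
        by simp
      then obtain v where v: "v \<in> chains (Pow V) (i + 1 + 1)" "boundary v = w"
        using Pow_acyclic[OF ne w] by blast
      have "coboundary (star z) = (\<lambda>_. 0)"
        unfolding star_cob[OF cyclesD(1)[OF z(1)]] cyclesD(2)[OF z(1)] by simp
      then have "inner_chain w (star z) = 0"
        using inner_boundary[OF v(1) chS[OF sz]] inner_commute[of v "coboundary (star z)"] v(2) by simp
      moreover have "inner_chain (star z) b = 0" by (rule inner_disjoint[OF sz b(1) SN(1)])
      ultimately have "inner_chain (star z) (star z) = 0"
        using inner_diff_right[of "star z" "star z" b] inner_commute[of "star z" w] by (simp add: w_def)
      then have "star z = (\<lambda>_. 0)" by (rule inner_self_zero[OF chS[OF sz]])
      then have "z = (\<lambda>_. 0)" by (rule star_inject[OF cyclesD(1)[OF z(1)] D])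
      then show "z \<in> boundaries D j" by simp
    qed
  qed
  then show ?thesis by (simp add: D_def S_def j_def)
qed

end


section \<open>Rank and closure in a matroid\<close>

context matroid
begin

lemma finite_indep: "finite \<I>"
  by (rule finite_subset[of _ "Pow E"]) (use indep_subset finite_ground in auto)

lemma finite_indep_set: "X \<in> \<I> \<Longrightarrow> finite X"
  using indep_subset finite_ground finite_subset by blast

lemma rk_attained: "\<exists>X \<in> \<I>. X \<subseteq> A \<and> card X = rk \<I> A"
proof -
  have "rk \<I> A \<in> card ` {X \<in> \<I>. X \<subseteq> A}"
    unfolding rk_def by (rule Max_in) (use finite_indep indep_empty in auto)
  then show ?thesis by auto
qed

lemma card_le_rk: "X \<in> \<I> \<Longrightarrow> X \<subseteq> A \<Longrightarrow> card X \<le> rk \<I> A"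
  unfolding rk_def by (rule Max_ge) (use finite_indep in auto)

lemma rk_mono: "A \<subseteq> B \<Longrightarrow> rk \<I> A \<le> rk \<I> B"
  by (metis rk_attained card_le_rk order_trans)

lemma rk_le_card: "finite A \<Longrightarrow> rk \<I> A \<le> card A"
  by (metis rk_attained card_mono)

lemma extend_to_rk:
  assumes "X \<in> \<I>" "X \<subseteq> A"
  shows "\<exists>Y \<in> \<I>. X \<subseteq> Y \<and> Y \<subseteq> A \<and> card Y = rk \<I> A"
proof -
  define F where "F = {Y \<in> \<I>. X \<subseteq> Y \<and> Y \<subseteq> A}"
  have "finite F" "F \<noteq> {}" using finite_indep assms by (auto simp: F_def)
  from finite_has_maximal[OF this] obtain Y where Y: "Y \<in> F" "\<forall>Y'\<in>F. Y \<subseteq> Y' \<longrightarrow> Y = Y'" by blast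
  then have YF: "Y \<in> \<I>" "X \<subseteq> Y" "Y \<subseteq> A" by (auto simp: F_def)
  have "card Y = rk \<I> A"
  proof (rule ccontr)
    assume "card Y \<noteq> rk \<I> A"
    then have "card Y < rk \<I> A" using card_le_rk[of Y A] YF by auto
    then obtain Z where Z: "Z \<in> \<I>" "Z \<subseteq> A" "card Y < card Z" using rk_attained[of A] by auto
    then obtain y where y: "y \<in> Z - Y" "insert y Y \<in> \<I>" using indep_augment[of Y Z] YF by auto
    then have "insert y Y \<in> F" using YF Z(2) by (auto simp: F_def)
    then show False using Y(2) y(1) by auto
  qed
  then show ?thesis using YF by blast
qed

definition closure :: "'a set \<Rightarrow> 'a set" where
  "closure A = {x \<in> E. rk \<I> (insert x A) = rk \<I> A}"

lemma subset_closure: "A \<subseteq> E \<Longrightarrow> A \<subseteq> closure A"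
  by (auto simp: closure_def insert_absorb)

lemma closure_subset: "closure A \<subseteq> E"
  by (auto simp: closure_def)

text \<open>
  Otherwise augmentation would extend a maximal independent subset of \<open>A\<close> by a point of the closure.
\<close>

lemma rk_closure:
  assumes "A \<subseteq> E"
  shows "rk \<I> (closure A) = rk \<I> A"
proof (rule antisym)
  obtain X where X: "X \<in> \<I>" "X \<subseteq> A" "card X = rk \<I> A" using rk_attained by blast
  show "rk \<I> (closure A) \<le> rk \<I> A"
  proof (rule ccontr)
    assume "\<not> rk \<I> (closure A) \<le> rk \<I> A"
    then obtain Y where Y: "Y \<in> \<I>" "Y \<subseteq> closure A" "card X < card Y"
      using rk_attained[of "closure A"] X(3) by auto
    then obtain y where y: "y \<in> Y - X" "insert y X \<in> \<I>" using indep_augment[OF X(1)] by blast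
    have "card (insert y X) \<le> rk \<I> (insert y A)"
      by (rule card_le_rk[OF y(2)]) (use X(2) in auto)
    moreover have "rk \<I> (insert y A) = rk \<I> A" using y(1) Y(2) by (auto simp: closure_def)
    ultimately show False using X(3) y(1) finite_indep_set[OF X(1)] by simp
  qed
qed (rule rk_mono[OF subset_closure[OF assms]])

lemma closure_flat:
  assumes "A \<subseteq> E"
  shows "closure A \<in> flats E \<I>"
proof -
  have "rk \<I> (closure A) < rk \<I> (insert x (closure A))" if x: "x \<in> E - closure A" for x
  proof -
    have "rk \<I> A \<noteq> rk \<I> (insert x A)" using x by (auto simp: closure_def)
    then have "rk \<I> A < rk \<I> (insert x A)" using rk_mono[OF subset_insertI, of A x] by simp
    also have "\<dots> \<le> rk \<I> (insert x (closure A))" by (rule rk_mono) (use subset_closure[OF assms] in auto)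
    finally show ?thesis using rk_closure[OF assms] by simp
  qed
  then show ?thesis using closure_subset by (auto simp: flats_def)
qed

lemma closure_least:
  assumes "A \<subseteq> E" "F \<in> flats E \<I>"
  shows "closure A \<subseteq> F \<longleftrightarrow> A \<subseteq> F"
proof
  assume AF: "A \<subseteq> F"
  show "closure A \<subseteq> F"
  proof
    fix x assume x: "x \<in> closure A"
    show "x \<in> F"
    proof (rule ccontr)
      assume "x \<notin> F"
      obtain X where X: "X \<in> \<I>" "X \<subseteq> A" "card X = rk \<I> A" using rk_attained by blast
      obtain Y where Y: "Y \<in> \<I>" "X \<subseteq> Y" "Y \<subseteq> F" "card Y = rk \<I> F"
        using extend_to_rk[OF X(1), of F] X(2) AF by blast
      have "rk \<I> F < rk \<I> (insert x F)"
        using assms(2) x \<open>x \<notin> F\<close> by (auto simp: flats_def closure_def)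
      then obtain Z where Z: "Z \<in> \<I>" "Z \<subseteq> insert x F" "card Y < card Z"
        using rk_attained[of "insert x F"] Y(4) by auto
      then obtain z where z: "z \<in> Z - Y" "insert z Y \<in> \<I>" using indep_augment[OF Y(1)] by blast
      have "z = x"
      proof (rule ccontr)
        assume "z \<noteq> x"
        then have "insert z Y \<subseteq> F" using z(1) Z(2) Y(3) by auto
        then show False
          using card_le_rk[OF z(2)] z(1) Y(4) finite_indep_set[OF Y(1)] by fastforce
      qed
      then have "insert x X \<in> \<I>" using indep_mono[OF z(2), of "insert x X"] Y(2) by auto
      then have "card (insert x X) \<le> rk \<I> (insert x A)" using card_le_rk X(2) by (meson insert_mono)
      moreover have "rk \<I> (insert x A) = rk \<I> A" using x by (simp add: closure_def)
      moreover have "x \<notin> X" using \<open>x \<notin> F\<close> X(2) AF by blast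
      ultimately show False using X(3) finite_indep_set[OF X(1)] by simp
    qed
  qed
qed (use subset_closure[OF assms(1)] in auto)

lemma ground_flat: "E \<in> flats E \<I>"
  by (simp add: flats_def)

lemma rk_flat_less:
  assumes "F \<in> flats E \<I>" "F \<subset> B" "B \<subseteq> E"
  shows "rk \<I> F < rk \<I> B"
proof -
  obtain x where x: "x \<in> B" "x \<notin> F" using assms(2) by blast
  then have "rk \<I> F < rk \<I> (insert x F)" using assms(1,3) by (auto simp: flats_def)
  also have "\<dots> \<le> rk \<I> B" by (rule rk_mono) (use x assms(2) in auto)
  finally show ?thesis .
qed

lemma nonspanning_sub: "nonspanning E \<I> \<subseteq> Pow E"
  by (auto simp: nonspanning_def)

lemma down_closed_nonspanning: "down_closed (nonspanning E \<I>)"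
  unfolding down_closed_def nonspanning_def using rk_mono by (auto intro: le_less_trans)

text \<open>
  The complex of independent sets of the dual is the Alexander dual of the nonspanning complex.
\<close>

lemma dual_indep_eq: "dual_indep E \<I> = {A. A \<subseteq> E \<and> E - A \<in> Pow E - nonspanning E \<I>}"
proof (rule Set.set_eqI)
  fix A
  have "(\<exists>B\<in>bases \<I>. A \<subseteq> E - B) \<longleftrightarrow> A \<subseteq> E \<and> rk \<I> E \<le> rk \<I> (E - A)"
  proof
    assume "\<exists>B\<in>bases \<I>. A \<subseteq> E - B"
    then obtain B where B: "B \<in> \<I>" "\<And>X. X \<in> \<I> \<Longrightarrow> B \<subseteq> X \<Longrightarrow> X = B" "A \<subseteq> E - B"
      by (auto simp: bases_def)
    obtain Y where "Y \<in> \<I>" "B \<subseteq> Y" "card Y = rk \<I> E"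
      using extend_to_rk[OF B(1) indep_subset[OF B(1)]] by blast
    then have "card B = rk \<I> E" using B(2) by blast
    moreover have "card B \<le> rk \<I> (E - A)"
      by (rule card_le_rk[OF B(1)]) (use B(3) indep_subset[OF B(1)] in auto)
    ultimately show "A \<subseteq> E \<and> rk \<I> E \<le> rk \<I> (E - A)" using B(3) by auto
  next
    assume A: "A \<subseteq> E \<and> rk \<I> E \<le> rk \<I> (E - A)"
    obtain X where X: "X \<in> \<I>" "X \<subseteq> E - A" "card X = rk \<I> (E - A)" using rk_attained by blast
    have "Y = X" if "Y \<in> \<I>" "X \<subseteq> Y" for Y
    proof -
      have "card Y \<le> card X"
        using card_le_rk[OF that(1) indep_subset[OF that(1)]] A X(3) by simp
      then show ?thesis using card_seteq[OF finite_indep_set[OF that(1)] that(2)] by simp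
    qed
    then have "X \<in> bases \<I>" using X(1) by (auto simp: bases_def)
    then show "\<exists>B\<in>bases \<I>. A \<subseteq> E - B" using X(2) A by blast
  qed
  then show "A \<in> dual_indep E \<I> \<longleftrightarrow> A \<in> {A. A \<subseteq> E \<and> E - A \<in> Pow E - nonspanning E \<I>}"
    by (auto simp: dual_indep_def nonspanning_def)
qed

lemma rk_aut:
  assumes g: "g permutes E" "\<forall>A\<subseteq>E. g ` A \<in> \<I> \<longleftrightarrow> A \<in> \<I>" and A: "A \<subseteq> E"
  shows "rk \<I> (g ` A) = rk \<I> A"
proof (rule antisym)
  have card: "card (g ` X) = card X" for X
    by (rule card_image[OF inj_on_subset[OF permutes_inj[OF g(1)] subset_UNIV]])
  obtain Y where Y: "Y \<in> \<I>" "Y \<subseteq> g ` A" "card Y = rk \<I> (g ` A)" using rk_attained by blast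
  obtain X where X: "X \<subseteq> A" "Y = g ` X" using Y(2) by (meson subset_imageE)
  have "X \<in> \<I>" using g(2) X Y(1) A by blast
  then show "rk \<I> (g ` A) \<le> rk \<I> A" using card_le_rk[of X A] X card[of X] Y(3) by simp
  obtain Z where Z: "Z \<in> \<I>" "Z \<subseteq> A" "card Z = rk \<I> A" using rk_attained by blast
  have "g ` Z \<in> \<I>" using g(2) Z A by blast
  then show "rk \<I> A \<le> rk \<I> (g ` A)" using card_le_rk[of "g ` Z" "g ` A"] Z card[of Z] by auto
qed

lemma nonspanning_aut:
  assumes g: "g permutes E" "\<forall>A\<subseteq>E. g ` A \<in> \<I> \<longleftrightarrow> A \<in> \<I>" and A: "A \<subseteq> E"
  shows "g ` A \<in> nonspanning E \<I> \<longleftrightarrow> A \<in> nonspanning E \<I>"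
proof -
  have "g ` A \<subseteq> E" using image_mono[OF A, of g] permutes_image[OF g(1)] by simp
  then show ?thesis using rk_aut[OF assms] A by (simp add: nonspanning_def)
qed

lemma flats_aut:
  assumes g: "g permutes E" "\<forall>A\<subseteq>E. g ` A \<in> \<I> \<longleftrightarrow> A \<in> \<I>" and F: "F \<in> flats E \<I>"
  shows "g ` F \<in> flats E \<I>"
proof -
  have FE: "F \<subseteq> E" using F by (simp add: flats_def)
  have "rk \<I> (g ` F) < rk \<I> (insert x (g ` F))" if x: "x \<in> E - g ` F" for x
  proof -
    obtain y where y: "x = g y" "y \<in> E" using x permutes_image[OF g(1)] by blast
    then have "y \<in> E - F" using x by blast
    then have "rk \<I> F < rk \<I> (insert y F)" using F by (simp add: flats_def)
    then show ?thesis
      using rk_aut[OF g FE] rk_aut[OF g, of "insert y F"] y FE by simp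
  qed
  moreover have "g ` F \<subseteq> E" using image_mono[OF FE, of g] permutes_image[OF g(1)] by simp
  ultimately show ?thesis by (simp add: flats_def)
qed

end

lemma simple_matroid_indep:
  assumes "simple_matroid E \<I>" "x \<in> E"
  shows "{x} \<in> \<I>"
  using assms by (auto simp: simple_matroid_def)

text \<open>
  Simplicity enters here: without loops, the empty set is the least flat.
\<close>

lemma proper_flats_iff:
  assumes "simple_matroid E \<I>"
  shows "F \<in> proper_part (flats E \<I>) \<longleftrightarrow> F \<in> flats E \<I> \<and> F \<noteq> {} \<and> F \<noteq> E"
proof -
  interpret matroid E \<I> using assms by (simp add: simple_matroid_def)
  have "rk \<I> {} = 0" using rk_le_card[of "{}"] by simp
  moreover have "1 \<le> rk \<I> {x}" if "x \<in> E" for x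
    using card_le_rk[OF simple_matroid_indep[OF assms that], of "{x}"] by simp
  ultimately have bot: "{} \<in> flats E \<I>" by (force simp: flats_def)
  have sub: "F' \<subseteq> E" if "F' \<in> flats E \<I>" for F' using that by (simp add: flats_def)
  show ?thesis
    using bot ground_flat sub unfolding proper_part_def by blast
qed

section \<open>The three homology representations of a simple matroid\<close>

lemma closed_faces_nonspanning:
  assumes "simple_matroid E \<I>" "E \<noteq> {}"
  shows "closed_faces E (nonspanning E \<I>) (proper_part (flats E \<I>)) (matroid.closure E \<I>)"
proof -
  interpret matroid E \<I> using assms by (simp add: simple_matroid_def)
  note proper = proper_flats_iff[OF assms(1)]
  obtain x where x: "x \<in> E" using assms(2) by blast
  have "0 < rk \<I> E"
    using card_le_rk[OF simple_matroid_indep[OF assms(1) x], of E] x by simp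
  then have empty: "{} \<in> nonspanning E \<I>" using rk_le_card[of "{}"] by (simp add: nonspanning_def)
  show ?thesis
  proof
    show "proper_part (flats E \<I>) \<subseteq> nonspanning E \<I>"
    proof
      fix F assume "F \<in> proper_part (flats E \<I>)"
      then have F: "F \<in> flats E \<I>" "F \<noteq> E" using proper by auto
      then have "F \<subset> E" by (auto simp: flats_def)
      then show "F \<in> nonspanning E \<I>" using rk_flat_less[OF F(1)] by (auto simp: nonspanning_def)
    qed
  next
    fix A assume A: "A \<in> nonspanning E \<I>" "A \<noteq> {}"
    have AE: "A \<subseteq> E" "rk \<I> A < rk \<I> E" using A(1) by (auto simp: nonspanning_def)
    have "closure A \<noteq> E" using rk_closure[OF AE(1)] AE(2) by auto
    then show "closure A \<in> proper_part (flats E \<I>)"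
      using closure_flat[OF AE(1)] subset_closure[OF AE(1)] A(2) proper by auto
    show "closure A \<subseteq> F \<longleftrightarrow> A \<subseteq> F" if "F \<in> proper_part (flats E \<I>)" for F
      by (rule closure_least[OF AE(1)]) (use that proper in auto)
  qed (use finite_ground nonspanning_sub down_closed_nonspanning empty proper in auto)
qed

text \<open>
  The rank is injective on a chain of flats and takes values between \<open>1\<close> and \<open>rk \<I> E - 1\<close> on proper ones.
\<close>

lemma card_chain_of_flats:
  assumes "simple_matroid E \<I>" "E \<noteq> {}" "C \<in> order_complex (proper_part (flats E \<I>))"
  shows "card C < rk \<I> E"
proof -
  interpret matroid E \<I> using assms by (simp add: simple_matroid_def)
  note proper = proper_flats_iff[OF assms(1)]
  have C: "C \<subseteq> proper_part (flats E \<I>)" "\<And>X Y. X \<in> C \<Longrightarrow> Y \<in> C \<Longrightarrow> X \<subseteq> Y \<or> Y \<subseteq> X"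
    using assms(3) by (auto simp: order_complex_iff)
  have flat: "F \<in> flats E \<I>" "F \<subset> E" "F \<noteq> {}" if "F \<in> C" for F
    using that C(1) proper by (auto simp: flats_def)
  have pos: "1 \<le> rk \<I> F" if F: "F \<in> C" for F
  proof -
    obtain x where "x \<in> F" "x \<in> E" using flat(2,3)[OF F] by blast
    then show ?thesis using card_le_rk[OF simple_matroid_indep[OF assms(1)], of x F] by simp
  qed
  have "inj_on (rk \<I>) C"
  proof (rule inj_onI)
    fix X Y assume XY: "X \<in> C" "Y \<in> C" "rk \<I> X = rk \<I> Y"
    show "X = Y"
    proof (rule ccontr)
      assume "X \<noteq> Y"
      then have "X \<subset> Y \<or> Y \<subset> X" using C(2)[OF XY(1,2)] by blast
      then show False using rk_flat_less flat XY by (metis less_irrefl psubset_imp_subset)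
    qed
  qed
  moreover have "rk \<I> ` C \<subseteq> {1..<rk \<I> E}"
    using pos rk_flat_less[of _ E] flat by auto
  ultimately have "card C \<le> card {1..<rk \<I> E}" by (intro card_inj_on_le) auto
  moreover obtain x where x: "x \<in> E" using assms(2) by blast
  have "1 \<le> rk \<I> E"
    using card_le_rk[OF simple_matroid_indep[OF assms(1) x], of E] x by simp
  ultimately show ?thesis by simp
qed

lemma cycles_trivial:
  assumes "\<And>\<sigma>. \<sigma> \<in> \<Delta> \<Longrightarrow> int (card \<sigma>) \<noteq> k + 1"
  shows "cycles \<Delta> k \<subseteq> boundaries \<Delta> k"
proof
  fix c assume "c \<in> cycles \<Delta> k"
  then have c: "c \<in> chains \<Delta> k" by (rule cyclesD)
  have "c l = 0" for l
  proof (rule ccontr)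
    assume nz: "c l \<noteq> 0"
    then have "distinct l" using alternating_nondistinct[OF chains_alternating[OF c]] by metis
    then have "int (card (set l)) = k + 1" using chainsD[OF c nz] by (simp add: distinct_card)
    then show False using chainsD[OF c nz] assms by blast
  qed
  then have "c = (\<lambda>_. 0)" by (rule ext)
  then show "c \<in> boundaries \<Delta> k" by simp
qed

text \<open>
  A cycle of degree \<open>i\<close> is filled in the full simplex by a chain whose faces have \<open>i + 2\<close> elements; when this is
  less than the rank, all of them are nonspanning.
\<close>

lemma nonspanning_low_cycles:
  assumes "simple_matroid E \<I>" "E \<noteq> {}" "i < int (rk \<I> E) - 2"
  shows "cycles (nonspanning E \<I>) i \<subseteq> boundaries (nonspanning E \<I>) i"
proof
  interpret matroid E \<I> using assms by (simp add: simple_matroid_def)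
  interpret vertex_set E by standard (rule finite_ground)
  fix x assume x: "x \<in> cycles (nonspanning E \<I>) i"
  obtain c where c: "c \<in> chains (Pow E) (i + 1)" "boundary c = x"
    using Pow_acyclic[OF assms(2) chains_mono[OF cyclesD(1)[OF x] nonspanning_sub] cyclesD(2)[OF x]] by blast
  have "c \<in> chains (nonspanning E \<I>) (i + 1)"
  proof (rule chainsI[OF chains_alternating[OF c(1)] nonspanning_sub])
    fix l assume nz: "c l \<noteq> 0"
    have "rk \<I> (set l) \<le> length l" using rk_le_card[of "set l"] card_length[of l] by simp
    then have "rk \<I> (set l) < rk \<I> E" using chainsD[OF c(1) nz] assms(3) by linarith
    then show "set l \<in> nonspanning E \<I> \<and> int (length l) = i + 1 + 1"
      using chainsD[OF c(1) nz] by (simp add: nonspanning_def)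
  qed
  then show "x \<in> boundaries (nonspanning E \<I>) i" using c(2) by (auto simp: boundaries_def)
qed

lemma rep_iso_zero_homology:
  assumes "finite V1" "finite V2" "\<Delta>1 \<subseteq> Pow V1" "\<Delta>2 \<subseteq> Pow V2"
    and "\<And>g. g \<in> G \<Longrightarrow> bij (\<phi>1 g) \<and> (\<forall>\<sigma>\<in>\<Delta>1. \<phi>1 g ` \<sigma> \<in> \<Delta>1)"
    and "\<And>g. g \<in> G \<Longrightarrow> bij (\<phi>2 g) \<and> (\<forall>\<sigma>\<in>\<Delta>2. \<phi>2 g ` \<sigma> \<in> \<Delta>2)"
    and z: "cycles \<Delta>1 k1 \<subseteq> boundaries \<Delta>1 k1" "cycles \<Delta>2 k2 \<subseteq> boundaries \<Delta>2 k2"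
  shows "rep_iso G (tensor_character (homology_rep \<phi>1 \<Delta>1 k1) \<chi>) (homology_rep \<phi>2 \<Delta>2 k2)"
  by (rule rep_iso_of_correspondence[OF assms(1-6), where T = "{(\<lambda>_. 0, \<lambda>_. 0)}"])
    (use z in \<open>auto simp: chain_map_def\<close>)

lemma rep_zero_in_homology: "rep_zero (homology_rep \<phi> \<Delta> k) \<in> rep_space (homology_rep \<phi> \<Delta> k)"
  unfolding rep_space_homology by (auto simp: homology_rep_def intro: imageI)

theorem mainTheorem1:
  fixes E :: "'a set" and \<I> :: "'a set set" and G :: "('a \<Rightarrow> 'a) set"
    and n r :: nat and i :: int
  assumes "simple_matroid E \<I>"
    and "card E = n"
    and "rk \<I> E = r"
    and "subgroup G (matroid_aut E \<I>)"
    and "0 \<le> i"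
  shows "rep_iso G (tensor_character (dual_indep_homology E \<I> (int n - 3 - i)) sgn_character)
           (nonspanning_homology E \<I> i)
       \<and> rep_iso G (nonspanning_homology E \<I> i) (flats_homology E \<I> i)
       \<and> (i \<noteq> int r - 2 \<longrightarrow>
            zero_rep (tensor_character (dual_indep_homology E \<I> (int n - 3 - i)) sgn_character)
          \<and> zero_rep (nonspanning_homology E \<I> i)
          \<and> zero_rep (flats_homology E \<I> i))"
proof -
  interpret matroid E \<I> using assms(1) by (simp add: simple_matroid_def)
  interpret vertex_set E by standard (rule finite_ground)
  let ?N = "nonspanning E \<I>" and ?P = "proper_part (flats E \<I>)" and ?D = "dual_indep E \<I>"
  let ?j = "int n - 3 - i"
  note proper = proper_flats_iff[OF assms(1)]
  have g: "g permutes E" "\<forall>A\<subseteq>E. g ` A \<in> \<I> \<longleftrightarrow> A \<in> \<I>" if "g \<in> G" for g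
    using subgroup.subset[OF assms(4)] that by (auto simp: matroid_aut_def)
  have actN: "\<forall>A\<subseteq>E. g ` A \<in> ?N \<longleftrightarrow> A \<in> ?N" if "g \<in> G" for g
    using nonspanning_aut[OF g[OF that]] by blast
  have actP: "g ` F \<in> ?P" if "g \<in> G" "F \<in> ?P" for g F
  proof -
    have "g ` F = E \<Longrightarrow> F = E"
      using permutes_image[OF g(1)[OF that(1)]] inj_image_eq_iff[OF permutes_inj[OF g(1)[OF that(1)]]] by metis
    then show ?thesis using flats_aut[OF g[OF that(1)]] that(2) proper by auto
  qed
  have D_eq: "?D = complements (Pow E - ?N)"
    by (simp add: dual_indep_eq complements_def)
  have P_sub: "order_complex ?P \<subseteq> Pow ?P" by (auto simp: order_complex_iff)
  have P_fin: "finite ?P"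
    by (rule finite_subset[of _ "Pow E"]) (use finite_ground proper in \<open>auto simp: flats_def\<close>)
  have iso: "rep_iso G (tensor_character (homology_rep (\<lambda>g. g) ?D ?j) sgn_character) (homology_rep (\<lambda>g. g) ?N i)
    \<and> rep_iso G (homology_rep (\<lambda>g. g) ?N i) (homology_rep (\<lambda>g F. g ` F) (order_complex ?P) i)
    \<and> (i \<noteq> int r - 2 \<longrightarrow> zero_rep (homology_rep (\<lambda>g. g) ?N i))"
  proof (cases "E = {}")
    case False
    interpret C: closed_faces E ?N ?P closure by (rule closed_faces_nonspanning[OF assms(1) False])
    have "rep_iso G (tensor_character (homology_rep (\<lambda>g. g) ?D ?j) sgn_character) (homology_rep (\<lambda>g. g) ?N i)"
      unfolding D_eq assms(2)[symmetric]
      by (rule alexander_duality[OF nonspanning_sub down_closed_nonspanning False]) (use g(1) actN in blast)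
    moreover have iso2: "rep_iso G (homology_rep (\<lambda>g. g) ?N i) (homology_rep (\<lambda>g F. g ` F) (order_complex ?P) i)"
    proof (rule C.rep_iso_closed_faces, intro conjI ballI)
      fix h assume h: "h \<in> G"
      show "bij h" using g(1)[OF h] by (rule permutes_bij)
      show "h ` A \<in> ?N" if "A \<in> ?N" for A using actN[OF h] that nonspanning_sub by blast
      show "h ` F \<in> ?P" if "F \<in> ?P" for F by (rule actP[OF h that])
    qed
    moreover have "zero_rep (homology_rep (\<lambda>g. g) ?N i)" if "i \<noteq> int r - 2"
    proof (cases "i < int r - 2")
      case True
      then show ?thesis
        using zero_homology_rep_iff[OF nonspanning_sub] nonspanning_low_cycles[OF assms(1) False] assms(3) by blast
    next
      case ge: False
      interpret B: vertex_set ?P by standard (rule P_fin)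
      have "cycles (order_complex ?P) i \<subseteq> boundaries (order_complex ?P) i"
      proof (rule cycles_trivial)
        fix C assume "C \<in> order_complex ?P"
        then show "int (card C) \<noteq> i + 1"
          using card_chain_of_flats[OF assms(1) False, of C] ge that assms(3) by linarith
      qed
      then have "zero_rep (homology_rep (\<lambda>g F. g ` F) (order_complex ?P) i)"
        using B.zero_homology_rep_iff[OF P_sub] by blast
      then show ?thesis using zero_rep_transfer[OF iso2 rep_zero_in_homology rep_zero_in_homology] by blast
    qed
    ultimately show ?thesis by blast
  next
    case True
    \<comment> \<open>The rank is \<open>0\<close>; there are no nonspanning sets, but the order complex and the dual
      independence complex consist of the empty face. All three homology groups vanish in the degrees in question.\<close>
    have n: "n = 0" using assms(2) True by simp
    have P: "?P = {}" using proper True by (auto simp: flats_def)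
    have zD: "cycles ?D ?j \<subseteq> boundaries ?D ?j"
      by (rule cycles_trivial) (use n assms(5) in auto)
    have zN: "cycles ?N i \<subseteq> boundaries ?N i"
    proof (rule cycles_trivial)
      fix A assume "A \<in> ?N"
      then show "int (card A) \<noteq> i + 1" using True assms(5) by (auto simp: nonspanning_def)
    qed
    have zP: "cycles (order_complex ?P) i \<subseteq> boundaries (order_complex ?P) i"
      by (rule cycles_trivial) (use P assms(5) in \<open>auto simp: order_complex_iff\<close>)
    have gid: "h = id" if "h \<in> G" for h using g(1)[OF that] True by simp
    have act1: "bij h \<and> (\<forall>\<sigma>\<in>\<Delta>. h ` \<sigma> \<in> \<Delta>)" if "h \<in> G" for h \<Delta>
      using gid[OF that] by simp
    have act2: "bij ((`) h) \<and> (\<forall>\<sigma>\<in>\<Delta>. (`) h ` \<sigma> \<in> \<Delta>)" if "h \<in> G" for h \<Delta>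
      using gid[OF that] by simp
    have D_sub: "?D \<subseteq> Pow E" by (auto simp: dual_indep_def)
    have 1: "rep_iso G (tensor_character (homology_rep (\<lambda>g. g) ?D ?j) sgn_character) (homology_rep (\<lambda>g. g) ?N i)"
      by (rule rep_iso_zero_homology[OF finite_ground finite_ground D_sub nonspanning_sub act1 act1 zD zN])
    have 2: "rep_iso G (homology_rep (\<lambda>g. g) ?N i) (homology_rep (\<lambda>g F. g ` F) (order_complex ?P) i)"
      by (rule rep_iso_untensor[OF finite_ground nonspanning_sub act1
            rep_iso_zero_homology[OF finite_ground P_fin nonspanning_sub P_sub act1 act2 zN zP]])
    show ?thesis using 1 2 zero_homology_rep_iff[OF nonspanning_sub] zN by blast
  qed
  then have iso1: "rep_iso G (tensor_character (homology_rep (\<lambda>g. g) ?D ?j) sgn_character) (homology_rep (\<lambda>g. g) ?N i)"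
    and iso2: "rep_iso G (homology_rep (\<lambda>g. g) ?N i) (homology_rep (\<lambda>g F. g ` F) (order_complex ?P) i)"
    and vanish: "i \<noteq> int r - 2 \<longrightarrow> zero_rep (homology_rep (\<lambda>g. g) ?N i)"
    by blast+
  have "rep_zero (tensor_character V \<chi>) \<in> rep_space (tensor_character V \<chi>)"
    if "rep_zero V \<in> rep_space V" for V :: "('a \<Rightarrow> 'a, ('a list \<Rightarrow> complex) set) complex_rep" and \<chi>
    using that by (simp add: tensor_character_def)
  note zero1 = zero_rep_transfer[OF iso1 this[OF rep_zero_in_homology] rep_zero_in_homology]
  note zero2 = zero_rep_transfer[OF iso2 rep_zero_in_homology rep_zero_in_homology]
  show ?thesis
    unfolding dual_indep_homology_def nonspanning_homology_def flats_homology_def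
    using iso1 iso2 vanish zero1 zero2 by blast
qed

end
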